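(* Let $G$ be a directed acyclic graph and let $\Theta(G)\subseteq\mathrm{PD}_m$ be the associated Gaussian model. The maximum likelihood degree of $\Theta(G)$ is one. Therefore, for every $\Sigma\in\Theta(G)$, the logarithmic Voronoi cell of $\Sigma$ is equal to its log-normal spectrahedron: $\log\mathrm{Vor}_{\Theta(G)}(\Sigma)=\mathcal K_{\Theta(G)}(\Sigma)$.
   Context: $\mathrm{PD}_m$ is the cone of real symmetric positive definite $m\times m$ matrices. Gaussian model on a DAG: $G$ has vertex set $[m]=\{1,\dots,m\}$ and edge set $E$ of directed edges $(i,j)$, with no directed cycle, the vertices being topologically ordered so that $(i,j)\in E$ implies $i<j$. The model $\Theta(G)$ consists of all matrices $\Sigma=(I-\Lambda)^{-T}\Omega(I-\Lambda)^{-1}$, where $\Lambda=(\lambda_{ij})$ is a real $m\times m$ matrix with $\lambda_{ij}=0$ unless $(i,j)\in E$ (so $\Lambda$ is strictly upper triangular), and $\Omega$ is a diagonal matrix with positive diagonal entries. A positive integer $n$ is fixed and $\ell_n(\Sigma,S)=-\frac n2\log\det\Sigma-\frac n2\mathrm{tr}(S\Sigma^{-1})$. For a model $\Theta\subseteq\mathrm{PD}_m$ and $\Sigma\in\Theta$, the logarithmic Voronoi cell is $\log\mathrm{Vor}_\Theta(\Sigma)=\{S\in\mathrm{PD}_m:\ \ell_n(\Sigma,S)\ge \ell_n(\Sigma',S)\text{ for all }\Sigma'\in\Theta\}$. A point $\Sigma$ of $\Theta$ is a critical point of $\ell_n(\cdot,S)$ on $\Theta$ if the gradient of $\ell_n(\cdot,S)$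 at $\Sigma$ lies in the normal space of $\Theta$ at $\Sigma$ (the orthogonal complement, with respect to the trace inner product on symmetric matrices, of the tangent space). The log-normal matrix space $\mathcal N_\Sigma\Theta$ is the affine linear space of all real symmetric $m\times m$ matrices $S$ such that $\Sigma$ is a critical point of $\ell_n(\cdot,S)$ on $\Theta$; the log-normal spectrahedron at $\Sigma$ is $\mathcal K_\Theta(\Sigma)=\mathrm{PD}_m\cap\mathcal N_\Sigma\Theta$. The maximum likelihood degree of $\Theta$ is the number of nonsingular complex critical points of $\ell_n(\cdot,S)$, for generic $S$, on the Zariski closure of $\Theta$ in the space of complex symmetric $m\times m$ matrices. *)

theory Defs
  imports "HOL-Analysis.Analysis"
begin

text \<open>
  The vertex set \<open>[m]\<close> is rendered as a finite linearly ordered index type \<open>'m\<close>, so that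
  \<open>m \<times> m\<close> matrices over a field \<open>'a\<close> have type \<open>'a^'m^'m\<close>.
\<close>

definition sym_mats :: "('a^'m^'m) set" where
  "sym_mats = {A. transpose A = A}"

definition PD :: "(real^'m^'m) set" where
  "PD = {A \<in> sym_mats. \<forall>x. x \<noteq> 0 \<longrightarrow> x \<bullet> (A *v x) > 0}"

definition topologically_ordered_dag :: "('m::linorder \<times> 'm) set \<Rightarrow> bool" where
  "topologically_ordered_dag E \<longleftrightarrow> acyclic E \<and> (\<forall>i j. (i, j) \<in> E \<longrightarrow> i < j)"

definition dag_model :: "('m::{finite,linorder} \<times> 'm) set \<Rightarrow>
    (real^'m::{finite,linorder}^'m::{finite,linorder}) set" where
  "dag_model E =
     {matrix_inv (transpose (mat 1 - \<Lambda>)) ** \<Omega> ** matrix_inv (mat 1 - \<Lambda>) | \<Lambda> \<Omega>.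
        (\<forall>i j. (i, j) \<notin> E \<longrightarrow> \<Lambda> $ i $ j = 0) \<and>
        (\<forall>i j. i \<noteq> j \<longrightarrow> \<Omega> $ i $ j = 0) \<and> (\<forall>i. \<Omega> $ i $ i > 0)}"

definition loglik :: "nat \<Rightarrow> real^'m^'m \<Rightarrow> real^'m^'m \<Rightarrow> real" where
  "loglik n \<Sigma> S = - (real n / 2) * ln (det \<Sigma>) - (real n / 2) * trace (S ** matrix_inv \<Sigma>)"

definition log_Voronoi :: "nat \<Rightarrow> (real^'m^'m) set \<Rightarrow> real^'m^'m \<Rightarrow> (real^'m^'m) set" where
  "log_Voronoi n \<Theta> \<Sigma> = {S \<in> PD. \<forall>\<Sigma>'\<in>\<Theta>. loglik n \<Sigma> S \<ge> loglik n \<Sigma>' S}"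

text \<open>
  Gradients and normal spaces live in the space of symmetric matrices and are taken with respect
  to the trace form \<open>(A, B) \<mapsto> trace (A ** B)\<close>. Over the complex numbers this is the bilinear form,
  not the Hermitian one; a derivative of the shape \<open>H \<mapsto> trace (g ** H)\<close> is complex linear.
\<close>

definition is_sym_gradient ::
    "('a::real_normed_field^'m^'m \<Rightarrow> 'a) \<Rightarrow> 'a^'m^'m \<Rightarrow> 'a^'m^'m \<Rightarrow> bool" where
  "is_sym_gradient f A g \<longleftrightarrow>
     g \<in> sym_mats \<and> (f has_derivative (\<lambda>H. trace (g ** H))) (at A within sym_mats)"

definition sym_orthogonal :: "('a::comm_ring_1^'m^'m) set \<Rightarrow> ('a^'m^'m) set" where
  "sym_orthogonal V = {N \<in> sym_mats. \<forall>T\<in>V. trace (N ** T) = 0}"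

text \<open>Tangent vectors of a (smooth) model are the velocities of curves inside the model.\<close>

definition tangent_space :: "(real^'m^'m) set \<Rightarrow> real^'m^'m \<Rightarrow> (real^'m^'m) set" where
  "tangent_space \<Theta> \<Sigma> =
     {v. \<exists>\<gamma> \<epsilon>. \<epsilon> > 0 \<and> (\<forall>t. \<bar>t\<bar> < \<epsilon> \<longrightarrow> \<gamma> t \<in> \<Theta>) \<and> \<gamma> 0 = \<Sigma> \<and>
          (\<gamma> has_vector_derivative v) (at 0)}"

definition critical_point :: "nat \<Rightarrow> (real^'m^'m) set \<Rightarrow> real^'m^'m \<Rightarrow> real^'m^'m \<Rightarrow> bool" where
  "critical_point n \<Theta> S \<Sigma> \<longleftrightarrow> \<Sigma> \<in> \<Theta> \<and>
     (\<exists>g. is_sym_gradient (\<lambda>A. loglik n A S) \<Sigma> g \<and> g \<in> sym_orthogonal (tangent_space \<Theta> \<Sigma>))"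

definition log_normal_space :: "nat \<Rightarrow> (real^'m^'m) set \<Rightarrow> real^'m^'m \<Rightarrow> (real^'m^'m) set" where
  "log_normal_space n \<Theta> \<Sigma> = {S \<in> sym_mats. critical_point n \<Theta> S \<Sigma>}"

definition log_normal_spectrahedron ::
    "nat \<Rightarrow> (real^'m^'m) set \<Rightarrow> real^'m^'m \<Rightarrow> (real^'m^'m) set" where
  "log_normal_spectrahedron n \<Theta> \<Sigma> = PD \<inter> log_normal_space n \<Theta> \<Sigma>"

text \<open>Polynomial functions in the entries of a complex matrix.\<close>

inductive matrix_poly :: "(complex^'m^'m \<Rightarrow> complex) \<Rightarrow> bool" where
  const: "matrix_poly (\<lambda>_. c)"
| entry: "matrix_poly (\<lambda>A. A $ i $ j)"
| add: "matrix_poly p \<Longrightarrow> matrix_poly q \<Longrightarrow> matrix_poly (\<lambda>A. p A + q A)"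
| mult: "matrix_poly p \<Longrightarrow> matrix_poly q \<Longrightarrow> matrix_poly (\<lambda>A. p A * q A)"

definition vanishing_ideal :: "(complex^'m^'m) set \<Rightarrow> (complex^'m^'m \<Rightarrow> complex) set" where
  "vanishing_ideal X = {p. matrix_poly p \<and> (\<forall>Z\<in>X. p Z = 0)}"

definition complexify :: "real^'m^'m \<Rightarrow> complex^'m^'m" where
  "complexify A = (\<chi> i j. complex_of_real (A $ i $ j))"

definition zariski_closure :: "(real^'m^'m) set \<Rightarrow> (complex^'m^'m) set" where
  "zariski_closure \<Theta> =
     {Z \<in> sym_mats. \<forall>p \<in> vanishing_ideal (complexify ` \<Theta>). p Z = 0}"

definition zariski_tangent_space ::
    "(complex^'m^'m) set \<Rightarrow> complex^'m^'m \<Rightarrow> (complex^'m^'m) set" where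
  "zariski_tangent_space X Z =
     {T \<in> sym_mats. \<forall>p \<in> vanishing_ideal X. frechet_derivative p (at Z) T = 0}"

text \<open>
  \<open>Z\<close> is a nonsingular point of the variety \<open>X\<close> if near \<open>Z\<close> the variety is cut out by polynomials
  from its ideal whose differentials at \<open>Z\<close> are linearly independent over the complex numbers
  (Jacobian criterion; the number of these polynomials is the local codimension of \<open>X\<close> in the
  space of all matrices, the equations expressing symmetry included).
\<close>

definition nonsingular_point :: "(complex^'m^'m) set \<Rightarrow> complex^'m^'m \<Rightarrow> bool" where
  "nonsingular_point X Z \<longleftrightarrow> Z \<in> X \<and>
     (\<exists>F U. finite F \<and> F \<subseteq> vanishing_ideal X \<and> open U \<and> Z \<in> U \<and>
        {W \<in> U. \<forall>f\<in>F. f W = 0} \<subseteq> X \<and>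
        (\<forall>c. (\<forall>T. (\<Sum>f\<in>F. c f * frechet_derivative f (at Z) T) = 0) \<longrightarrow> (\<forall>f\<in>F. c f = 0)))"

text \<open>
  On complex matrices the log-likelihood is multivalued. A gradient at \<open>Z\<close> is the gradient of
  the function obtained from any continuous branch \<open>L\<close> of \<open>log det\<close> near \<open>Z\<close>; the existence of a
  branch forces \<open>det Z \<noteq> 0\<close>, and branches differ locally by constants.
\<close>

definition is_complex_score ::
    "nat \<Rightarrow> complex^'m^'m \<Rightarrow> complex^'m^'m \<Rightarrow> complex^'m^'m \<Rightarrow> bool" where
  "is_complex_score n S Z g \<longleftrightarrow>
     (\<exists>U L. open U \<and> Z \<in> U \<and> continuous_on U L \<and> (\<forall>W\<in>U. exp (L W) = det W) \<and>
        is_sym_gradient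
          (\<lambda>W. - (of_nat n / 2) * L W - (of_nat n / 2) * trace (S ** matrix_inv W)) Z g)"

definition nonsingular_complex_critical_points ::
    "nat \<Rightarrow> (complex^'m^'m) set \<Rightarrow> complex^'m^'m \<Rightarrow> (complex^'m^'m) set" where
  "nonsingular_complex_critical_points n X S =
     {Z. nonsingular_point X Z \<and>
         (\<exists>g. is_complex_score n S Z g \<and> g \<in> sym_orthogonal (zariski_tangent_space X Z))}"

text \<open>
  \<open>generic S\<close> means: for all complex symmetric \<open>S\<close> outside the zero set of some polynomial that
  does not vanish identically on the symmetric matrices.
\<close>

definition has_ML_degree :: "nat \<Rightarrow> (real^'m^'m) set \<Rightarrow> nat \<Rightarrow> bool" where
  "has_ML_degree n \<Theta> d \<longleftrightarrow>
     (\<exists>h. matrix_poly h \<and> (\<exists>S\<in>sym_mats. h S \<noteq> 0) \<and>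
        (\<forall>S\<in>sym_mats. h S \<noteq> 0 \<longrightarrow>
           finite (nonsingular_complex_critical_points n (zariski_closure \<Theta>) S) \<and>
           card (nonsingular_complex_critical_points n (zariski_closure \<Theta>) S) = d))"

end

theory Submission
  imports Defs
begin

text \<open>Write \<open>B = 1 - \<Lambda>\<close> and \<open>A = B\<^sup>-\<^sup>1\<close>, so that a point of the model is \<open>\<Sigma> = A\<^sup>T \<Omega> A\<close>, and \<open>B\<^sup>T \<Sigma> = \<Omega> A\<close>
is upper triangular. The velocities of the parametrisation at \<open>\<Sigma>\<close> pair with a symmetric \<open>g\<close>
through the entries of \<open>A g \<Sigma>\<close> at the edges and the diagonal of \<open>A g A\<^sup>T\<close>. If \<open>g\<close> is the score at
\<open>\<Sigma>\<close> for data \<open>S\<close>, then \<open>S = \<Sigma> + (2/n) \<Sigma> g \<Sigma>\<close>, and orthogonality of \<open>g\<close> to these velocities becomes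
the normal equations of linear regression: column \<open>j\<close> of \<open>\<Lambda>\<close> regresses vertex \<open>j\<close> on its parents
under the covariance \<open>S\<close>, and \<open>\<Omega>\<close> holds the residual variances (\<open>normal_equationsI\<close>,
\<open>normal_equationsD\<close>). These equations are linear in \<open>\<Lambda>\<close> and then explicit in \<open>\<Omega>\<close>. When the blocks
of \<open>S\<close> on the parent sets are invertible they have exactly one solution, rational in \<open>S\<close>; the
point with these parameters is called \<open>mle E S\<close> below.

For real positive definite \<open>S\<close> a solution of the normal equations is a global maximiser: the
regression minimises every residual variance, and \<open>ln x \<le> x - 1\<close> does the rest
(\<open>normal_equations_imp_max\<close>). Conversely a maximiser is critical by differentiating along curves.
So critical points and maximisers agree, which is the equality of the Voronoi cell and the
spectrahedron.

For the maximum likelihood degree, the difficulty is that the Zariski closure contains points at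
which some parent block is singular and which need not come from the parametrisation. They
are handled by a polynomial identity. A normal covector at any point \<open>Z\<close> of the closure is the
symmetric gradient at \<open>Z\<close> of a single polynomial \<open>p\<close> of the ideal
(\<open>normal_covector_is_differential\<close>). With \<open>T W = W + (2/n) W (grad p W) W\<close>, a polynomial in \<open>W\<close>, a
point \<open>W\<close> of the model is critical for the data \<open>T W\<close>, so \<open>W\<close> and \<open>T W\<close> satisfy the normal equations
cleared of denominators. Being polynomial in \<open>W\<close>, this relation extends from the model to its
closure, and at \<open>Z\<close> it says that \<open>Z\<close> is the \<open>mle\<close> of \<open>T Z = S\<close> as soon as the parent blocks of \<open>S\<close> are
invertible (\<open>critical_point_eq_mle\<close>).

Existence for generic \<open>S\<close> needs that \<open>mle E S\<close> lies on the closure, that it is a nonsingular point and that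
the Zariski tangent space there consists of velocities. The first holds because positive real
parameters are Zariski dense. For the other two, the closure is cut out near a point with
invertible parent blocks by symmetry and by the vanishing of the partial covariances of
nonadjacent pairs given the parents of the later vertex; these equations have a triangular
Jacobian (\<open>nonsingular_point_sem_cov\<close>, \<open>zariski_tangent_is_velocity\<close>).\<close>

section \<open>Matrices over a field\<close>

text \<open>The infix notation for vector types attaches the sort \<open>finite\<close> to a bare index variable, which
clashes with an index type that is fixed with a larger sort; the synonym leaves the sort open.\<close>

type_synonym ('a, 'm) square_matrix = "(('a, 'm) vec, 'm) vec"

lemma matrix_mult_entry: "(A ** B) $ i $ j = (\<Sum>k\<in>UNIV. A $ i $ k * B $ k $ j)"
  by (simp add: matrix_matrix_mult_def)

lemma transpose_entry [simp]: "transpose A $ i $ j = A $ j $ i"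
  by (simp add: transpose_def)

lemma transpose_add: "transpose (A + B) = transpose A + transpose B"
  by (simp add: vec_eq_iff)

lemma transpose_diff: "transpose (A - B) = transpose A - transpose B"
  by (simp add: vec_eq_iff)

lemma trace_transpose [simp]: "trace (transpose A) = trace A"
  by (simp add: trace_def)

lemma matrix_add_rdistrib:
  fixes A :: "'a::comm_ring_1^'m^'n"
  shows "(A + B) ** C = A ** C + B ** C"
  by (simp add: vec_eq_iff matrix_mult_entry algebra_simps sum.distrib)

lemma matrix_mult_diff:
  fixes A :: "'a::comm_ring_1^'m^'n"
  shows "A ** (B - C) = A ** B - A ** C" "(A - A') ** B = A ** B - A' ** B"
  by (simp_all add: vec_eq_iff matrix_mult_entry algebra_simps sum_subtractf)

lemma matrix_mult_minus:
  fixes A :: "'a::comm_ring_1^'m^'n"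
  shows "A ** (- B) = - (A ** B)" "(- A) ** B = - (A ** B)"
  by (simp_all add: vec_eq_iff matrix_mult_entry sum_negf)

lemma matrix_mult_scaleR:
  fixes A :: "'a::real_algebra_1^'m^'n"
  shows "A ** (c *\<^sub>R B) = c *\<^sub>R (A ** B)" "(c *\<^sub>R A) ** B = c *\<^sub>R (A ** B)"
  by (simp_all add: vec_eq_iff matrix_mult_entry scaleR_sum_right)

lemma sym_mats_iff: "A \<in> sym_mats \<longleftrightarrow> (\<forall>i j. A $ i $ j = A $ j $ i)"
  by (auto simp: sym_mats_def vec_eq_iff)

lemma transpose_sym_mats: "A \<in> sym_mats \<Longrightarrow> transpose A = A"
  by (simp add: sym_mats_def)

lemma sym_mats_congruence:
  fixes A :: "'a::comm_semiring_1^'m^'m"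
  assumes "S \<in> sym_mats"
  shows "A ** S ** transpose A \<in> sym_mats" "transpose A ** S ** A \<in> sym_mats"
  using assms by (simp_all add: sym_mats_def matrix_transpose_mul matrix_mul_assoc)

lemma matrix_inv_cancel:
  fixes A :: "'a::field^'n^'n"
  assumes "det A \<noteq> 0"
  shows "A ** matrix_inv A = mat 1" "matrix_inv A ** A = mat 1"
proof -
  have "\<exists>B. A ** B = mat 1 \<and> B ** A = mat 1"
    using assms by (simp add: invertible_det_nz[symmetric] invertible_def)
  then have "A ** matrix_inv A = mat 1 \<and> matrix_inv A ** A = mat 1"
    unfolding matrix_inv_def by (rule someI_ex)
  then show "A ** matrix_inv A = mat 1" "matrix_inv A ** A = mat 1"
    by auto
qed

lemma matrix_inv_eqI:
  fixes A :: "'a::field^'n^'n"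
  assumes "A ** B = mat 1"
  shows "matrix_inv A = B"
proof -
  have "det A * det B = 1"
    using assms by (metis det_I det_mul)
  then have "det A \<noteq> 0"
    by auto
  then have "B = matrix_inv A ** A ** B"
    by (simp add: matrix_inv_cancel)
  also have "\<dots> = matrix_inv A"
    using assms by (simp add: matrix_mul_assoc[symmetric])
  finally show ?thesis by simp
qed

lemma matrix_mult_left_cancel:
  fixes A :: "'a::field^'n^'n"
  assumes "det A \<noteq> 0"
  shows "A ** X = A ** Y \<longleftrightarrow> X = Y"
  using assms by (metis matrix_inv_cancel(2) matrix_mul_assoc matrix_mul_lid)

lemma matrix_mult_right_cancel:
  fixes A :: "'a::field^'n^'n"
  assumes "det A \<noteq> 0"
  shows "X ** A = Y ** A \<longleftrightarrow> X = Y"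
  using assms by (metis matrix_inv_cancel(1) matrix_mul_assoc matrix_mul_rid)

lemma transpose_matrix_inv:
  fixes A :: "'a::field^'n^'n"
  assumes "det A \<noteq> 0"
  shows "matrix_inv (transpose A) = transpose (matrix_inv A)"
  by (rule matrix_inv_eqI) (simp add: matrix_inv_cancel assms flip: matrix_transpose_mul)

lemma matrix_inv_entry:
  fixes A :: "'a::field^'n^'n"
  assumes "det A \<noteq> 0"
  shows "matrix_inv A $ k $ l
    = det (\<chi> i j. if j = k then mat 1 $ i $ l else A $ i $ j) / det A"
proof -
  let ?x = "column l (matrix_inv A)"
  have "A *v ?x = column l (A ** matrix_inv A)"
    by (simp add: vec_eq_iff column_def matrix_vector_mult_def matrix_mult_entry)
  also have "\<dots> = (\<chi> i. mat 1 $ i $ l)"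
    by (simp add: matrix_inv_cancel assms column_def)
  finally have "A *v ?x = (\<chi> i. mat 1 $ i $ l)" .
  then have "?x = (\<chi> k. det (\<chi> i j. if j = k then (\<chi> i. mat 1 $ i $ l) $ i else A $ i $ j) / det A)"
    using cramer[OF assms] by blast
  then have "?x $ k = (\<chi> k. det (\<chi> i j. if j = k then (\<chi> i. mat 1 $ i $ l) $ i else A $ i $ j) / det A) $ k"
    by (rule arg_cong)
  then show ?thesis
    by (simp only: column_def vec_lambda_beta)
qed

lemma matrix_inv_sym_mats:
  fixes A :: "'a::field^'n^'n"
  assumes "A \<in> sym_mats" "det A \<noteq> 0"
  shows "matrix_inv A \<in> sym_mats"
  using assms by (simp add: sym_mats_def flip: transpose_matrix_inv)

section \<open>Derivatives of the determinant and of the inverse\<close>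

lemma bounded_bilinear_matrix_mult:
  "bounded_bilinear ((**) :: 'a::{real_normed_field,euclidean_space}^'m^'n \<Rightarrow> 'a^'k^'m \<Rightarrow> 'a^'k^'n)"
  unfolding bilinear_conv_bounded_bilinear[symmetric] bilinear_def
  by (auto intro!: linearI simp: vec_eq_iff matrix_mult_entry sum.distrib algebra_simps scaleR_sum_right)

lemmas has_derivative_matrix_mult = bounded_bilinear.FDERIV[OF bounded_bilinear_matrix_mult]

lemma has_derivative_matrix_mult_const:
  fixes P :: "'a::{real_normed_field,euclidean_space}^'m^'n" and Q :: "'a^'l^'k"
  shows "((\<lambda>X. P ** X ** Q) has_derivative (\<lambda>X. P ** X ** Q)) F"
  by (rule bounded_linear_imp_has_derivative)
     (intro bounded_linear_compose[OF bounded_bilinear.bounded_linear_left[OF bounded_bilinear_matrix_mult]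
       bounded_bilinear.bounded_linear_right[OF bounded_bilinear_matrix_mult]])

lemma bounded_linear_trace:
  "bounded_linear (trace :: 'a::{real_normed_field,euclidean_space}^'m^'m \<Rightarrow> 'a)"
  by (auto intro!: linearI simp: trace_def sum.distrib scaleR_sum_right simp flip: linear_conv_bounded_linear)

lemma bounded_linear_entry:
  "bounded_linear (\<lambda>A :: 'a::{real_normed_field,euclidean_space}^'m^'n. A $ i $ j)"
  by (auto intro!: linearI simp flip: linear_conv_bounded_linear)

lemmas has_derivative_entry = bounded_linear_imp_has_derivative[OF bounded_linear_entry]

lemma has_derivative_det:
  fixes Z :: "'a::{real_normed_field,euclidean_space}^'m^'m"
  shows "(det has_derivative (\<lambda>H. \<Sum>p | p permutes (UNIV::'m set). of_int (sign p) *
      (\<Sum>i\<in>UNIV. H $ i $ p i * (\<Prod>j\<in>UNIV - {i}. Z $ j $ p j)))) (at Z)"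
  unfolding det_def
  by (auto intro!: derivative_eq_intros has_derivative_entry)

text \<open>Jacobi's formula. At the identity matrix a permutation other than the identity moves two points,
so its product vanishes to second order and only the diagonal contributes; multiplicativity
of the determinant transports this to any invertible matrix.\<close>

lemma has_derivative_det_Jacobi:
  fixes Z :: "'a::{real_normed_field,euclidean_space}^'m^'m"
  assumes "det Z \<noteq> 0"
  shows "(det has_derivative (\<lambda>H. det Z * trace (matrix_inv Z ** H))) (at Z)"
proof -
  have summand: "(\<Sum>i\<in>UNIV. H $ i $ p i * (\<Prod>j\<in>UNIV - {i}. (mat 1 :: 'a^'m^'m) $ j $ p j))
      = (if p = id then trace H else 0)" if "p permutes UNIV" for p and H :: "'a^'m^'m"
  proof (cases "p = id")
    case True
    then show ?thesis by (simp add: trace_def mat_def)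
  next
    case False
    then obtain k where k: "p k \<noteq> k" by fastforce
    have pk: "p (p k) \<noteq> p k"
      using k that by (metis permutes_inj injD)
    have "(\<Prod>j\<in>UNIV - {i}. (mat 1 :: 'a^'m^'m) $ j $ p j) = 0" for i
    proof (cases "i = k")
      case True
      have "(mat 1 :: 'a^'m^'m) $ p k $ p (p k) = 0" using pk by (simp add: mat_def)
      moreover have "p k \<in> UNIV - {i}" using True k by simp
      ultimately show ?thesis by (metis (no_types, lifting) finite prod_zero)
    next
      case False
      have "(mat 1 :: 'a^'m^'m) $ k $ p k = 0" using k by (simp add: mat_def)
      moreover have "k \<in> UNIV - {i}" using False by simp
      ultimately show ?thesis by (metis (no_types, lifting) finite prod_zero)
    qed
    then show ?thesis using False by (simp del: prod_zero_iff)
  qed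
  have "(det has_derivative (\<lambda>H. trace H)) (at (mat 1 :: 'a^'m^'m))"
  proof (rule has_derivative_eq_rhs[OF has_derivative_det], rule ext)
    fix H :: "'a^'m^'m"
    have "(\<Sum>p | p permutes (UNIV::'m set). of_int (sign p) *
        (\<Sum>i\<in>UNIV. H $ i $ p i * (\<Prod>j\<in>UNIV - {i}. (mat 1 :: 'a^'m^'m) $ j $ p j)))
      = (\<Sum>p | p permutes (UNIV::'m set). if p = id then trace H else 0)"
    proof (rule sum.cong[OF refl])
      fix p assume "p \<in> {p. p permutes (UNIV::'m set)}"
      then have "p permutes UNIV" by simp
      show "of_int (sign p) *
          (\<Sum>i\<in>UNIV. H $ i $ p i * (\<Prod>j\<in>UNIV - {i}. (mat 1 :: 'a^'m^'m) $ j $ p j))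
        = (if p = id then trace H else 0)"
        unfolding summand[OF \<open>p permutes UNIV\<close>] by (cases "p = id") (simp_all add: sign_id)
    qed
    also have "\<dots> = trace H"
      using finite_permutations[of "UNIV :: 'm set"] permutes_id[of "UNIV :: 'm set"] by simp
    finally show "(\<Sum>p | p permutes (UNIV::'m set). of_int (sign p) *
        (\<Sum>i\<in>UNIV. H $ i $ p i * (\<Prod>j\<in>UNIV - {i}. (mat 1 :: 'a^'m^'m) $ j $ p j)))
      = trace H" .
  qed
  then have "(det has_derivative trace) (at (matrix_inv Z ** Z ** mat 1))"
    using assms by (simp add: matrix_inv_cancel)
  then have "((\<lambda>W. det (matrix_inv Z ** W ** mat 1)) has_derivative
      (\<lambda>H. trace (matrix_inv Z ** H ** mat 1))) (at Z)"
    by (rule has_derivative_compose[OF has_derivative_matrix_mult_const])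
  then have "((\<lambda>W. det Z * det (matrix_inv Z ** W)) has_derivative
      (\<lambda>H. det Z * trace (matrix_inv Z ** H))) (at Z)"
    unfolding matrix_mul_rid by (rule has_derivative_mult_right)
  moreover have "det Z * det (matrix_inv Z ** W) = det W" for W
    using assms by (metis det_mul matrix_inv_cancel(1) matrix_mul_assoc matrix_mul_lid)
  ultimately show ?thesis by simp
qed

lemma continuous_det:
  fixes Z :: "'a::{real_normed_field,euclidean_space}^'m^'m"
  shows "isCont det Z"
  using has_derivative_continuous[OF has_derivative_det] .

lemma eventually_det_nonzero:
  fixes Z :: "'a::{real_normed_field,euclidean_space}^'m^'m"
  assumes "det Z \<noteq> 0"
  shows "eventually (\<lambda>W. det W \<noteq> 0) (nhds Z)"
proof -
  have "eventually (\<lambda>W. det W \<noteq> 0) (at Z)"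
    using isContD[OF continuous_det] assms by (rule tendsto_imp_eventually_ne)
  then show ?thesis using assms by (simp add: eventually_nhds_conv_at)
qed

text \<open>By Cramer's rule the entries of the inverse are quotients of polynomials in the entries.\<close>

lemma differentiable_matrix_inv:
  fixes Z :: "'a::{real_normed_field,euclidean_space}^'m^'m"
  assumes "det Z \<noteq> 0"
  shows "matrix_inv differentiable (at Z)"
proof -
  define N where "N k l W = (\<chi> i j. if j = k then mat 1 $ i $ l else W $ i $ j)"
    for k l and W :: "'a^'m^'m"
  have "((\<lambda>W. N k l W) has_derivative (\<lambda>H. \<chi> i j. if j = k then 0 else H $ i $ j)) (at Z)" for k l
    unfolding has_derivative_componentwise_within[of "N k l"]
  proof
    fix b :: "'a^'m^'m" assume "b \<in> Basis"
    then obtain i j c where b: "b = axis i (axis j c)"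
      by (auto simp: Basis_vec_def)
    show "((\<lambda>W. N k l W \<bullet> b) has_derivative
        (\<lambda>H. (\<chi> i j. if j = k then 0 else H $ i $ j) \<bullet> b)) (at Z)"
      unfolding b N_def
      by (cases "j = k") (auto simp: inner_axis intro!: derivative_eq_intros has_derivative_entry)
  qed
  then have "(\<lambda>W. det (N k l W)) differentiable (at Z)" for k l
    unfolding differentiable_def using has_derivative_compose[OF _ has_derivative_det] by blast
  moreover have "det differentiable (at Z)"
    using has_derivative_det by (auto simp: differentiable_def)
  ultimately have quot: "(\<lambda>W. det (N k l W) / det W) differentiable (at Z)" for k l
    using assms by (intro differentiable_divide) auto
  have "(\<lambda>W. matrix_inv W $ k $ l) differentiable (at Z)" for k l
  proof -
    obtain D where D: "((\<lambda>W. det (N k l W) / det W) has_derivative D) (at Z)"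
      using quot[of k l] by (auto simp: differentiable_def)
    have "eventually (\<lambda>W. det (N k l W) / det W = matrix_inv W $ k $ l) (nhds Z)"
      using eventually_det_nonzero[OF assms]
      by (rule eventually_mono) (simp add: matrix_inv_entry N_def)
    then have "((\<lambda>W. matrix_inv W $ k $ l) has_derivative D) (at Z)"
      using has_derivative_transform_eventually[OF D]
      by (simp add: eventually_nhds_conv_at)
    then show ?thesis by (auto simp: differentiable_def)
  qed
  then show ?thesis
    unfolding differentiable_componentwise_within[of matrix_inv]
    by (auto simp: Basis_vec_def inner_axis intro!: differentiable_inner)
qed

text \<open>Differentiability being known, the derivative is read off from \<open>W W\<^sup>-\<^sup>1 = 1\<close>.\<close>

lemma has_derivative_matrix_inv:
  fixes Z :: "'a::{real_normed_field,euclidean_space}^'m^'m"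
  assumes "det Z \<noteq> 0"
  shows "(matrix_inv has_derivative (\<lambda>H. - (matrix_inv Z ** H ** matrix_inv Z))) (at Z)"
proof -
  obtain D where D: "(matrix_inv has_derivative D) (at Z)"
    using differentiable_matrix_inv[OF assms] by (auto simp: differentiable_def)
  have "((\<lambda>W. W ** matrix_inv W) has_derivative (\<lambda>H. Z ** D H + H ** matrix_inv Z)) (at Z)"
    by (rule has_derivative_matrix_mult[OF has_derivative_ident D])
  moreover have "eventually (\<lambda>W. W ** matrix_inv W = mat 1) (at Z)"
    using eventually_det_nonzero[OF assms]
    by (auto simp: matrix_inv_cancel eventually_nhds_conv_at elim: eventually_mono)
  ultimately have "((\<lambda>W. mat 1 :: 'a^'m^'m) has_derivative (\<lambda>H. Z ** D H + H ** matrix_inv Z)) (at Z)"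
    by (rule has_derivative_transform_eventually)
       (simp_all only: eventually_nhds_conv_at matrix_inv_cancel[OF assms] UNIV_I)
  then have "(\<lambda>H. Z ** D H + H ** matrix_inv Z) = (\<lambda>H. 0)"
    by (rule has_derivative_unique[OF _ has_derivative_const])
  then have *: "Z ** D H = - (H ** matrix_inv Z)" for H
    using fun_cong[of "\<lambda>H. Z ** D H + H ** matrix_inv Z" "\<lambda>H. 0" H]
    by (simp add: eq_neg_iff_add_eq_0)
  have "D H = - (matrix_inv Z ** H ** matrix_inv Z)" for H
  proof -
    have "D H = matrix_inv Z ** (Z ** D H)"
      using assms by (simp add: matrix_mul_assoc matrix_inv_cancel)
    also have "\<dots> = - (matrix_inv Z ** (H ** matrix_inv Z))"
      unfolding * by (simp add: vec_eq_iff matrix_mult_entry sum_negf)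
    finally show ?thesis by (simp add: matrix_mul_assoc)
  qed
  then have "D = (\<lambda>H. - (matrix_inv Z ** H ** matrix_inv Z))" by (rule ext)
  with D show ?thesis by simp
qed

section \<open>The score of the log-likelihood\<close>

definition sym_unit :: "'m \<Rightarrow> 'm \<Rightarrow> 'a::zero_neq_one^'m^'m" where
  "sym_unit k l = (\<chi> i j. if i = k \<and> j = l \<or> i = l \<and> j = k then 1 else 0)"

lemma sym_unit_sym: "sym_unit k l \<in> sym_mats"
  by (auto simp: sym_mats_iff sym_unit_def)

lemma trace_mult_sym_unit:
  fixes D :: "'a::comm_ring_1^'m^'m"
  assumes "D \<in> sym_mats"
  shows "trace (D ** sym_unit k l) = (if k = l then D $ k $ k else 2 * D $ k $ l)"
proof -
  have "D $ i $ j * sym_unit k l $ j $ i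
      = (if i = k then if j = l then D $ k $ l else 0 else 0)
      + (if k \<noteq> l \<and> i = l then if j = k then D $ l $ k else 0 else 0)" for i j
    by (auto simp: sym_unit_def)
  moreover have "(\<Sum>i\<in>UNIV. \<Sum>j\<in>UNIV. if i = a then if j = b then c else 0 else 0) = c"
    for a b :: 'm and c :: 'a
  proof -
    have "(\<Sum>j\<in>UNIV. if i = a then if j = b then c else 0 else 0) = (if i = a then c else 0)" for i
      by simp
    then show ?thesis by simp
  qed
  ultimately have "trace (D ** sym_unit k l) = D $ k $ l + (if k \<noteq> l then D $ l $ k else 0)"
    by (cases "k = l") (simp_all add: trace_def matrix_mult_entry sum.distrib)
  then show ?thesis
    using assms by (auto simp: sym_mats_iff)
qed

lemma sym_trace_nondegenerate:
  fixes D :: "'a::{comm_ring_1,semiring_char_0,ring_no_zero_divisors}^'m^'m"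
  assumes "D \<in> sym_mats" "\<And>H. H \<in> sym_mats \<Longrightarrow> trace (D ** H) = 0"
  shows "D = 0"
proof -
  have "D $ k $ l = 0" for k l
    using assms(2)[OF sym_unit_sym, of k l] trace_mult_sym_unit[OF assms(1), of k l]
    by (auto split: if_splits)
  then show ?thesis by (simp add: vec_eq_iff)
qed

text \<open>A derivative within the symmetric matrices only sees symmetric directions, and on these the
trace form is nondegenerate; the lines through \<open>Z\<close> already determine it.\<close>

lemma is_sym_gradient_unique:
  fixes Z :: "'a::{real_normed_field,euclidean_space}^'m^'m"
  assumes "is_sym_gradient f Z g" "is_sym_gradient f Z g'" and Z: "Z \<in> sym_mats"
  shows "g = g'"
proof -
  have line: "((\<lambda>t. f (Z + t *\<^sub>R H)) has_derivative (\<lambda>t. trace (g ** (t *\<^sub>R H)))) (at 0)"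
    if "is_sym_gradient f Z g" "H \<in> sym_mats" for g H
  proof -
    have "((\<lambda>t. Z + t *\<^sub>R H) has_derivative (\<lambda>t. t *\<^sub>R H)) (at 0)"
      by (auto intro!: derivative_eq_intros)
    moreover have "range (\<lambda>t. Z + t *\<^sub>R H) \<subseteq> sym_mats"
      using Z that(2) by (auto simp: sym_mats_iff)
    then have "(f has_derivative (\<lambda>H. trace (g ** H)))
        (at (Z + 0 *\<^sub>R H) within range (\<lambda>t. Z + t *\<^sub>R H))"
      using that(1) by (auto simp: is_sym_gradient_def intro: has_derivative_subset)
    ultimately show ?thesis
      by (rule has_derivative_in_compose)
  qed
  have "trace ((g - g') ** H) = 0" if "H \<in> sym_mats" for H
  proof -
    have "trace (g ** H) = trace (g' ** H)"
      using fun_cong[OF has_derivative_unique[OF line[OF assms(1) that] line[OF assms(2) that]], of 1]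
      by simp
    then show ?thesis
      by (simp add: trace_def matrix_mult_entry algebra_simps sum_subtractf)
  qed
  moreover have "g - g' \<in> sym_mats"
    using assms by (auto simp: is_sym_gradient_def sym_mats_iff)
  ultimately have "g - g' = 0"
    by (intro sym_trace_nondegenerate)
  then show ?thesis by simp
qed

text \<open>The gradient of the log-likelihood with respect to the covariance matrix.\<close>

definition score :: "nat \<Rightarrow> 'a::real_normed_field^'m^'m \<Rightarrow> 'a^'m^'m \<Rightarrow> 'a^'m^'m" where
  "score n S Z = - (real n / 2) *\<^sub>R (matrix_inv Z - matrix_inv Z ** S ** matrix_inv Z)"

lemma score_sym:
  fixes Z :: "'a::real_normed_field^'m^'m"
  assumes "Z \<in> sym_mats" "S \<in> sym_mats" "det Z \<noteq> 0"
  shows "score n S Z \<in> sym_mats"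
proof -
  have inv: "matrix_inv Z \<in> sym_mats"
    using assms by (simp add: matrix_inv_sym_mats)
  then have "matrix_inv Z ** S ** matrix_inv Z \<in> sym_mats"
    using sym_mats_congruence(1)[OF assms(2), of "matrix_inv Z"] by (simp add: transpose_sym_mats)
  then show ?thesis
    using inv by (auto simp: score_def sym_mats_iff)
qed

text \<open>The data can be recovered from a point and the score there. This turns statements about
critical points into statements about normal covectors.\<close>

lemma score_solve:
  fixes Z :: "'a::real_normed_field^'m^'m"
  assumes "det Z \<noteq> 0" "n > 0"
  shows "S = Z + (2 / real n) *\<^sub>R (Z ** score n S Z ** Z)"
proof -
  let ?Y = "matrix_inv Z"
  have "Z ** (?Y - ?Y ** S ** ?Y) ** Z = Z ** ?Y ** Z - (Z ** ?Y) ** S ** (?Y ** Z)"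
    by (simp add: matrix_mult_diff matrix_mul_assoc)
  then have "Z ** (?Y - ?Y ** S ** ?Y) ** Z = Z - S"
    by (simp add: matrix_inv_cancel assms(1))
  then have "Z ** score n S Z ** Z = - (real n / 2) *\<^sub>R (Z - S)"
    by (simp add: score_def matrix_mult_minus matrix_mult_scaleR)
  then show ?thesis
    using assms(2) by simp
qed

lemma trace_score:
  fixes Z :: "'a::{real_normed_field,euclidean_space}^'m^'m"
  shows "trace (score n S Z ** H)
    = - (of_nat n / 2) * trace (matrix_inv Z ** H)
      + (of_nat n / 2) * trace (S ** (matrix_inv Z ** H ** matrix_inv Z))"
proof -
  let ?Y = "matrix_inv Z"
  have "trace (S ** (?Y ** H ** ?Y)) = trace (?Y ** S ** ?Y ** H)"
    by (metis matrix_mul_assoc trace_mul_sym)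
  moreover have "score n S Z ** H = - (real n / 2) *\<^sub>R (?Y ** H - ?Y ** S ** ?Y ** H)"
    unfolding score_def
    by (simp add: matrix_mult_minus matrix_mult_scaleR matrix_mult_diff)
  moreover have "trace (- c *\<^sub>R (A - B)) = - (of_real c) * trace A + of_real c * trace B"
    for c and A B :: "'a^'m^'m"
  proof -
    have "trace (- c *\<^sub>R (A - B)) = - c *\<^sub>R (trace A - trace B)"
      by (simp only: trace_def vector_scaleR_component vector_minus_component
          scaleR_sum_right sum_subtractf[symmetric])
    also have "\<dots> = - (of_real c) * trace A + of_real c * trace B"
      unfolding scaleR_conv_of_real by (simp add: algebra_simps)
    finally show ?thesis .
  qed
  ultimately show ?thesis by simp
qed

lemma has_derivative_gaussian_loglik:
  fixes Z :: "'a::{real_normed_field,euclidean_space}^'m^'m"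
  assumes "det Z \<noteq> 0"
    and "(L has_derivative (\<lambda>H. trace (matrix_inv Z ** H))) (at Z)"
  shows "((\<lambda>W. - (of_nat n / 2) * L W - (of_nat n / 2) * trace (S ** matrix_inv W))
    has_derivative (\<lambda>H. trace (score n S Z ** H))) (at Z)"
proof -
  have "((\<lambda>W. S ** matrix_inv W ** mat 1) has_derivative
      (\<lambda>H. S ** (- (matrix_inv Z ** H ** matrix_inv Z)) ** mat 1)) (at Z)"
    by (rule has_derivative_compose[OF has_derivative_matrix_inv[OF assms(1)]
          has_derivative_matrix_mult_const])
  then have "((\<lambda>W. trace (S ** matrix_inv W)) has_derivative
      (\<lambda>H. - trace (S ** (matrix_inv Z ** H ** matrix_inv Z)))) (at Z)"
    using bounded_linear.has_derivative[OF bounded_linear_trace]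
    by (fastforce simp: matrix_mult_minus linear_neg[OF bounded_linear.linear[OF bounded_linear_trace]])
  note this [derivative_intros] assms(2) [derivative_intros]
  show ?thesis
    by (rule derivative_eq_intros refl)+ (simp add: trace_score fun_eq_iff algebra_simps)
qed

lemma has_derivative_loglik:
  assumes "det \<Sigma> > 0"
  shows "((\<lambda>A. loglik n A S) has_derivative (\<lambda>H. trace (score n S \<Sigma> ** H))) (at \<Sigma>)"
proof -
  have "((\<lambda>W. ln (det W)) has_derivative (\<lambda>H. trace (matrix_inv \<Sigma> ** H))) (at \<Sigma>)"
    using assms by (auto intro!: derivative_eq_intros has_derivative_det_Jacobi)
  then show ?thesis
    using has_derivative_gaussian_loglik[of \<Sigma> "\<lambda>W. ln (det W)" n S] assms
    by (simp add: loglik_def [abs_def])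
qed

lemma loglik_sym_gradient:
  assumes "\<Sigma> \<in> sym_mats" "S \<in> sym_mats" "det \<Sigma> > 0"
  shows "is_sym_gradient (\<lambda>A. loglik n A S) \<Sigma> g \<longleftrightarrow> g = score n S \<Sigma>"
proof -
  have "is_sym_gradient (\<lambda>A. loglik n A S) \<Sigma> (score n S \<Sigma>)"
    using has_derivative_loglik[of \<Sigma> n S] assms
    unfolding is_sym_gradient_def
    by (auto simp: score_sym intro: has_derivative_at_withinI)
  then show ?thesis
    using is_sym_gradient_unique assms(1) by blast
qed

text \<open>Two continuous branches of \<open>log det\<close> differ locally by a constant, so every branch
inherits the derivative of the principal one, centred at the point in question.\<close>

lemma has_derivative_log_det_branch:
  fixes Z :: "complex^'m^'m"
  assumes "open U" "Z \<in> U" "continuous_on U L" and L: "\<And>W. W \<in> U \<Longrightarrow> exp (L W) = det W"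
  shows "det Z \<noteq> 0" "(L has_derivative (\<lambda>H. trace (matrix_inv Z ** H))) (at Z)"
proof -
  show nz: "det Z \<noteq> 0"
    using L[OF assms(2)] exp_not_eq_zero by metis
  have "isCont L Z"
    using assms continuous_on_eq_continuous_at by blast
  then have "eventually (\<lambda>W. dist (L W) (L Z) < pi) (at Z)"
    by (intro tendstoD) (auto simp: isCont_def)
  moreover have "eventually (\<lambda>W. W \<in> U) (at Z)"
    using assms(1,2) by (simp add: eventually_at_topological) blast
  ultimately have ev: "eventually (\<lambda>W. L Z + Ln (det W / det Z) = L W) (at Z)"
  proof eventually_elim
    case (elim W)
    have "\<bar>Im (L W - L Z)\<bar> < pi"
      using elim(1) abs_Im_le_cmod[of "L W - L Z"] by (simp add: dist_norm)
    then have "Ln (exp (L W - L Z)) = L W - L Z"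
      by (intro Ln_exp) auto
    then show ?case
      using L[OF elim(2)] L[OF assms(2)] by (simp add: exp_diff)
  qed
  have "((\<lambda>W. det W / det Z) has_derivative (\<lambda>H. trace (matrix_inv Z ** H))) (at Z)"
    using nz by (auto intro!: derivative_eq_intros has_derivative_det_Jacobi)
  moreover have "(Ln has_derivative (\<lambda>h. h)) (at (det Z / det Z))"
    using has_field_derivative_Ln[of 1] nz lambda_one
    by (simp add: has_field_derivative_def mult_1 [abs_def])
  ultimately have "((\<lambda>W. Ln (det W / det Z)) has_derivative (\<lambda>H. trace (matrix_inv Z ** H))) (at Z)"
    by (rule has_derivative_compose)
  then have "((\<lambda>W. L Z + Ln (det W / det Z)) has_derivative (\<lambda>H. trace (matrix_inv Z ** H))) (at Z)"
    by (auto intro!: derivative_eq_intros)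
  then show "(L has_derivative (\<lambda>H. trace (matrix_inv Z ** H))) (at Z)"
    by (rule has_derivative_transform_eventually[OF _ ev]) (simp_all add: nz)
qed

lemma is_complex_score_iff:
  fixes Z :: "complex^'m^'m"
  assumes "Z \<in> sym_mats" "S \<in> sym_mats"
  shows "is_complex_score n S Z g \<longleftrightarrow> det Z \<noteq> 0 \<and> g = score n S Z"
proof
  assume "is_complex_score n S Z g"
  then obtain U L where UL: "open U" "Z \<in> U" "continuous_on U L" "\<forall>W\<in>U. exp (L W) = det W"
    and grad: "is_sym_gradient
          (\<lambda>W. - (of_nat n / 2) * L W - (of_nat n / 2) * trace (S ** matrix_inv W)) Z g"
    unfolding is_complex_score_def by blast
  have nz: "det Z \<noteq> 0" and L: "(L has_derivative (\<lambda>H. trace (matrix_inv Z ** H))) (at Z)"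
    using has_derivative_log_det_branch[of U Z L] UL by blast+
  have "is_sym_gradient
      (\<lambda>W. - (of_nat n / 2) * L W - (of_nat n / 2) * trace (S ** matrix_inv W)) Z (score n S Z)"
    unfolding is_sym_gradient_def
    using has_derivative_gaussian_loglik[OF nz L, of n S] score_sym[OF assms nz, of n]
    by (auto intro: has_derivative_at_withinI)
  then show "det Z \<noteq> 0 \<and> g = score n S Z"
    using is_sym_gradient_unique[OF grad _ assms(1)] nz by simp
next
  assume g: "det Z \<noteq> 0 \<and> g = score n S Z"
  define U where "U = (\<lambda>W :: complex^'m^'m. det W / det Z) -` (- \<real>\<^sub>\<le>\<^sub>0)"
  define L where "L W = Ln (det W / det Z) + Ln (det Z)" for W :: "complex^'m^'m"
  have cont: "continuous_on A (\<lambda>W :: complex^'m^'m. det W / det Z)" for A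
    using g continuous_det by (intro continuous_intros continuous_at_imp_continuous_on) auto
  have "open U"
    unfolding U_def using cont[of UNIV] by (intro open_vimage) (simp_all add: open_Compl)
  moreover have "Z \<in> U"
    using g by (simp add: U_def)
  moreover have "continuous_on U L"
    unfolding L_def
    by (intro continuous_on_add continuous_on_Ln' cont continuous_on_const) (simp add: U_def)
  moreover have expL: "exp (L W) = det W" if "W \<in> U" for W
  proof -
    have "det W / det Z \<noteq> 0"
      using that by (metis Compl_iff U_def nonpos_Reals_zero_I vimageE)
    then show ?thesis
      using g by (simp add: L_def exp_add exp_Ln del: divide_eq_0_iff)
  qed
  ultimately have "(L has_derivative (\<lambda>H. trace (matrix_inv Z ** H))) (at Z)"
    by (intro has_derivative_log_det_branch)
  then have "is_sym_gradient
      (\<lambda>W. - (of_nat n / 2) * L W - (of_nat n / 2) * trace (S ** matrix_inv W)) Z g"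
    unfolding is_sym_gradient_def
    using has_derivative_gaussian_loglik[of Z L n S] score_sym[OF assms, of n] g
    by (auto intro: has_derivative_at_withinI)
  then show "is_complex_score n S Z g"
    unfolding is_complex_score_def
    using \<open>open U\<close> \<open>Z \<in> U\<close> \<open>continuous_on U L\<close> expL by blast
qed

section \<open>Structural equation models on an ordered acyclic graph\<close>

definition edge_supported :: "('m \<times> 'm) set \<Rightarrow> 'a::zero^'m^'m \<Rightarrow> bool" where
  "edge_supported E \<Lambda> \<longleftrightarrow> (\<forall>i j. (i, j) \<notin> E \<longrightarrow> \<Lambda> $ i $ j = 0)"

definition diagonal :: "'a::zero^'m^'m \<Rightarrow> bool" where
  "diagonal D \<longleftrightarrow> (\<forall>i j. i \<noteq> j \<longrightarrow> D $ i $ j = 0)"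

definition sem_cov :: "'a::field^'m^'m \<Rightarrow> 'a^'m^'m \<Rightarrow> 'a^'m^'m" where
  "sem_cov \<Lambda> \<Omega> = transpose (matrix_inv (mat 1 - \<Lambda>)) ** \<Omega> ** matrix_inv (mat 1 - \<Lambda>)"

text \<open>The derivative of \<open>sem_cov\<close> at \<open>(\<Lambda>, \<Omega>)\<close> in the direction \<open>(\<Lambda>', \<Omega>')\<close>: the inverse \<open>A\<close> of \<open>1 - \<Lambda>\<close> has
derivative \<open>A \<Lambda>' A\<close>.\<close>

definition cov_velocity ::
    "'a::field^'m^'m \<Rightarrow> 'a^'m^'m \<Rightarrow> 'a^'m^'m \<Rightarrow> 'a^'m^'m \<Rightarrow> 'a^'m^'m" where
  "cov_velocity \<Lambda> \<Omega> \<Lambda>' \<Omega>' =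
     transpose (matrix_inv (mat 1 - \<Lambda>)) ** \<Omega>' ** matrix_inv (mat 1 - \<Lambda>)
     + transpose (matrix_inv (mat 1 - \<Lambda>)) ** transpose \<Lambda>' ** sem_cov \<Lambda> \<Omega>
     + sem_cov \<Lambda> \<Omega> ** \<Lambda>' ** matrix_inv (mat 1 - \<Lambda>)"

text \<open>Row \<open>j\<close> of \<open>(1 - \<Lambda>)\<^sup>T\<close> is the residual of vertex \<open>j\<close> after regression with coefficients \<open>\<Lambda>\<close>. The
equations ask that under the covariance \<open>S\<close> it is uncorrelated with the parents of \<open>j\<close> and has
covariance \<open>\<Omega>\<^sub>j\<^sub>j\<close> with \<open>j\<close> itself, which is then the residual variance.\<close>

definition normal_equations ::
    "('m \<times> 'm) set \<Rightarrow> 'a::field^'m^'m \<Rightarrow> 'a^'m^'m \<Rightarrow> 'a^'m^'m \<Rightarrow> bool" where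
  "normal_equations E \<Lambda> \<Omega> S \<longleftrightarrow>
     (\<forall>i j. (i, j) \<in> E \<longrightarrow> (transpose (mat 1 - \<Lambda>) ** S) $ j $ i = 0) \<and>
     (\<forall>j. (transpose (mat 1 - \<Lambda>) ** S) $ j $ j = \<Omega> $ j $ j)"

lemma mat_1_entry: "mat 1 $ i $ j = (if i = j then 1 else 0)"
  by (simp add: mat_def)

lemma diagonal_transpose: "diagonal D \<Longrightarrow> transpose D = D"
  unfolding diagonal_def vec_eq_iff transpose_entry by (intro allI) (case_tac "i = ia"; simp)

lemma diagonal_mult_entry:
  fixes D :: "'a::comm_ring_1^'m^'m"
  assumes "diagonal D"
  shows "(D ** A) $ i $ j = D $ i $ i * A $ i $ j" "(A ** D) $ i $ j = A $ i $ j * D $ j $ j"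
proof -
  have "(\<Sum>k\<in>UNIV. D $ i $ k * A $ k $ j) = (\<Sum>k\<in>UNIV. if k = i then D $ i $ i * A $ i $ j else 0)"
    using assms by (intro sum.cong) (auto simp: diagonal_def)
  then show "(D ** A) $ i $ j = D $ i $ i * A $ i $ j"
    by (simp add: matrix_mult_entry)
  have "(\<Sum>k\<in>UNIV. A $ i $ k * D $ k $ j) = (\<Sum>k\<in>UNIV. if k = j then A $ i $ j * D $ j $ j else 0)"
    using assms by (intro sum.cong) (auto simp: diagonal_def)
  then show "(A ** D) $ i $ j = A $ i $ j * D $ j $ j"
    by (simp add: matrix_mult_entry)
qed

lemma one_minus_transpose_mult_entry:
  fixes \<Lambda> :: "'a::comm_ring_1^'m^'m"
  shows "(transpose (mat 1 - \<Lambda>) ** S) $ j $ i = S $ j $ i - (\<Sum>k\<in>UNIV. \<Lambda> $ k $ j * S $ k $ i)"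
  by (simp add: transpose_diff matrix_mult_diff) (simp add: matrix_mult_entry)

lemma mult_one_minus_entry:
  fixes \<Lambda> :: "'a::comm_ring_1^'m^'m"
  shows "(S ** (mat 1 - \<Lambda>)) $ i $ j = S $ i $ j - (\<Sum>k\<in>UNIV. S $ i $ k * \<Lambda> $ k $ j)"
  by (simp add: matrix_mult_diff) (simp add: matrix_mult_entry)

text \<open>The largest point that a permutation moves is moved downwards, and there the matrix vanishes.\<close>

lemma det_unitriangular:
  fixes B :: "('a::comm_ring_1, 'm::{finite,linorder}) square_matrix"
  assumes diag: "\<And>i. B $ i $ i = 1" and low: "\<And>i j. j < i \<Longrightarrow> B $ i $ j = 0"
  shows "det B = 1"
proof -
  have "of_int (sign p) * (\<Prod>i\<in>UNIV. B $ i $ p i) = (if p = id then 1 else 0)"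
    if p: "p permutes UNIV" for p
  proof (cases "p = id")
    case True
    then show ?thesis by (simp add: diag sign_id)
  next
    case False
    define M where "M = {i. p i \<noteq> i}"
    have "M \<noteq> {}" using False by (auto simp: M_def)
    then have "Max M \<in> M" by (simp add: Max_in)
    then have "p (p (Max M)) \<noteq> p (Max M)"
      using injD[OF permutes_inj[OF p], of "p (Max M)" "Max M"] by (auto simp: M_def)
    then have "p (Max M) \<le> Max M"
      by (simp add: M_def)
    with \<open>Max M \<in> M\<close> have "p (Max M) < Max M"
      by (auto simp: M_def)
    then have "(\<Prod>i\<in>UNIV. B $ i $ p i) = 0"
      using low by (intro prod_zero) auto
    then show ?thesis using False by simp
  qed
  then have "det B = (\<Sum>p | p permutes (UNIV::'m set). if p = id then 1 else 0)"
    unfolding det_def by (intro sum.cong) auto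
  then show ?thesis
    using finite_permutations[of "UNIV :: 'm set"] permutes_id[of "UNIV :: 'm set"] by simp
qed

locale ordered_dag =
  fixes E :: "('m::{finite,linorder} \<times> 'm) set"
  assumes edge_less: "(i, j) \<in> E \<Longrightarrow> i < j"
begin

lemma edge_supported_zero:
  assumes "edge_supported E \<Lambda>" "j \<le> i"
  shows "\<Lambda> $ i $ j = 0"
  using assms edge_less by (force simp: edge_supported_def)

lemma det_one_minus:
  fixes \<Lambda> :: "('a::field, 'm) square_matrix"
  assumes "edge_supported E \<Lambda>"
  shows "det (mat 1 - \<Lambda>) = 1"
  by (rule det_unitriangular) (auto simp: mat_def edge_supported_zero[OF assms])

lemma inverse_one_minus:
  fixes \<Lambda> :: "('a::field, 'm) square_matrix"
  assumes "edge_supported E \<Lambda>"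
  shows "(mat 1 - \<Lambda>) ** matrix_inv (mat 1 - \<Lambda>) = mat 1"
    "matrix_inv (mat 1 - \<Lambda>) ** (mat 1 - \<Lambda>) = mat 1"
    "transpose (mat 1 - \<Lambda>) ** transpose (matrix_inv (mat 1 - \<Lambda>)) = mat 1"
    "transpose (matrix_inv (mat 1 - \<Lambda>)) ** transpose (mat 1 - \<Lambda>) = mat 1"
  using matrix_inv_cancel[of "mat 1 - \<Lambda>"] det_one_minus[OF assms]
  by (simp_all flip: matrix_transpose_mul)

text \<open>The inverse satisfies \<open>A = 1 + \<Lambda> A\<close>, which determines its rows from the last one upwards.\<close>

lemma inverse_unitriangular:
  fixes \<Lambda> :: "('a::field, 'm) square_matrix"
  assumes "edge_supported E \<Lambda>"
  shows "j < i \<Longrightarrow> matrix_inv (mat 1 - \<Lambda>) $ i $ j = 0"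
    and "matrix_inv (mat 1 - \<Lambda>) $ i $ i = 1"
proof -
  let ?A = "matrix_inv (mat 1 - \<Lambda>)"
  have inv: "?A = mat 1 + \<Lambda> ** ?A"
    using inverse_one_minus(1)[OF assms] by (simp add: matrix_mult_diff diff_eq_eq)
  have rec: "?A $ i $ j = mat 1 $ i $ j + (\<Sum>k\<in>UNIV. \<Lambda> $ i $ k * ?A $ k $ j)" for i j
  proof -
    have "?A $ i $ j = (mat 1 + \<Lambda> ** ?A) $ i $ j"
      by (rule arg_cong[OF inv])
    also have "\<dots> = mat 1 $ i $ j + (\<Sum>k\<in>UNIV. \<Lambda> $ i $ k * ?A $ k $ j)"
      by (simp add: matrix_mult_entry)
    finally show ?thesis .
  qed
  have zero: "j < i \<Longrightarrow> ?A $ i $ j = 0" for i j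
  proof (induction "card {k. i < k}" arbitrary: i rule: less_induct)
    case less
    have "\<Lambda> $ i $ k * ?A $ k $ j = 0" for k
    proof (cases "i < k")
      case True
      then have "card {l. k < l} < card {l. i < l}"
        by (intro psubset_card_mono) auto
      then show ?thesis using less True by simp
    next
      case False
      then show ?thesis using edge_supported_zero[OF assms] by simp
    qed
    then have "(\<Sum>k\<in>UNIV. \<Lambda> $ i $ k * ?A $ k $ j) = 0" by (rule sum.neutral[OF ballI])
    then show ?case using rec[of i j] less.prems by (simp add: mat_1_entry)
  qed
  then show "j < i \<Longrightarrow> ?A $ i $ j = 0" .
  have "\<Lambda> $ i $ k * ?A $ k $ i = 0" for k
    using zero edge_supported_zero[OF assms] by (cases "i < k") auto
  then have "(\<Sum>k\<in>UNIV. \<Lambda> $ i $ k * ?A $ k $ i) = 0" by (rule sum.neutral[OF ballI])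
  then show "?A $ i $ i = 1" using rec[of i i] by (simp add: mat_1_entry)
qed

lemma transpose_mult_sem_cov:
  fixes \<Lambda> :: "('a::field, 'm) square_matrix"
  assumes "edge_supported E \<Lambda>"
  shows "transpose (mat 1 - \<Lambda>) ** sem_cov \<Lambda> \<Omega> = \<Omega> ** matrix_inv (mat 1 - \<Lambda>)"
  using inverse_one_minus[OF assms] by (simp add: sem_cov_def matrix_mul_assoc)

lemma sem_cov_mult:
  fixes \<Lambda> :: "('a::field, 'm) square_matrix"
  assumes "edge_supported E \<Lambda>"
  shows "sem_cov \<Lambda> \<Omega> ** (mat 1 - \<Lambda>) = transpose (matrix_inv (mat 1 - \<Lambda>)) ** \<Omega>"
  using inverse_one_minus[OF assms] by (simp add: sem_cov_def flip: matrix_mul_assoc)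

lemma sem_cov_unique:
  fixes \<Lambda> :: "('a::field, 'm) square_matrix"
  assumes "edge_supported E \<Lambda>"
  shows "Z = sem_cov \<Lambda> \<Omega> \<longleftrightarrow> transpose (mat 1 - \<Lambda>) ** Z ** (mat 1 - \<Lambda>) = \<Omega>"
proof
  assume "Z = sem_cov \<Lambda> \<Omega>"
  then show "transpose (mat 1 - \<Lambda>) ** Z ** (mat 1 - \<Lambda>) = \<Omega>"
    using inverse_one_minus[OF assms]
    by (simp add: transpose_mult_sem_cov[OF assms] flip: matrix_mul_assoc)
next
  assume *: "transpose (mat 1 - \<Lambda>) ** Z ** (mat 1 - \<Lambda>) = \<Omega>"
  have "sem_cov \<Lambda> \<Omega> = (transpose (matrix_inv (mat 1 - \<Lambda>)) ** transpose (mat 1 - \<Lambda>)) ** Z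
      ** ((mat 1 - \<Lambda>) ** matrix_inv (mat 1 - \<Lambda>))"
    unfolding sem_cov_def *[symmetric] by (simp only: matrix_mul_assoc)
  then show "Z = sem_cov \<Lambda> \<Omega>"
    using inverse_one_minus[OF assms] by simp
qed

lemma sem_cov_sym:
  fixes \<Lambda> :: "('a::field, 'm) square_matrix"
  assumes "diagonal \<Omega>"
  shows "sem_cov \<Lambda> \<Omega> \<in> sym_mats"
  unfolding sem_cov_def
  by (rule sym_mats_congruence) (simp add: sym_mats_def diagonal_transpose assms)

lemma transpose_mult_sem_cov_entry:
  fixes \<Lambda> :: "('a::field, 'm) square_matrix"
  assumes "edge_supported E \<Lambda>" "diagonal \<Omega>"
  shows "i < j \<Longrightarrow> (transpose (mat 1 - \<Lambda>) ** sem_cov \<Lambda> \<Omega>) $ j $ i = 0"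
    and "(transpose (mat 1 - \<Lambda>) ** sem_cov \<Lambda> \<Omega>) $ j $ j = \<Omega> $ j $ j"
  using assms by (simp_all add: transpose_mult_sem_cov diagonal_mult_entry inverse_unitriangular)

lemma det_sem_cov:
  fixes \<Lambda> :: "('a::field, 'm) square_matrix"
  assumes "edge_supported E \<Lambda>" "diagonal \<Omega>"
  shows "det (sem_cov \<Lambda> \<Omega>) = (\<Prod>i\<in>UNIV. \<Omega> $ i $ i)"
proof -
  have "det (matrix_inv (mat 1 - \<Lambda>)) = 1"
    using arg_cong[OF inverse_one_minus(1)[OF assms(1)], of det] det_one_minus[OF assms(1)]
    by (simp add: det_mul)
  moreover have "det \<Omega> = (\<Prod>i\<in>UNIV. \<Omega> $ i $ i)"
    using assms(2) by (intro det_diagonal) (auto simp: diagonal_def)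
  ultimately show ?thesis
    by (simp add: sem_cov_def det_mul)
qed

text \<open>If \<open>B\<^sup>T Z\<close> is upper triangular then so is \<open>B\<^sup>T Z B\<close>, which is symmetric and hence diagonal.\<close>

lemma sem_cov_of_triangular:
  fixes \<Lambda> :: "('a::field, 'm) square_matrix"
  assumes \<Lambda>: "edge_supported E \<Lambda>" and Z: "Z \<in> sym_mats"
    and tri: "\<And>i j. i < j \<Longrightarrow> (transpose (mat 1 - \<Lambda>) ** Z) $ j $ i = 0"
  shows "Z = sem_cov \<Lambda> (\<chi> i j. if i = j then (transpose (mat 1 - \<Lambda>) ** Z) $ i $ i else 0)"
proof -
  let ?B = "mat 1 - \<Lambda>"
  let ?Y = "transpose ?B ** Z"
  have entry: "(?Y ** ?B) $ j $ i = ?Y $ j $ i - (\<Sum>k\<in>UNIV. ?Y $ j $ k * \<Lambda> $ k $ i)" for i j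
    by (rule mult_one_minus_entry)
  have low: "?Y $ j $ k * \<Lambda> $ k $ i = 0" if "i \<le> j" for i j k
    using tri[of k j] edge_supported_zero[OF \<Lambda>, of i k] that by (cases "k < i") auto
  have "(?Y ** ?B) $ j $ i = (if i = j then ?Y $ i $ i else 0)" if "i \<le> j" for i j
    using entry[of j i] low[OF that] tri that by (auto simp: sum.neutral)
  moreover have "?Y ** ?B \<in> sym_mats"
    by (rule sym_mats_congruence(2)[OF Z])
  ultimately have "(?Y ** ?B) $ j $ i = (if j = i then ?Y $ j $ j else 0)" for i j
    unfolding sym_mats_iff by (cases "i \<le> j") (metis, metis linear)
  then have "?Y ** ?B = (\<chi> i j. if i = j then ?Y $ i $ i else 0)"
    by (simp add: vec_eq_iff)
  then show ?thesis
    using sem_cov_unique[OF \<Lambda>] by blast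
qed

text \<open>The trace is cyclic, and the two terms with \<open>\<Lambda>'\<close> are transposes of each other.\<close>

lemma trace_cov_velocity:
  fixes \<Lambda> :: "('a::field, 'm) square_matrix"
  assumes "g \<in> sym_mats" "diagonal \<Omega>" "diagonal \<Omega>'"
  defines "A \<equiv> matrix_inv (mat 1 - \<Lambda>)"
  shows "trace (g ** cov_velocity \<Lambda> \<Omega> \<Lambda>' \<Omega>')
    = (\<Sum>j\<in>UNIV. \<Omega>' $ j $ j * (A ** g ** transpose A) $ j $ j)
      + 2 * (\<Sum>i\<in>UNIV. \<Sum>j\<in>UNIV. \<Lambda>' $ i $ j * (A ** g ** sem_cov \<Lambda> \<Omega>) $ j $ i)"
proof -
  let ?Z = "sem_cov \<Lambda> \<Omega>"
  have sym: "transpose g = g" "transpose ?Z = ?Z"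
    using assms(1) sem_cov_sym[OF assms(2)] by (simp_all add: transpose_sym_mats)
  have 1: "trace (g ** (transpose A ** \<Omega>' ** A)) = trace (\<Omega>' ** (A ** g ** transpose A))"
    using trace_mul_sym[of "g ** transpose A" "\<Omega>' ** A"] by (simp add: matrix_mul_assoc)
  have 2: "trace (g ** (?Z ** \<Lambda>' ** A)) = trace (\<Lambda>' ** (A ** g ** ?Z))"
    using trace_mul_sym[of "g ** ?Z" "\<Lambda>' ** A"] by (simp add: matrix_mul_assoc)
  have "transpose (g ** (transpose A ** transpose \<Lambda>' ** ?Z)) = ?Z ** \<Lambda>' ** A ** g"
    by (simp add: matrix_transpose_mul sym matrix_mul_assoc)
  then have 3: "trace (g ** (transpose A ** transpose \<Lambda>' ** ?Z)) = trace (g ** (?Z ** \<Lambda>' ** A))"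
    using trace_transpose[of "g ** (transpose A ** transpose \<Lambda>' ** ?Z)"]
      trace_mul_sym[of "?Z ** \<Lambda>' ** A" g] by simp
  have "trace (\<Omega>' ** M) = (\<Sum>j\<in>UNIV. \<Omega>' $ j $ j * M $ j $ j)" for M
    unfolding trace_def by (simp add: diagonal_mult_entry[OF assms(3)])
  moreover have "trace (\<Lambda>' ** M) = (\<Sum>i\<in>UNIV. \<Sum>j\<in>UNIV. \<Lambda>' $ i $ j * M $ j $ i)" for M
    by (simp add: trace_def matrix_mult_entry)
  ultimately show ?thesis
    using 1 2 3 by (simp add: cov_velocity_def matrix_add_ldistrib trace_add flip: A_def)
qed

text \<open>Since \<open>B\<^sup>T Z = \<Omega> A\<close>, multiplying \<open>S - Z = c Z g Z\<close> by \<open>B\<^sup>T\<close> gives \<open>c \<Omega> A g Z\<close>. So the entries of \<open>A g Z\<close> measure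
the failure of the normal equations; on the diagonal they may be replaced by those of
\<open>A g A\<^sup>T\<close>, because \<open>A g Z B = A g A\<^sup>T \<Omega>\<close> and the correction by \<open>\<Lambda>\<close> only involves entries at edges. By
\<open>trace_cov_velocity\<close> the right-hand side is orthogonality of a symmetric \<open>g\<close> to all velocities.\<close>

lemma normal_equations_iff:
  fixes \<Lambda> :: "('a::real_normed_field, 'm) square_matrix"
  assumes \<Lambda>: "edge_supported E \<Lambda>" and \<Omega>: "diagonal \<Omega>" "\<And>j. \<Omega> $ j $ j \<noteq> 0" and "c \<noteq> 0"
  defines "A \<equiv> matrix_inv (mat 1 - \<Lambda>)" and "Z \<equiv> sem_cov \<Lambda> \<Omega>"
  assumes S: "S = Z + c *\<^sub>R (Z ** g ** Z)"
  shows "normal_equations E \<Lambda> \<Omega> S \<longleftrightarrow>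
    (\<forall>i j. (i, j) \<in> E \<longrightarrow> (A ** g ** Z) $ j $ i = 0) \<and> (\<forall>j. (A ** g ** transpose A) $ j $ j = 0)"
proof -
  let ?B = "mat 1 - \<Lambda>"
  have "transpose ?B ** S = transpose ?B ** Z + c *\<^sub>R ((transpose ?B ** Z) ** g ** Z)"
    by (simp add: S matrix_add_ldistrib matrix_mult_scaleR matrix_mul_assoc)
  also have "(transpose ?B ** Z) ** g ** Z = \<Omega> ** (A ** g ** Z)"
    by (simp add: transpose_mult_sem_cov[OF \<Lambda>] Z_def A_def matrix_mul_assoc)
  finally have entry: "(transpose ?B ** S) $ j $ i
      = (transpose ?B ** Z) $ j $ i + c *\<^sub>R (\<Omega> $ j $ j * (A ** g ** Z) $ j $ i)" for i j
    by (simp add: diagonal_mult_entry[OF \<Omega>(1)])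
  have edge: "(transpose ?B ** S) $ j $ i = 0 \<longleftrightarrow> (A ** g ** Z) $ j $ i = 0" if "(i, j) \<in> E" for i j
    using entry[of j i] transpose_mult_sem_cov_entry(1)[OF \<Lambda> \<Omega>(1) edge_less[OF that]] \<Omega>(2) \<open>c \<noteq> 0\<close>
    by (simp add: Z_def)
  have vertex: "(transpose ?B ** S) $ j $ j = \<Omega> $ j $ j \<longleftrightarrow> (A ** g ** Z) $ j $ j = 0" for j
    using entry[of j j] transpose_mult_sem_cov_entry(2)[OF \<Lambda> \<Omega>(1)] \<Omega>(2) \<open>c \<noteq> 0\<close>
    by (simp add: Z_def)
  have scaled: "(A ** g ** transpose A) $ j $ j * \<Omega> $ j $ j
      = (A ** g ** Z) $ j $ j - (\<Sum>k\<in>UNIV. (A ** g ** Z) $ j $ k * \<Lambda> $ k $ j)" for j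
  proof -
    have "A ** g ** transpose A ** \<Omega> = A ** g ** Z ** ?B"
      by (simp add: sem_cov_mult[OF \<Lambda>] Z_def A_def flip: matrix_mul_assoc)
    then show ?thesis
      by (simp flip: diagonal_mult_entry(2)[OF \<Omega>(1)] mult_one_minus_entry)
  qed
  then have "(A ** g ** transpose A) $ j $ j * \<Omega> $ j $ j = (A ** g ** Z) $ j $ j"
    if "\<forall>i. (i, j) \<in> E \<longrightarrow> (A ** g ** Z) $ j $ i = 0" for j
  proof -
    have "(A ** g ** Z) $ j $ k * \<Lambda> $ k $ j = 0" for k
      using that \<Lambda> by (cases "(k, j) \<in> E") (auto simp: edge_supported_def)
    then have "(\<Sum>k\<in>UNIV. (A ** g ** Z) $ j $ k * \<Lambda> $ k $ j) = 0"
      by (rule sum.neutral[OF ballI])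
    then show ?thesis using scaled[of j] by simp
  qed
  then show ?thesis
    unfolding normal_equations_def using edge vertex \<Omega>(2) by (metis mult_eq_0_iff)
qed

end

lemma dag_model_eq:
  fixes E :: "('m::{finite,linorder} \<times> 'm) set"
  assumes "ordered_dag E"
  shows "dag_model E = {sem_cov \<Lambda> \<Omega> | \<Lambda> \<Omega>.
    edge_supported E \<Lambda> \<and> diagonal \<Omega> \<and> (\<forall>i. \<Omega> $ i $ i > 0)}"
proof -
  interpret ordered_dag E by fact
  have "matrix_inv (transpose (mat 1 - \<Lambda>)) = transpose (matrix_inv (mat 1 - \<Lambda>))"
    if "edge_supported E \<Lambda>" for \<Lambda> :: "(real, 'm) square_matrix"
    by (rule transpose_matrix_inv) (simp add: det_one_minus[OF that])
  then show ?thesis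
    unfolding dag_model_def sem_cov_def edge_supported_def[symmetric] diagonal_def[symmetric]
    by (intro Collect_cong ex_cong1) auto
qed

definition single :: "'m \<Rightarrow> 'm \<Rightarrow> 'a::zero_neq_one^'m^'m" where
  "single i j = (\<chi> a b. if a = i \<and> b = j then 1 else 0)"

lemma edge_supported_single: "(i, j) \<in> E \<Longrightarrow> edge_supported E (single i j)"
  by (auto simp: edge_supported_def single_def)

lemma diagonal_single: "diagonal (single j j)"
  by (auto simp: diagonal_def single_def)

lemma edge_supported_0: "edge_supported E 0"
  by (simp add: edge_supported_def)

lemma diagonal_0: "diagonal 0"
  by (simp add: diagonal_def)

context ordered_dag
begin

text \<open>Orthogonality to the velocities of the coordinate directions suffices. This form is needed over
the complex numbers, where only velocities of real parameters are at hand.\<close>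

lemma normal_equationsI:
  fixes \<Lambda> :: "('a::real_normed_field, 'm) square_matrix"
  assumes \<Lambda>: "edge_supported E \<Lambda>" and \<Omega>: "diagonal \<Omega>" "\<And>j. \<Omega> $ j $ j \<noteq> 0" and "c \<noteq> 0"
    and g: "g \<in> sym_mats"
    and S: "S = sem_cov \<Lambda> \<Omega> + c *\<^sub>R (sem_cov \<Lambda> \<Omega> ** g ** sem_cov \<Lambda> \<Omega>)"
    and edges: "\<And>i j. (i, j) \<in> E \<Longrightarrow> trace (g ** cov_velocity \<Lambda> \<Omega> (single i j) 0) = 0"
    and vertices: "\<And>j. trace (g ** cov_velocity \<Lambda> \<Omega> 0 (single j j)) = 0"
  shows "normal_equations E \<Lambda> \<Omega> S"
proof -
  let ?A = "matrix_inv (mat 1 - \<Lambda>)"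
  have "(?A ** g ** sem_cov \<Lambda> \<Omega>) $ j $ i = 0" if "(i, j) \<in> E" for i j
  proof -
    have "(\<Sum>b\<in>UNIV. single i j $ a $ b * M $ b $ a) = (if a = i then M $ j $ i else 0)"
      for a and M :: "('a, 'm) square_matrix"
      by (simp add: single_def if_distrib[of "\<lambda>x. x * _"] cong: if_cong)
    then show ?thesis
      using edges[OF that] trace_cov_velocity[OF g \<Omega>(1) diagonal_0, of \<Lambda> "single i j"] by simp
  qed
  moreover have "(?A ** g ** transpose ?A) $ j $ j = 0" for j
    using vertices[of j] trace_cov_velocity[OF g \<Omega>(1) diagonal_single, of \<Lambda> 0 j]
    by (simp add: single_def if_distrib[of "\<lambda>x. x * _"] cong: if_cong)
  ultimately show ?thesis
    using normal_equations_iff[OF \<Lambda> \<Omega> \<open>c \<noteq> 0\<close> S] by blast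
qed

lemma normal_equationsD:
  fixes \<Lambda> :: "('a::real_normed_field, 'm) square_matrix"
  assumes \<Lambda>: "edge_supported E \<Lambda>" and \<Omega>: "diagonal \<Omega>" "\<And>j. \<Omega> $ j $ j \<noteq> 0" and "c \<noteq> 0"
    and g: "g \<in> sym_mats"
    and S: "S = sem_cov \<Lambda> \<Omega> + c *\<^sub>R (sem_cov \<Lambda> \<Omega> ** g ** sem_cov \<Lambda> \<Omega>)"
    and normal: "normal_equations E \<Lambda> \<Omega> S"
    and \<Lambda>': "edge_supported E \<Lambda>'" and \<Omega>': "diagonal \<Omega>'"
  shows "trace (g ** cov_velocity \<Lambda> \<Omega> \<Lambda>' \<Omega>') = 0"
proof -
  let ?A = "matrix_inv (mat 1 - \<Lambda>)"
  have edges: "(?A ** g ** sem_cov \<Lambda> \<Omega>) $ j $ i = 0" if "(i, j) \<in> E" for i j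
    using normal_equations_iff[OF \<Lambda> \<Omega> \<open>c \<noteq> 0\<close> S] normal that by blast
  have vertices: "(?A ** g ** transpose ?A) $ j $ j = 0" for j
    using normal_equations_iff[OF \<Lambda> \<Omega> \<open>c \<noteq> 0\<close> S] normal by blast
  have "\<Lambda>' $ i $ j * (?A ** g ** sem_cov \<Lambda> \<Omega>) $ j $ i = 0" for i j
    using edges \<Lambda>' by (cases "(i, j) \<in> E") (auto simp: edge_supported_def)
  then have "(\<Sum>i\<in>UNIV. \<Sum>j\<in>UNIV. \<Lambda>' $ i $ j * (?A ** g ** sem_cov \<Lambda> \<Omega>) $ j $ i) = 0"
    by (intro sum.neutral ballI)
  then show ?thesis
    by (simp add: trace_cov_velocity[OF g \<Omega>(1) \<Omega>'] vertices)
qed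

section \<open>Logarithmic Voronoi cells\<close>

text \<open>The parameters move on a straight line, along which the variances stay positive for a short time.\<close>

lemma cov_velocity_tangent:
  fixes \<Lambda> \<Omega> :: "(real, 'm) square_matrix"
  assumes \<Lambda>: "edge_supported E \<Lambda>" and \<Omega>: "diagonal \<Omega>" "\<And>j. \<Omega> $ j $ j > 0"
    and \<Lambda>': "edge_supported E \<Lambda>'" and \<Omega>': "diagonal \<Omega>'"
  shows "cov_velocity \<Lambda> \<Omega> \<Lambda>' \<Omega>' \<in> tangent_space (dag_model E) (sem_cov \<Lambda> \<Omega>)"
proof -
  define \<gamma> where "\<gamma> t = sem_cov (\<Lambda> + t *\<^sub>R \<Lambda>') (\<Omega> + t *\<^sub>R \<Omega>')" for t
  let ?A = "matrix_inv (mat 1 - \<Lambda>)"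
  have "\<forall>j. eventually (\<lambda>t. (\<Omega> + t *\<^sub>R \<Omega>') $ j $ j > 0) (nhds 0)"
  proof
    fix j
    have "((\<lambda>t. \<Omega> $ j $ j + t * \<Omega>' $ j $ j) \<longlongrightarrow> \<Omega> $ j $ j + 0 * \<Omega>' $ j $ j) (nhds 0)"
      by (intro tendsto_intros filterlim_ident)
    then show "eventually (\<lambda>t. (\<Omega> + t *\<^sub>R \<Omega>') $ j $ j > 0) (nhds 0)"
      using \<Omega>(2)[of j] by (auto dest: order_tendstoD(1)[where a = 0])
  qed
  then have "eventually (\<lambda>t. \<forall>j. (\<Omega> + t *\<^sub>R \<Omega>') $ j $ j > 0) (nhds 0)"
    by (simp add: eventually_all_finite)
  then obtain \<epsilon> where "\<epsilon> > 0" and pos: "\<And>t. \<bar>t\<bar> < \<epsilon> \<Longrightarrow> \<forall>j. (\<Omega> + t *\<^sub>R \<Omega>') $ j $ j > 0"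
    unfolding eventually_nhds_metric by (auto simp: dist_real_def)
  have "\<gamma> t \<in> dag_model E" if "\<bar>t\<bar> < \<epsilon>" for t
  proof -
    have "edge_supported E (\<Lambda> + t *\<^sub>R \<Lambda>')" "diagonal (\<Omega> + t *\<^sub>R \<Omega>')"
      using \<Lambda> \<Lambda>' \<Omega>(1) \<Omega>' by (auto simp: edge_supported_def diagonal_def)
    then show ?thesis
      unfolding dag_model_eq[OF ordered_dag_axioms] \<gamma>_def using pos[OF that] by blast
  qed
  moreover have "\<gamma> 0 = sem_cov \<Lambda> \<Omega>"
    by (simp add: \<gamma>_def)
  moreover have "(\<gamma> has_vector_derivative cov_velocity \<Lambda> \<Omega> \<Lambda>' \<Omega>') (at 0)"
  proof -
    have "((\<lambda>t. mat 1 - (\<Lambda> + t *\<^sub>R \<Lambda>')) has_derivative (\<lambda>t. - (t *\<^sub>R \<Lambda>'))) (at 0)"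
      by (auto intro!: derivative_eq_intros)
    moreover have "(matrix_inv has_derivative (\<lambda>H. - (?A ** H ** ?A))) (at (mat 1 - (\<Lambda> + 0 *\<^sub>R \<Lambda>')))"
      using has_derivative_matrix_inv[of "mat 1 - \<Lambda>"] det_one_minus[OF \<Lambda>] by simp
    ultimately have "((\<lambda>t. matrix_inv (mat 1 - (\<Lambda> + t *\<^sub>R \<Lambda>'))) has_derivative
        (\<lambda>t. - (?A ** (- (t *\<^sub>R \<Lambda>')) ** ?A))) (at 0)"
      by (rule has_derivative_compose)
    then have A: "((\<lambda>t. matrix_inv (mat 1 - (\<Lambda> + t *\<^sub>R \<Lambda>'))) has_derivative
        (\<lambda>t. t *\<^sub>R (?A ** \<Lambda>' ** ?A))) (at 0)"
      by (simp add: matrix_mult_minus matrix_mult_scaleR)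
    have "bounded_linear (transpose :: (real, 'm) square_matrix \<Rightarrow> _)"
      by (auto intro!: linearI simp: vec_eq_iff simp flip: linear_conv_bounded_linear)
    from bounded_linear.has_derivative[OF this A]
    have "((\<lambda>t. transpose (matrix_inv (mat 1 - (\<Lambda> + t *\<^sub>R \<Lambda>')))) has_derivative
        (\<lambda>t. transpose (t *\<^sub>R (?A ** \<Lambda>' ** ?A)))) (at 0)" .
    moreover have "((\<lambda>t. \<Omega> + t *\<^sub>R \<Omega>') has_derivative (\<lambda>t. t *\<^sub>R \<Omega>')) (at 0)"
      by (auto intro!: derivative_eq_intros)
    ultimately have "(\<gamma> has_derivative (\<lambda>t. transpose ?A ** \<Omega> ** (t *\<^sub>R (?A ** \<Lambda>' ** ?A))
       + (transpose ?A ** (t *\<^sub>R \<Omega>') + transpose (t *\<^sub>R (?A ** \<Lambda>' ** ?A)) ** \<Omega>) ** ?A)) (at 0)"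
      unfolding \<gamma>_def [abs_def] sem_cov_def
      using has_derivative_matrix_mult[OF has_derivative_matrix_mult A] by fastforce
    moreover have "transpose ?A ** \<Omega> ** (t *\<^sub>R (?A ** \<Lambda>' ** ?A))
       + (transpose ?A ** (t *\<^sub>R \<Omega>') + transpose (t *\<^sub>R (?A ** \<Lambda>' ** ?A)) ** \<Omega>) ** ?A
      = t *\<^sub>R cov_velocity \<Lambda> \<Omega> \<Lambda>' \<Omega>'" for t
      by (simp add: cov_velocity_def sem_cov_def transpose_scalar matrix_mult_scaleR
          matrix_transpose_mul matrix_mul_assoc scaleR_add_right matrix_add_rdistrib)
    ultimately show ?thesis
      by (simp add: has_vector_derivative_def)
  qed
  ultimately show ?thesis
    unfolding tangent_space_def using \<open>\<epsilon> > 0\<close> by blast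
qed

lemma trace_inverse_sem_cov:
  fixes \<Lambda> :: "(real, 'm) square_matrix"
  assumes \<Lambda>: "edge_supported E \<Lambda>" and \<Omega>: "diagonal \<Omega>" "\<And>j. \<Omega> $ j $ j > 0"
  shows "trace (S ** matrix_inv (sem_cov \<Lambda> \<Omega>))
    = (\<Sum>j\<in>UNIV. (transpose (mat 1 - \<Lambda>) ** S ** (mat 1 - \<Lambda>)) $ j $ j / \<Omega> $ j $ j)"
proof -
  let ?B = "mat 1 - \<Lambda>"
  define D :: "(real, 'm) square_matrix" where "D = (\<chi> i j. if i = j then 1 / \<Omega> $ i $ i else 0)"
  have D: "diagonal D" by (simp add: D_def diagonal_def)
  have "\<Omega> ** D = mat 1"
    using \<Omega> by (simp add: vec_eq_iff diagonal_mult_entry[OF \<Omega>(1)])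
      (use \<Omega>(2) in \<open>simp add: D_def mat_1_entry less_imp_neq[THEN not_sym]\<close>)
  have "sem_cov \<Lambda> \<Omega> ** (?B ** D ** transpose ?B)
      = transpose (matrix_inv ?B) ** (\<Omega> ** D) ** transpose ?B"
    by (simp add: matrix_mul_assoc sem_cov_mult[OF \<Lambda>])
  also have "\<dots> = mat 1"
    by (simp add: \<open>\<Omega> ** D = mat 1\<close> inverse_one_minus[OF \<Lambda>])
  finally have "matrix_inv (sem_cov \<Lambda> \<Omega>) = ?B ** D ** transpose ?B"
    by (rule matrix_inv_eqI)
  then have "trace (S ** matrix_inv (sem_cov \<Lambda> \<Omega>)) = trace (S ** ?B ** D ** transpose ?B)"
    by (simp add: matrix_mul_assoc)
  also have "\<dots> = trace (transpose ?B ** S ** ?B ** D)"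
    using trace_mul_sym[of "S ** ?B ** D" "transpose ?B"] by (simp add: matrix_mul_assoc)
  also have "\<dots> = (\<Sum>j\<in>UNIV. (transpose ?B ** S ** ?B) $ j $ j / \<Omega> $ j $ j)"
    unfolding trace_def diagonal_mult_entry(2)[OF D] by (simp add: D_def)
  finally show ?thesis .
qed

text \<open>The residual is uncorrelated with the parents, so a change \<open>\<Delta>\<close> of the coefficients adds
\<open>\<Delta>\<^sup>T S \<Delta>\<close> to the covariance of the residuals without a cross term on the diagonal.\<close>

lemma residual_variance_minimal:
  fixes \<Lambda> \<Lambda>' :: "(real, 'm) square_matrix"
  assumes S: "S \<in> PD" and \<Lambda>: "edge_supported E \<Lambda>" and normal: "normal_equations E \<Lambda> \<Omega> S"
    and \<Lambda>': "edge_supported E \<Lambda>'"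
  shows "(transpose (mat 1 - \<Lambda>) ** S ** (mat 1 - \<Lambda>)) $ j $ j = \<Omega> $ j $ j"
    and "\<Omega> $ j $ j \<le> (transpose (mat 1 - \<Lambda>') ** S ** (mat 1 - \<Lambda>')) $ j $ j"
proof -
  let ?B = "mat 1 - \<Lambda>"
  let ?Y = "transpose ?B ** S"
  have sym: "transpose S = S"
    using S by (simp add: PD_def sym_mats_def)
  have orth: "(?Y ** \<Delta>) $ j $ j = 0" if "edge_supported E \<Delta>" for \<Delta> :: "(real, 'm) square_matrix"
  proof -
    have "?Y $ j $ k * \<Delta> $ k $ j = 0" for k
      using normal that
      by (cases "(k, j) \<in> E") (auto simp: normal_equations_def edge_supported_def)
    then show ?thesis
      unfolding matrix_mult_entry[of ?Y] by (intro sum.neutral ballI)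
  qed
  have "(?Y ** ?B) $ j $ j = ?Y $ j $ j - (?Y ** \<Lambda>) $ j $ j"
    by (simp add: matrix_mult_diff)
  then show res: "(?Y ** ?B) $ j $ j = \<Omega> $ j $ j"
    using normal orth[OF \<Lambda>] by (simp add: normal_equations_def)
  define \<Delta> where "\<Delta> = \<Lambda>' - \<Lambda>"
  have "edge_supported E \<Delta>"
    using \<Lambda> \<Lambda>' by (simp add: \<Delta>_def edge_supported_def)
  have B': "mat 1 - \<Lambda>' = ?B - \<Delta>"
    by (simp add: \<Delta>_def)
  have "transpose (mat 1 - \<Lambda>') ** S ** (mat 1 - \<Lambda>')
      = ?Y ** ?B - ?Y ** \<Delta> - transpose (?Y ** \<Delta>) + transpose \<Delta> ** S ** \<Delta>"
    unfolding B'
    by (simp add: transpose_diff matrix_mult_diff matrix_transpose_mul sym matrix_mul_assoc)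
  then have "(transpose (mat 1 - \<Lambda>') ** S ** (mat 1 - \<Lambda>')) $ j $ j
      = \<Omega> $ j $ j + (transpose \<Delta> ** S ** \<Delta>) $ j $ j"
    using res orth[OF \<open>edge_supported E \<Delta>\<close>] by simp
  moreover have "(transpose \<Delta> ** S ** \<Delta>) $ j $ j = column j \<Delta> \<bullet> (S *v column j \<Delta>)"
    unfolding matrix_mul_assoc[symmetric]
    by (simp add: inner_vec_def column_def matrix_mult_entry matrix_vector_mult_def)
  moreover have "column j \<Delta> \<bullet> (S *v column j \<Delta>) \<ge> 0"
    using S by (cases "column j \<Delta> = 0") (auto simp: PD_def less_imp_le)
  ultimately show "\<Omega> $ j $ j \<le> (transpose (mat 1 - \<Lambda>') ** S ** (mat 1 - \<Lambda>')) $ j $ j"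
    by simp
qed

text \<open>The log-likelihood is a sum over the vertices of \<open>ln \<omega> + q / \<omega>\<close>, up to the factor \<open>- n / 2\<close>, where \<open>q\<close> is
the residual variance under \<open>S\<close>. Each summand is smallest when \<open>q\<close> is smallest and \<open>\<omega> = q\<close>.\<close>

lemma normal_equations_imp_max:
  fixes \<Lambda> \<Lambda>' :: "(real, 'm) square_matrix"
  assumes S: "S \<in> PD"
    and \<Lambda>: "edge_supported E \<Lambda>" and \<Omega>: "diagonal \<Omega>" "\<And>j. \<Omega> $ j $ j > 0"
    and normal: "normal_equations E \<Lambda> \<Omega> S"
    and \<Lambda>': "edge_supported E \<Lambda>'" and \<Omega>': "diagonal \<Omega>'" "\<And>j. \<Omega>' $ j $ j > 0"
  shows "loglik n (sem_cov \<Lambda>' \<Omega>') S \<le> loglik n (sem_cov \<Lambda> \<Omega>) S"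
proof -
  let ?q = "\<lambda>\<Lambda> j. (transpose (mat 1 - \<Lambda>) ** S ** (mat 1 - \<Lambda>)) $ j $ j"
  have lik: "loglik n (sem_cov \<Lambda> \<Omega>) S
      = - (real n / 2) * (\<Sum>j\<in>UNIV. ln (\<Omega> $ j $ j) + ?q \<Lambda> j / \<Omega> $ j $ j)"
    if "edge_supported E \<Lambda>" "diagonal \<Omega>" "\<And>j. \<Omega> $ j $ j > 0" for \<Lambda> \<Omega> :: "(real, 'm) square_matrix"
  proof -
    have "ln (\<Prod>j\<in>UNIV. \<Omega> $ j $ j) = (\<Sum>j\<in>UNIV. ln (\<Omega> $ j $ j))"
      using that(3) by (intro ln_prod) (simp_all add: less_imp_neq[THEN not_sym])
    then show ?thesis
      by (simp add: loglik_def trace_inverse_sem_cov[OF that] det_sem_cov[OF that(1,2)]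
          sum.distrib algebra_simps)
  qed
  have "(\<Sum>j\<in>UNIV. ln (\<Omega> $ j $ j) + ?q \<Lambda> j / \<Omega> $ j $ j)
      \<le> (\<Sum>j\<in>UNIV. ln (\<Omega>' $ j $ j) + ?q \<Lambda>' j / \<Omega>' $ j $ j)"
  proof (rule sum_mono)
    fix j
    have pos: "\<Omega> $ j $ j > 0" "\<Omega>' $ j $ j > 0" by (fact \<Omega> \<Omega>')+
    have "ln (\<Omega> $ j $ j) - ln (\<Omega>' $ j $ j) \<le> \<Omega> $ j $ j / \<Omega>' $ j $ j - 1"
      using pos ln_le_minus_one[of "\<Omega> $ j $ j / \<Omega>' $ j $ j"] by (simp add: ln_div)
    moreover have "\<Omega> $ j $ j / \<Omega>' $ j $ j \<le> ?q \<Lambda>' j / \<Omega>' $ j $ j"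
      using pos residual_variance_minimal(2)[OF S \<Lambda> normal \<Lambda>'] by (simp add: divide_right_mono)
    moreover have "?q \<Lambda> j / \<Omega> $ j $ j = 1"
      using pos residual_variance_minimal(1)[OF S \<Lambda> normal \<Lambda>] by simp
    ultimately show "ln (\<Omega> $ j $ j) + ?q \<Lambda> j / \<Omega> $ j $ j
        \<le> ln (\<Omega>' $ j $ j) + ?q \<Lambda>' j / \<Omega>' $ j $ j"
      by linarith
  qed
  then show ?thesis
    unfolding lik[OF \<Lambda> \<Omega>] lik[OF \<Lambda>' \<Omega>'] by (intro mult_left_mono_neg) auto
qed

text \<open>Criticality gives the normal equations and these give a global maximum; a maximum is critical
because the log-likelihood is stationary along every curve in the model.\<close>

lemma log_Voronoi_eq_spectrahedron:
  assumes "n > 0" and \<Sigma>: "\<Sigma> \<in> dag_model E"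
  shows "log_Voronoi n (dag_model E) \<Sigma> = log_normal_spectrahedron n (dag_model E) \<Sigma>"
proof -
  obtain \<Lambda> \<Omega> where \<Sigma>_eq: "\<Sigma> = sem_cov \<Lambda> \<Omega>" and \<Lambda>: "edge_supported E \<Lambda>"
    and \<Omega>: "diagonal \<Omega>" "\<And>j. \<Omega> $ j $ j > 0"
    using \<Sigma> unfolding dag_model_eq[OF ordered_dag_axioms] by blast
  have sym: "\<Sigma> \<in> sym_mats"
    unfolding \<Sigma>_eq by (rule sem_cov_sym[OF \<Omega>(1)])
  have det: "det \<Sigma> > 0"
    unfolding \<Sigma>_eq det_sem_cov[OF \<Lambda> \<Omega>(1)] by (intro prod_pos) (simp add: \<Omega>)
  have "critical_point n (dag_model E) S \<Sigma>
      \<longleftrightarrow> (\<forall>\<Sigma>'\<in>dag_model E. loglik n \<Sigma> S \<ge> loglik n \<Sigma>' S)" if S: "S \<in> PD" for S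
  proof
    have S_sym: "S \<in> sym_mats"
      using S by (simp add: PD_def)
    assume "critical_point n (dag_model E) S \<Sigma>"
    then have orth: "score n S \<Sigma> \<in> sym_orthogonal (tangent_space (dag_model E) \<Sigma>)"
      using loglik_sym_gradient[OF sym S_sym det] by (auto simp: critical_point_def)
    have "normal_equations E \<Lambda> \<Omega> S"
    proof (rule normal_equationsI[OF \<Lambda> \<Omega>(1)])
      show "\<Omega> $ j $ j \<noteq> 0" for j
        using \<Omega>(2)[of j] by simp
      show "2 / real n \<noteq> 0" using \<open>n > 0\<close> by simp
      show "S = sem_cov \<Lambda> \<Omega> + (2 / real n) *\<^sub>R (sem_cov \<Lambda> \<Omega> ** score n S \<Sigma> ** sem_cov \<Lambda> \<Omega>)"
        using score_solve[of \<Sigma> n S] det \<open>n > 0\<close> by (simp add: \<Sigma>_eq)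
      show "score n S \<Sigma> \<in> sym_mats"
        using orth by (simp add: sym_orthogonal_def)
      have velocity: "trace (score n S \<Sigma> ** cov_velocity \<Lambda> \<Omega> \<Lambda>' \<Omega>') = 0"
        if "edge_supported E \<Lambda>'" "diagonal \<Omega>'" for \<Lambda>' \<Omega>'
        using orth cov_velocity_tangent[OF \<Lambda> \<Omega> that] by (simp add: sym_orthogonal_def \<Sigma>_eq)
      show "trace (score n S \<Sigma> ** cov_velocity \<Lambda> \<Omega> (single i j) 0) = 0" if "(i, j) \<in> E" for i j
        by (rule velocity[OF edge_supported_single[OF that] diagonal_0])
      show "trace (score n S \<Sigma> ** cov_velocity \<Lambda> \<Omega> 0 (single j j)) = 0" for j
        by (rule velocity[OF edge_supported_0 diagonal_single])
    qed
    then show "\<forall>\<Sigma>'\<in>dag_model E. loglik n \<Sigma> S \<ge> loglik n \<Sigma>' S"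
      unfolding dag_model_eq[OF ordered_dag_axioms]
      using normal_equations_imp_max[OF S \<Lambda> \<Omega>] by (auto simp: \<Sigma>_eq)
  next
    have S_sym: "S \<in> sym_mats"
      using S by (simp add: PD_def)
    assume max: "\<forall>\<Sigma>'\<in>dag_model E. loglik n \<Sigma> S \<ge> loglik n \<Sigma>' S"
    have "trace (score n S \<Sigma> ** v) = 0" if v: "v \<in> tangent_space (dag_model E) \<Sigma>" for v
    proof -
      obtain \<gamma> \<epsilon> where "\<epsilon> > 0" and \<gamma>: "\<And>t. \<bar>t\<bar> < \<epsilon> \<Longrightarrow> \<gamma> t \<in> dag_model E" "\<gamma> 0 = \<Sigma>"
        and der: "(\<gamma> has_derivative (\<lambda>t. t *\<^sub>R v)) (at 0)"
        using v unfolding tangent_space_def has_vector_derivative_def by blast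
      have "((\<lambda>A. loglik n A S) has_derivative (\<lambda>H. trace (score n S \<Sigma> ** H))) (at (\<gamma> 0))"
        unfolding \<gamma>(2) by (rule has_derivative_loglik[OF det])
      from has_derivative_compose[OF der this]
      have "((\<lambda>t. loglik n (\<gamma> t) S) has_derivative (\<lambda>t. t * trace (score n S \<Sigma> ** v))) (at 0)"
        by (simp add: matrix_mult_scaleR trace_def sum_distrib_left)
      then have "DERIV (\<lambda>t. loglik n (\<gamma> t) S) 0 :> trace (score n S \<Sigma> ** v)"
        by (rule has_derivative_imp_has_field_derivative) simp
      then show ?thesis
        by (rule DERIV_local_max[OF _ \<open>\<epsilon> > 0\<close>]) (use max \<gamma> in auto)
    qed
    then show "critical_point n (dag_model E) S \<Sigma>"
      using \<Sigma> loglik_sym_gradient[OF sym S_sym det] score_sym[OF sym S_sym] det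
      by (auto simp: critical_point_def sym_orthogonal_def)
  qed
  then show ?thesis
    by (auto simp: log_Voronoi_def log_normal_spectrahedron_def log_normal_space_def PD_def)
qed

end

section \<open>Polynomial functions of a complex matrix\<close>

lemma matrix_poly_uminus: "matrix_poly p \<Longrightarrow> matrix_poly (\<lambda>A. - p A)"
  using matrix_poly.mult[OF matrix_poly.const[of "-1"]] by simp

lemma matrix_poly_diff: "matrix_poly p \<Longrightarrow> matrix_poly q \<Longrightarrow> matrix_poly (\<lambda>A. p A - q A)"
  using matrix_poly.add[OF _ matrix_poly_uminus] by simp

lemma matrix_poly_sum:
  "(\<And>x. x \<in> I \<Longrightarrow> matrix_poly (p x)) \<Longrightarrow> matrix_poly (\<lambda>A. \<Sum>x\<in>I. p x A)"
  by (induction I rule: infinite_finite_induct) (auto intro: matrix_poly.intros)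

lemma matrix_poly_prod:
  "(\<And>x. x \<in> I \<Longrightarrow> matrix_poly (p x)) \<Longrightarrow> matrix_poly (\<lambda>A. \<Prod>x\<in>I. p x A)"
  by (induction I rule: infinite_finite_induct) (auto intro: matrix_poly.intros)

text \<open>Polynomiality of matrix valued maps, so that closure under matrix operations can be stated
without entries.\<close>

definition poly_map :: "(complex^'m^'m \<Rightarrow> complex^'m^'m) \<Rightarrow> bool" where
  "poly_map T \<longleftrightarrow> (\<forall>i j. matrix_poly (\<lambda>A. T A $ i $ j))"

lemma poly_mapD: "poly_map T \<Longrightarrow> matrix_poly (\<lambda>A. T A $ i $ j)"
  by (simp add: poly_map_def)

lemma poly_map_id: "poly_map (\<lambda>A. A)"
  by (simp add: poly_map_def matrix_poly.entry)

lemma poly_map_const: "poly_map (\<lambda>A. C)"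
  by (simp add: poly_map_def matrix_poly.const)

lemma poly_map_add: "poly_map T \<Longrightarrow> poly_map R \<Longrightarrow> poly_map (\<lambda>A. T A + R A)"
  by (simp add: poly_map_def matrix_poly.add)

lemma poly_map_diff: "poly_map T \<Longrightarrow> poly_map R \<Longrightarrow> poly_map (\<lambda>A. T A - R A)"
  by (simp add: poly_map_def matrix_poly_diff)

lemma poly_map_scaleR: "poly_map T \<Longrightarrow> poly_map (\<lambda>A. c *\<^sub>R T A)"
  by (simp add: poly_map_def scaleR_conv_of_real matrix_poly.mult matrix_poly.const
      del: of_real_mult)

lemma poly_map_mult: "poly_map T \<Longrightarrow> poly_map R \<Longrightarrow> poly_map (\<lambda>A. T A ** R A)"
  by (simp add: poly_map_def matrix_mult_entry matrix_poly_sum matrix_poly.mult)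

lemma poly_map_transpose: "poly_map T \<Longrightarrow> poly_map (\<lambda>A. transpose (T A))"
  by (simp add: poly_map_def)

lemma matrix_poly_det: "poly_map T \<Longrightarrow> matrix_poly (\<lambda>A. det (T A))"
  unfolding det_def poly_map_def
  by (intro matrix_poly_sum matrix_poly.mult matrix_poly.const matrix_poly_prod) blast

lemma matrix_poly_compose:
  assumes "matrix_poly p" "poly_map T"
  shows "matrix_poly (\<lambda>A. p (T A))"
  using assms(1)
  by induction (auto intro: matrix_poly.intros poly_mapD[OF assms(2)])

lemma matrix_poly_if:
  "(b \<Longrightarrow> matrix_poly p) \<Longrightarrow> (\<not> b \<Longrightarrow> matrix_poly q) \<Longrightarrow> matrix_poly (\<lambda>A. if b then p A else q A)"
  by (cases b) simp_all

lemma poly_map_compose: "poly_map F \<Longrightarrow> poly_map T \<Longrightarrow> poly_map (\<lambda>A. F (T A))"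
  by (auto simp: poly_map_def intro: matrix_poly_compose[where T = T])

lemmas poly_map_intros = poly_map_id poly_map_const poly_map_add poly_map_diff poly_map_scaleR
  poly_map_mult poly_map_transpose

lemma matrix_poly_has_derivative:
  fixes p :: "complex^'m^'m \<Rightarrow> complex"
  assumes "matrix_poly p"
  shows "\<exists>G. poly_map G \<and>
    (\<forall>Z. (p has_derivative (\<lambda>H. \<Sum>i\<in>UNIV. \<Sum>j\<in>UNIV. G Z $ i $ j * H $ i $ j)) (at Z))"
  using assms
proof induction
  case (const c)
  show ?case by (intro exI[of _ "\<lambda>A. 0"]) (simp add: poly_map_const)
next
  case (entry k l)
  have "(\<Sum>i\<in>UNIV. \<Sum>j\<in>UNIV. single k l $ i $ j * H $ i $ j) = H $ k $ l" for H :: "complex^'m^'m"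
  proof -
    have "(\<Sum>j\<in>UNIV. single k l $ i $ j * H $ i $ j) = (if i = k then H $ k $ l else 0)" for i
      by (simp add: single_def if_distrib[of "\<lambda>x. x * _"] cong: if_cong)
    then show ?thesis by simp
  qed
  then show ?case
    by (intro exI[of _ "\<lambda>A. single k l"]) (simp add: poly_map_const has_derivative_entry)
next
  case (add p q)
  then obtain G G' where "poly_map G" "poly_map G'"
    "\<And>Z. (p has_derivative (\<lambda>H. \<Sum>i\<in>UNIV. \<Sum>j\<in>UNIV. G Z $ i $ j * H $ i $ j)) (at Z)"
    "\<And>Z. (q has_derivative (\<lambda>H. \<Sum>i\<in>UNIV. \<Sum>j\<in>UNIV. G' Z $ i $ j * H $ i $ j)) (at Z)"
    by blast
  then show ?case
    by (intro exI[of _ "\<lambda>A. G A + G' A"] conjI poly_map_add allI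
          has_derivative_eq_rhs[OF has_derivative_add])
       (auto simp: fun_eq_iff algebra_simps sum.distrib)
next
  case (mult p q)
  then obtain G G' where "poly_map G" "poly_map G'"
    "\<And>Z. (p has_derivative (\<lambda>H. \<Sum>i\<in>UNIV. \<Sum>j\<in>UNIV. G Z $ i $ j * H $ i $ j)) (at Z)"
    "\<And>Z. (q has_derivative (\<lambda>H. \<Sum>i\<in>UNIV. \<Sum>j\<in>UNIV. G' Z $ i $ j * H $ i $ j)) (at Z)"
    by blast
  moreover have "poly_map (\<lambda>A. \<chi> i j. p A * G' A $ i $ j + G A $ i $ j * q A)"
    unfolding poly_map_def vec_lambda_beta
    by (intro allI matrix_poly.add matrix_poly.mult poly_mapD mult.hyps \<open>poly_map G\<close> \<open>poly_map G'\<close>)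
  ultimately show ?case
    by (intro exI[of _ "\<lambda>A. \<chi> i j. p A * G' A $ i $ j + G A $ i $ j * q A"] conjI allI
          has_derivative_eq_rhs[OF has_derivative_mult])
       (auto simp: fun_eq_iff algebra_simps sum.distrib sum_distrib_left)
qed

lemma matrix_poly_differentiable:
  assumes "matrix_poly p"
  shows "p differentiable (at Z)"
  using matrix_poly_has_derivative[OF assms] unfolding differentiable_def by blast

lemma matrix_poly_frechet_derivative:
  assumes "matrix_poly p"
  shows "(p has_derivative frechet_derivative p (at Z)) (at Z)"
  using matrix_poly_differentiable[OF assms] by (simp add: frechet_derivative_works)

text \<open>The matrix which represents the differential of \<open>p\<close> on symmetric directions in the trace form.\<close>

definition sym_grad :: "(complex^'m^'m \<Rightarrow> complex) \<Rightarrow> complex^'m^'m \<Rightarrow> complex^'m^'m" where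
  "sym_grad p Z = (\<chi> i j. (frechet_derivative p (at Z) (single i j)
      + frechet_derivative p (at Z) (single j i)) / 2)"

lemma sym_grad_sym: "sym_grad p Z \<in> sym_mats"
  by (auto simp: sym_grad_def sym_mats_iff add.commute)

lemma sym_grad:
  assumes "matrix_poly p"
  shows "poly_map (sym_grad p)"
    and "H \<in> sym_mats \<Longrightarrow> trace (sym_grad p Z ** H) = frechet_derivative p (at Z) H"
proof -
  obtain G where G: "poly_map G"
    and der: "\<And>Z. (p has_derivative (\<lambda>H. \<Sum>i\<in>UNIV. \<Sum>j\<in>UNIV. G Z $ i $ j * H $ i $ j)) (at Z)"
    using matrix_poly_has_derivative[OF assms] by blast
  have fd: "frechet_derivative p (at Z) H = (\<Sum>i\<in>UNIV. \<Sum>j\<in>UNIV. G Z $ i $ j * H $ i $ j)" for Z H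
    using fun_cong[OF frechet_derivative_at[OF der], of Z H] by simp
  have "frechet_derivative p (at Z) (single k l) = G Z $ k $ l" for k l Z
  proof -
    have "(\<Sum>j\<in>UNIV. G Z $ i $ j * single k l $ i $ j) = (if i = k then G Z $ k $ l else 0)" for i
      by (simp add: single_def if_distrib[of "\<lambda>x. _ * x"] cong: if_cong)
    then show ?thesis by (simp add: fd)
  qed
  then have grad: "sym_grad p Z = (\<chi> i j. (G Z $ i $ j + G Z $ j $ i) * (1 / 2))" for Z
    by (simp add: sym_grad_def)
  show "poly_map (sym_grad p)"
    unfolding poly_map_def grad vec_lambda_beta
    by (intro allI matrix_poly.mult matrix_poly.add matrix_poly.const poly_mapD[OF G])
  assume H: "H \<in> sym_mats"
  have "trace (sym_grad p Z ** H)
      = (\<Sum>i\<in>UNIV. \<Sum>j\<in>UNIV. G Z $ i $ j * H $ i $ j) / 2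
        + (\<Sum>i\<in>UNIV. \<Sum>j\<in>UNIV. G Z $ j $ i * H $ j $ i) / 2"
    using H unfolding sym_mats_iff grad trace_def matrix_mult_entry
    by (simp add: sum_divide_distrib flip: sum.distrib) (intro sum.cong refl, simp add: field_simps)
  also have "(\<Sum>i\<in>UNIV. \<Sum>j\<in>UNIV. G Z $ j $ i * H $ j $ i)
      = (\<Sum>i\<in>UNIV. \<Sum>j\<in>UNIV. G Z $ i $ j * H $ i $ j)"
    by (rule sum.swap)
  finally show "trace (sym_grad p Z ** H) = frechet_derivative p (at Z) H"
    by (simp add: fd)
qed

lemma matrix_poly_line:
  assumes "matrix_poly p"
  shows "\<exists>q. \<forall>t. p (\<chi> i j. Z $ i $ j + t * D $ i $ j) = poly q t"
  using assms
proof induction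
  case (const c)
  show ?case by (intro exI[of _ "[:c:]"]) simp
next
  case (entry i j)
  show ?case by (intro exI[of _ "[:Z $ i $ j, D $ i $ j:]"]) simp
next
  case (add p q)
  then show ?case by (metis poly_add)
next
  case (mult p q)
  then show ?case by (metis poly_mult)
qed

text \<open>Positive real matrices are Zariski dense: one entry after the other is freed, a polynomial in one
variable being zero if it vanishes at all positive reals.\<close>

lemma matrix_poly_zero_if_zero_on_positive:
  fixes p :: "complex^'m^'m \<Rightarrow> complex"
  assumes p: "matrix_poly p"
    and zero: "\<And>M. (\<And>i j. M $ i $ j > 0) \<Longrightarrow> p (complexify M) = 0"
  shows "p Z = 0"
proof -
  have "p Z = 0" if "\<And>i j. (i, j) \<notin> F \<Longrightarrow> \<exists>r > 0. Z $ i $ j = complex_of_real r"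
    for F :: "('m \<times> 'm) set" and Z
    using finite[of F] that
  proof (induction F arbitrary: Z rule: finite_induct)
    case empty
    then obtain r where r: "\<And>i j. r i j > 0" "\<And>i j. Z $ i $ j = complex_of_real (r i j)"
      by (metis empty_iff)
    then have "Z = complexify (\<chi> i j. r i j)"
      by (simp add: complexify_def vec_eq_iff)
    then show ?case
      using zero[of "\<chi> i j. r i j"] r(1) by simp
  next
    case (insert x F)
    obtain k l where x: "x = (k, l)" by (cases x)
    obtain q where q: "\<And>t. p (\<chi> i j. Z $ i $ j + t * single k l $ i $ j) = poly q t"
      using matrix_poly_line[OF p] by blast
    have "poly q (complex_of_real r - Z $ k $ l) = 0" if "r > 0" for r
      unfolding q[symmetric]
    proof (rule insert.IH)
      fix i j assume "(i, j) \<notin> F"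
      show "\<exists>s > 0. (\<chi> i j. Z $ i $ j + (complex_of_real r - Z $ k $ l) * single k l $ i $ j) $ i $ j
          = complex_of_real s"
      proof (cases "(i, j) = x")
        case True
        then show ?thesis using that x by (auto simp: single_def)
      next
        case False
        then have "\<exists>s > 0. Z $ i $ j = complex_of_real s"
          using insert.prems \<open>(i, j) \<notin> F\<close> by blast
        then show ?thesis using False x by (auto simp: single_def)
      qed
    qed
    then have "(\<lambda>r. complex_of_real r - Z $ k $ l) ` {0<..} \<subseteq> {t. poly q t = 0}"
      by auto
    moreover have "infinite ((\<lambda>r. complex_of_real r - Z $ k $ l) ` {0<..})"
      using finite_imageD[of "\<lambda>r. complex_of_real r - Z $ k $ l" "{0<..}"] infinite_Ioi[of "0::real"]
      by (auto simp: inj_on_def)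
    ultimately have "q = 0"
      using poly_roots_finite finite_subset by blast
    then show ?case
      using q[of 0] by (simp add: vec_lambda_eta)
  qed
  from this[of UNIV] show ?thesis by simp
qed

section \<open>Zariski closures\<close>

lemma complexify_mult: "complexify (A ** B) = complexify A ** complexify B"
  by (simp add: complexify_def vec_eq_iff matrix_mult_entry)

lemma complexify_transpose: "complexify (transpose A) = transpose (complexify A)"
  by (simp add: complexify_def vec_eq_iff)

lemma complexify_mat_1: "complexify (mat 1) = mat 1"
  by (simp add: complexify_def vec_eq_iff mat_1_entry)

lemma complexify_add: "complexify (A + B) = complexify A + complexify B"
  by (simp add: complexify_def vec_eq_iff)

lemma complexify_diff: "complexify (A - B) = complexify A - complexify B"
  by (simp add: complexify_def vec_eq_iff)

lemma complexify_single: "complexify (single i j) = single i j"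
  by (simp add: complexify_def vec_eq_iff single_def)

lemma complexify_0: "complexify 0 = 0"
  by (simp add: complexify_def vec_eq_iff)

lemma complexify_sym: "A \<in> sym_mats \<Longrightarrow> complexify A \<in> sym_mats"
  by (simp add: complexify_def sym_mats_iff)

lemma complexify_matrix_inv:
  assumes "det A \<noteq> 0"
  shows "complexify (matrix_inv A) = matrix_inv (complexify A)"
proof -
  have "complexify A ** complexify (matrix_inv A) = mat 1"
    using assms by (simp add: matrix_inv_cancel complexify_mat_1 flip: complexify_mult)
  then show ?thesis by (simp add: matrix_inv_eqI)
qed

lemma bounded_linear_complexify: "bounded_linear (complexify :: real^'m^'m \<Rightarrow> _)"
  by (auto intro!: linearI simp: complexify_def vec_eq_iff scaleR_conv_of_real[where 'a = complex]
      simp flip: linear_conv_bounded_linear)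

lemma vanishing_ideal_zariski_closure:
  assumes "\<Theta> \<subseteq> sym_mats"
  shows "vanishing_ideal (zariski_closure \<Theta>) = vanishing_ideal (complexify ` \<Theta>)"
proof
  have "complexify ` \<Theta> \<subseteq> zariski_closure \<Theta>"
    using assms complexify_sym by (fastforce simp: zariski_closure_def vanishing_ideal_def)
  then show "vanishing_ideal (zariski_closure \<Theta>) \<subseteq> vanishing_ideal (complexify ` \<Theta>)"
    by (auto simp: vanishing_ideal_def)
  show "vanishing_ideal (complexify ` \<Theta>) \<subseteq> vanishing_ideal (zariski_closure \<Theta>)"
    by (auto simp: vanishing_ideal_def zariski_closure_def)
qed

lemma frechet_derivative_tangent:
  assumes "p \<in> vanishing_ideal (complexify ` \<Theta>)" "v \<in> tangent_space \<Theta> \<Sigma>"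
  shows "frechet_derivative p (at (complexify \<Sigma>)) (complexify v) = 0"
proof -
  obtain \<gamma> \<epsilon> where "\<epsilon> > 0" and \<gamma>: "\<And>t. \<bar>t\<bar> < \<epsilon> \<Longrightarrow> \<gamma> t \<in> \<Theta>" "\<gamma> 0 = \<Sigma>"
    and der: "(\<gamma> has_derivative (\<lambda>t. t *\<^sub>R v)) (at 0)"
    using assms(2) unfolding tangent_space_def has_vector_derivative_def by blast
  have p: "matrix_poly p" and zero: "\<And>t. \<bar>t\<bar> < \<epsilon> \<Longrightarrow> p (complexify (\<gamma> t)) = 0"
    using assms(1) \<gamma>(1) by (auto simp: vanishing_ideal_def)
  have "((\<lambda>t. complexify (\<gamma> t)) has_derivative (\<lambda>t. complexify (t *\<^sub>R v))) (at 0)"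
    by (rule bounded_linear.has_derivative[OF bounded_linear_complexify der])
  moreover have "(p has_derivative frechet_derivative p (at (complexify \<Sigma>))) (at (complexify (\<gamma> 0)))"
    unfolding \<gamma>(2) by (rule matrix_poly_frechet_derivative[OF p])
  ultimately have "((\<lambda>t. p (complexify (\<gamma> t))) has_derivative
      (\<lambda>t. frechet_derivative p (at (complexify \<Sigma>)) (complexify (t *\<^sub>R v)))) (at 0)"
    by (rule has_derivative_compose)
  then have "((\<lambda>t. 0) has_derivative
      (\<lambda>t. frechet_derivative p (at (complexify \<Sigma>)) (complexify (t *\<^sub>R v)))) (at 0)"
    by (rule has_derivative_transform_within[OF _ \<open>\<epsilon> > 0\<close>]) (auto simp: zero dist_real_def)
  from fun_cong[OF has_derivative_unique[OF this has_derivative_const], of 1]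
  show ?thesis by simp
qed

text \<open>The symmetric gradients at \<open>Z\<close> of the polynomials in the ideal form a complex subspace \<open>N\<close>, and
the Zariski tangent space is its annihilator. In finite dimension \<open>N\<close> is the annihilator of its
annihilator, so a normal covector belongs to \<open>N\<close>; and since \<open>N\<close> is closed under addition, a single
polynomial of the ideal realises it.\<close>

lemma normal_covector_is_differential:
  fixes X :: "(complex^'m^'m) set"
  assumes g: "g \<in> sym_orthogonal (zariski_tangent_space X Z)"
  obtains p where "p \<in> vanishing_ideal X" "sym_grad p Z = g"
proof -
  define N where "N = (\<lambda>p. sym_grad p Z) ` vanishing_ideal X"
  have g_sym: "g \<in> sym_mats" using g by (simp add: sym_orthogonal_def)
  have add: "(\<lambda>W. p W + q W) \<in> vanishing_ideal X \<and>
      sym_grad (\<lambda>W. p W + q W) Z = sym_grad p Z + sym_grad q Z"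
    if "p \<in> vanishing_ideal X" "q \<in> vanishing_ideal X" for p q
  proof -
    have pq: "matrix_poly p" "matrix_poly q" using that by (auto simp: vanishing_ideal_def)
    have "frechet_derivative (\<lambda>W. p W + q W) (at Z)
        = (\<lambda>H. frechet_derivative p (at Z) H + frechet_derivative q (at Z) H)"
      using pq by (intro frechet_derivative_at[symmetric] has_derivative_add
          matrix_poly_frechet_derivative)
    then show ?thesis
      using that by (auto simp: vanishing_ideal_def sym_grad_def vec_eq_iff add_divide_distrib
          intro: matrix_poly.add)
  qed
  have smult: "(\<lambda>W. c * p W) \<in> vanishing_ideal X \<and>
      (\<forall>i j. sym_grad (\<lambda>W. c * p W) Z $ i $ j = c * sym_grad p Z $ i $ j)"
    if "p \<in> vanishing_ideal X" for p c
  proof -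
    have p: "matrix_poly p" using that by (auto simp: vanishing_ideal_def)
    have "frechet_derivative (\<lambda>W. c * p W) (at Z) = (\<lambda>H. c * frechet_derivative p (at Z) H)"
      using p by (intro frechet_derivative_at[symmetric] has_derivative_mult_right
          matrix_poly_frechet_derivative)
    then show ?thesis
      using that by (auto simp: vanishing_ideal_def sym_grad_def algebra_simps
          intro: matrix_poly.intros)
  qed
  have scale: "(\<chi> i j. c * A $ i $ j) \<in> N" if A: "A \<in> N" for A c
  proof -
    obtain p where p: "p \<in> vanishing_ideal X" "A = sym_grad p Z"
      using A by (auto simp: N_def)
    then have "(\<chi> i j. c * A $ i $ j) = sym_grad (\<lambda>W. c * p W) Z"
      using smult[OF p(1), of c] by (simp add: vec_eq_iff)
    then show ?thesis
      using smult[OF p(1), of c] by (auto simp: N_def)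
  qed
  have "(\<lambda>W. 0) \<in> vanishing_ideal X"
    by (auto simp: vanishing_ideal_def intro: matrix_poly.const)
  moreover have "sym_grad (\<lambda>W. 0) Z = 0"
    by (simp add: sym_grad_def vec_eq_iff)
  ultimately have "0 \<in> N"
    unfolding N_def by (metis imageI)
  have "subspace N"
  proof (rule subspaceI)
    show "0 \<in> N" by fact
    show "A + B \<in> N" if "A \<in> N" "B \<in> N" for A B
      using that add unfolding N_def by (smt (verit) imageE imageI)
    show "c *\<^sub>R A \<in> N" if "A \<in> N" for A c
    proof -
      have "c *\<^sub>R A = (\<chi> i j. complex_of_real c * A $ i $ j)"
        by (simp add: vec_eq_iff scaleR_conv_of_real[where 'a = complex])
      then show ?thesis using scale[OF that] by simp
    qed
  qed
  obtain y z where y: "y \<in> N" and z: "\<And>w. w \<in> N \<Longrightarrow> orthogonal z w" and gyz: "g = y + z"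
    using orthogonal_subspace_decomp_exists[of N g] \<open>subspace N\<close> by (metis span_eq_iff)
  have N_sym: "N \<subseteq> sym_mats"
    by (auto simp: N_def sym_grad_sym)
  have z_sym: "z \<in> sym_mats"
    using gyz g_sym y N_sym by (auto simp: sym_mats_iff)
  \<comment> \<open>The real inner product with z is the real part of the complex trace form against the
    conjugate of z. As N is a complex subspace, the conjugate is annihilated by all of N.\<close>
  define T where "T = (\<chi> i j. cnj (z $ i $ j))"
  have T_sym: "T \<in> sym_mats"
    using z_sym by (simp add: T_def sym_mats_iff)
  have trace_T: "trace (A ** T) = (\<Sum>i\<in>UNIV. \<Sum>j\<in>UNIV. A $ i $ j * cnj (z $ i $ j))" for A
    using z_sym by (simp add: trace_def matrix_mult_entry T_def sym_mats_iff)
  have Re_T: "Re (trace (A ** T)) = z \<bullet> A" for A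
    by (simp add: trace_T inner_vec_def inner_complex_def algebra_simps)
  have trace_N: "trace (A ** T) = 0" if "A \<in> N" for A
  proof (rule complex_eqI)
    show "Re (trace (A ** T)) = Re 0"
      using z[OF that] by (simp add: Re_T orthogonal_def)
    have "trace ((\<chi> i j. \<i> * A $ i $ j) ** T) = \<i> * trace (A ** T)"
      by (simp add: trace_T sum_distrib_left mult.assoc)
    then have "Re (\<i> * trace (A ** T)) = 0"
      using z[OF scale[OF that, of \<i>]] by (metis Re_T orthogonal_def)
    then show "Im (trace (A ** T)) = Im 0" by simp
  qed
  have "T \<in> zariski_tangent_space X Z"
    unfolding zariski_tangent_space_def
    using T_sym trace_N sym_grad(2)[OF _ T_sym] by (fastforce simp: N_def vanishing_ideal_def)
  then have "trace (g ** T) = 0"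
    using g by (simp add: sym_orthogonal_def)
  then have "trace (z ** T) = 0"
    using trace_N[OF y] by (simp add: gyz matrix_add_rdistrib trace_add)
  then have "z = 0"
    using Re_T[of z] by simp
  then show ?thesis
    using that y gyz by (auto simp: N_def)
qed

section \<open>Regression on the parents\<close>

text \<open>The block of \<open>S\<close> on the parents of \<open>j\<close>, padded by the identity matrix. The padding keeps the type
of the full matrix and does not change the determinant of the block.\<close>

definition parent_gram :: "('m \<times> 'm) set \<Rightarrow> 'm \<Rightarrow> 'a::field^'m^'m \<Rightarrow> 'a^'m^'m" where
  "parent_gram E j S =
     (\<chi> a b. if (a, j) \<in> E \<and> (b, j) \<in> E then S $ a $ b else if a = b then 1 else 0)"

definition parent_det :: "('m \<times> 'm) set \<Rightarrow> 'm \<Rightarrow> 'a::field^'m^'m \<Rightarrow> 'a" where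
  "parent_det E j S = det (parent_gram E j S)"

definition parent_rhs :: "('m \<times> 'm) set \<Rightarrow> 'm \<Rightarrow> 'a::field^'m^'m \<Rightarrow> 'a^'m" where
  "parent_rhs E j S = (\<chi> a. if (a, j) \<in> E then S $ a $ j else 0)"

text \<open>Cramer's numerator of the coefficient of \<open>k\<close> in the regression of \<open>j\<close> on its parents.\<close>

definition coef_num :: "('m \<times> 'm) set \<Rightarrow> 'a::field^'m^'m \<Rightarrow> 'm \<Rightarrow> 'm \<Rightarrow> 'a" where
  "coef_num E S k j = (if (k, j) \<in> E
     then det (\<chi> a b. if b = k then parent_rhs E j S $ a else parent_gram E j S $ a $ b)
     else 0)"

definition regression :: "('m \<times> 'm) set \<Rightarrow> 'a::field^'m^'m \<Rightarrow> 'a^'m^'m" where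
  "regression E S = (\<chi> k j. coef_num E S k j / parent_det E j S)"

definition resid_var :: "('m \<times> 'm) set \<Rightarrow> 'a::field^'m^'m \<Rightarrow> 'a^'m^'m" where
  "resid_var E S =
     (\<chi> i j. if i = j then (transpose (mat 1 - regression E S) ** S) $ j $ j else 0)"

definition mle :: "('m \<times> 'm) set \<Rightarrow> 'a::field^'m^'m \<Rightarrow> 'a^'m^'m" where
  "mle E S = sem_cov (regression E S) (resid_var E S)"

lemma edge_supported_regression: "edge_supported E (regression E S)"
  by (simp add: edge_supported_def regression_def coef_num_def)

lemma diagonal_resid_var: "diagonal (resid_var E S)"
  by (simp add: diagonal_def resid_var_def)

lemma parent_gram_mult:
  assumes x: "\<And>k. (k, j) \<notin> E \<Longrightarrow> x $ k = 0"
  shows "(parent_gram E j S *v x) $ a = (if (a, j) \<in> E then \<Sum>k\<in>UNIV. S $ a $ k * x $ k else 0)"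
proof (cases "(a, j) \<in> E")
  case True
  have "parent_gram E j S $ a $ k * x $ k = S $ a $ k * x $ k" for k
    using True x[of k] by (cases "(k, j) \<in> E") (simp_all add: parent_gram_def)
  then have "(\<Sum>k\<in>UNIV. parent_gram E j S $ a $ k * x $ k) = (\<Sum>k\<in>UNIV. S $ a $ k * x $ k)"
    by (rule sum.cong[OF refl])
  then show ?thesis
    using True by (simp add: matrix_vector_mult_def)
next
  case False
  have "parent_gram E j S $ a $ k * x $ k = 0" for k
    using False x[of a] by (cases "a = k") (simp_all add: parent_gram_def)
  then have "(\<Sum>k\<in>UNIV. parent_gram E j S $ a $ k * x $ k) = 0"
    by (intro sum.neutral ballI)
  then show ?thesis
    using False by (simp add: matrix_vector_mult_def)
qed

lemma uncorrelated_iff: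
  fixes S :: "'a::field^'m^'m"
  assumes S: "S \<in> sym_mats" and \<Lambda>: "edge_supported E \<Lambda>"
  shows "(\<forall>i. (i, j) \<in> E \<longrightarrow> (transpose (mat 1 - \<Lambda>) ** S) $ j $ i = 0) \<longleftrightarrow>
    parent_gram E j S *v column j \<Lambda> = parent_rhs E j S"
proof -
  have "(transpose (mat 1 - \<Lambda>) ** S) $ j $ i = S $ i $ j - (\<Sum>k\<in>UNIV. S $ i $ k * column j \<Lambda> $ k)" for i
    using S unfolding one_minus_transpose_mult_entry column_def sym_mats_iff
    by (simp add: mult.commute)
  moreover have "(parent_gram E j S *v column j \<Lambda>) $ a
      = (if (a, j) \<in> E then \<Sum>k\<in>UNIV. S $ a $ k * column j \<Lambda> $ k else 0)" for a
    using \<Lambda> by (intro parent_gram_mult) (simp add: column_def edge_supported_def)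
  ultimately show ?thesis
    by (auto simp: vec_eq_iff parent_rhs_def)
qed

text \<open>In this direction Cramer's rule holds without dividing, so singular parent blocks are covered.\<close>

lemma coef_num_eq:
  fixes S :: "'a::field^'m^'m"
  assumes S: "S \<in> sym_mats" and \<Lambda>: "edge_supported E \<Lambda>"
    and uncorrelated: "\<And>i. (i, j) \<in> E \<Longrightarrow> (transpose (mat 1 - \<Lambda>) ** S) $ j $ i = 0"
  shows "coef_num E S k j = \<Lambda> $ k $ j * parent_det E j S"
proof (cases "(k, j) \<in> E")
  case True
  have rhs: "parent_gram E j S *v column j \<Lambda> = parent_rhs E j S"
    using uncorrelated uncorrelated_iff[OF S \<Lambda>] by blast
  have "column j \<Lambda> $ k = \<Lambda> $ k $ j"
    by (simp add: column_def)
  then show ?thesis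
    using True cramer_lemma[of k "parent_gram E j S" "column j \<Lambda>", unfolded rhs]
    by (simp add: coef_num_def parent_det_def)
next
  case False
  then show ?thesis
    using \<Lambda> by (simp add: coef_num_def edge_supported_def)
qed

lemma regression_uncorrelated:
  fixes S :: "'a::field^'m^'m"
  assumes S: "S \<in> sym_mats" and det: "parent_det E j S \<noteq> 0" and "(i, j) \<in> E"
  shows "(transpose (mat 1 - regression E S) ** S) $ j $ i = 0"
proof -
  let ?b = "parent_rhs E j S"
  let ?x = "(\<chi> k. det (\<chi> a b. if b = k then ?b $ a else parent_gram E j S $ a $ b)
    / parent_det E j S)"
  have x: "parent_gram E j S *v ?x = ?b"
    using cramer det unfolding parent_det_def by blast
  have "?x = column j (regression E S)"
  proof (subst vec_eq_iff, intro allI)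
    fix k
    show "?x $ k = column j (regression E S) $ k"
    proof (cases "(k, j) \<in> E")
      case True
      then show ?thesis by (simp add: column_def regression_def coef_num_def)
    next
      case False
      have "(parent_gram E j S *v ?x) $ k = (\<Sum>b\<in>UNIV. if b = k then ?x $ k else 0)"
        unfolding matrix_vector_mult_def vec_lambda_beta[of _ k]
        using False by (intro sum.cong) (auto simp: parent_gram_def)
      then have "?x $ k = 0"
        unfolding x using False by (simp add: parent_rhs_def)
      then show ?thesis
        using False by (simp add: column_def regression_def coef_num_def)
    qed
  qed
  then show ?thesis
    using x uncorrelated_iff[OF S edge_supported_regression, of j] \<open>(i, j) \<in> E\<close> by metis
qed

lemma normal_equations_regression:
  fixes S :: "'a::field^'m^'m"
  assumes "S \<in> sym_mats" "\<And>j. parent_det E j S \<noteq> 0"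
  shows "normal_equations E (regression E S) (resid_var E S) S"
  using regression_uncorrelated[OF assms] by (simp add: normal_equations_def resid_var_def)

text \<open>Where the parent determinants do not vanish, this is \<open>1 - regression E S\<close> with column \<open>j\<close>
multiplied by \<open>parent_det E j S\<close>; together with
\<open>resid_num\<close> it expresses the normal equations by polynomials in \<open>S\<close>.\<close>

definition regression_num :: "('m \<times> 'm) set \<Rightarrow> 'a::field^'m^'m \<Rightarrow> 'a^'m^'m" where
  "regression_num E S = (\<chi> k j. (if k = j then parent_det E j S else 0) - coef_num E S k j)"

definition resid_num :: "('m \<times> 'm) set \<Rightarrow> 'a::field^'m^'m \<Rightarrow> 'a^'m^'m" where
  "resid_num E S = (\<chi> i j. if i = j
     then parent_det E j S * (transpose (regression_num E S) ** S) $ j $ j else 0)"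

text \<open>For \<open>Z = sem_cov \<Lambda> \<Omega>\<close> the two equations together say that the congruence of \<open>Z\<close> by
\<open>regression_num E S\<close> is \<open>resid_num E S\<close>: a polynomial relation between \<open>Z\<close> and \<open>S\<close>.\<close>

lemma regression_num_congruence:
  fixes S :: "'a::field^'m^'m"
  assumes S: "S \<in> sym_mats" and \<Lambda>: "edge_supported E \<Lambda>" and \<Omega>: "diagonal \<Omega>"
    and normal: "normal_equations E \<Lambda> \<Omega> S"
  defines "D \<equiv> \<chi> i j. if i = j then parent_det E j S else 0"
  shows "transpose (regression_num E S) ** Z ** regression_num E S
      = D ** (transpose (mat 1 - \<Lambda>) ** Z ** (mat 1 - \<Lambda>)) ** D"
    and "resid_num E S = D ** \<Omega> ** D"
proof -
  have D: "diagonal D" by (simp add: diagonal_def D_def)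
  have D_entry: "D $ j $ j = parent_det E j S" for j by (simp add: D_def)
  have "coef_num E S k j = \<Lambda> $ k $ j * parent_det E j S" for k j
    using normal by (intro coef_num_eq[OF S \<Lambda>]) (simp add: normal_equations_def)
  then have num: "regression_num E S = (mat 1 - \<Lambda>) ** D"
    by (simp add: vec_eq_iff diagonal_mult_entry[OF D])
       (simp add: regression_num_def D_def mat_1_entry left_diff_distrib)
  show "transpose (regression_num E S) ** Z ** regression_num E S
      = D ** (transpose (mat 1 - \<Lambda>) ** Z ** (mat 1 - \<Lambda>)) ** D"
    by (simp add: num matrix_transpose_mul diagonal_transpose[OF D] matrix_mul_assoc)
  have "(transpose (regression_num E S) ** S) $ j $ j = parent_det E j S * \<Omega> $ j $ j" for j
  proof -
    have "transpose (regression_num E S) ** S = D ** (transpose (mat 1 - \<Lambda>) ** S)"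
      by (simp add: num matrix_transpose_mul diagonal_transpose[OF D] matrix_mul_assoc)
    then show ?thesis
      using normal D_entry by (simp add: diagonal_mult_entry[OF D] normal_equations_def)
  qed
  then show "resid_num E S = D ** \<Omega> ** D"
    using \<Omega> by (simp add: vec_eq_iff diagonal_mult_entry[OF D])
       (auto simp: resid_num_def D_def diagonal_def)
qed

lemma matrix_poly_parent_det: "matrix_poly (parent_det E j)"
proof -
  have "poly_map (parent_gram E j)"
    unfolding poly_map_def parent_gram_def vec_lambda_beta
    by (intro allI matrix_poly_if matrix_poly.const matrix_poly.entry)
  then show ?thesis
    unfolding parent_det_def [abs_def] by (rule matrix_poly_det)
qed

lemma matrix_poly_coef_num: "matrix_poly (\<lambda>S. coef_num E S k j)"
proof (cases "(k, j) \<in> E")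
  case True
  have "poly_map (\<lambda>S. \<chi> a b. if b = k then parent_rhs E j S $ a else parent_gram E j S $ a $ b)"
    unfolding poly_map_def parent_gram_def parent_rhs_def vec_lambda_beta
    by (intro allI matrix_poly_if matrix_poly.const matrix_poly.entry)
  from matrix_poly_det[OF this] show ?thesis
    using True by (simp add: coef_num_def)
qed (simp add: coef_num_def matrix_poly.const)

lemma poly_map_regression_num: "poly_map (regression_num E)"
  unfolding poly_map_def regression_num_def vec_lambda_beta
  by (intro allI matrix_poly_diff matrix_poly_if matrix_poly_coef_num matrix_poly_parent_det
      matrix_poly.const)

lemma poly_map_resid_num: "poly_map (resid_num E)"
  unfolding poly_map_def resid_num_def vec_lambda_beta
  by (intro allI matrix_poly_if matrix_poly.const matrix_poly.mult matrix_poly_parent_det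
      poly_mapD poly_map_mult poly_map_transpose poly_map_regression_num poly_map_id)

section \<open>Uniqueness of the critical point\<close>

context ordered_dag
begin

lemma dag_model_sym: "dag_model E \<subseteq> sym_mats"
  unfolding dag_model_eq[OF ordered_dag_axioms] by (auto intro: sem_cov_sym)

lemma complexify_sem_cov:
  fixes \<Lambda> :: "(real, 'm) square_matrix"
  assumes "edge_supported E \<Lambda>"
  shows "complexify (sem_cov \<Lambda> \<Omega>) = sem_cov (complexify \<Lambda>) (complexify \<Omega>)"
  using det_one_minus[OF assms]
  by (simp add: sem_cov_def complexify_mult complexify_transpose complexify_matrix_inv
      complexify_diff complexify_mat_1)

lemma complexify_cov_velocity:
  fixes \<Lambda> :: "(real, 'm) square_matrix"
  assumes "edge_supported E \<Lambda>"
  shows "complexify (cov_velocity \<Lambda> \<Omega> \<Lambda>' \<Omega>')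
    = cov_velocity (complexify \<Lambda>) (complexify \<Omega>) (complexify \<Lambda>') (complexify \<Omega>')"
  using det_one_minus[OF assms]
  by (simp add: cov_velocity_def complexify_mult complexify_transpose complexify_matrix_inv
      complexify_diff complexify_mat_1 complexify_add complexify_sem_cov[OF assms])

lemma cov_velocity_sym:
  fixes \<Lambda> :: "('a::field, 'm) square_matrix"
  assumes "diagonal \<Omega>" "diagonal \<Omega>'"
  shows "cov_velocity \<Lambda> \<Omega> \<Lambda>' \<Omega>' \<in> sym_mats"
  using assms sem_cov_sym[OF assms(1), of \<Lambda>]
  by (simp add: sym_mats_def cov_velocity_def transpose_add matrix_transpose_mul matrix_mul_assoc
      diagonal_transpose add_ac)

text \<open>The differential of \<open>p\<close> vanishes on velocities of curves in the model, so its gradient at a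
point of the model is orthogonal to the velocities of all real parameters.\<close>

lemma normal_equations_on_model:
  fixes \<Lambda> :: "(real, 'm) square_matrix"
  assumes p: "p \<in> vanishing_ideal (zariski_closure (dag_model E))" and "c \<noteq> 0"
    and \<Lambda>: "edge_supported E \<Lambda>" and \<Omega>: "diagonal \<Omega>" "\<And>j. \<Omega> $ j $ j > 0"
  defines "Z \<equiv> sem_cov (complexify \<Lambda>) (complexify \<Omega>)"
  shows "normal_equations E (complexify \<Lambda>) (complexify \<Omega>) (Z + c *\<^sub>R (Z ** sym_grad p Z ** Z))"
proof -
  have c\<Lambda>: "edge_supported E (complexify \<Lambda>)" and c\<Omega>: "diagonal (complexify \<Omega>)"
    using \<Lambda> \<Omega> by (simp_all add: edge_supported_def diagonal_def complexify_def)
  have p': "p \<in> vanishing_ideal (complexify ` dag_model E)"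
    using p vanishing_ideal_zariski_closure[OF dag_model_sym] by simp
  have velocity: "trace (sym_grad p Z ** cov_velocity (complexify \<Lambda>) (complexify \<Omega>)
      (complexify \<Lambda>') (complexify \<Omega>')) = 0"
    if "edge_supported E \<Lambda>'" "diagonal \<Omega>'" for \<Lambda>' \<Omega>'
  proof -
    let ?v = "cov_velocity \<Lambda> \<Omega> \<Lambda>' \<Omega>'"
    have "frechet_derivative p (at (complexify (sem_cov \<Lambda> \<Omega>))) (complexify ?v) = 0"
      by (rule frechet_derivative_tangent[OF p' cov_velocity_tangent[OF \<Lambda> \<Omega> that]])
    moreover have "complexify ?v \<in> sym_mats"
      by (intro complexify_sym cov_velocity_sym \<Omega> that)
    moreover have "matrix_poly p" using p by (simp add: vanishing_ideal_def)
    ultimately have "trace (sym_grad p Z ** complexify ?v) = 0"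
      by (simp add: sym_grad(2) Z_def complexify_sem_cov[OF \<Lambda>])
    then show ?thesis
      by (simp only: complexify_cov_velocity[OF \<Lambda>])
  qed
  show ?thesis
  proof (rule normal_equationsI[OF c\<Lambda> c\<Omega> _ \<open>c \<noteq> 0\<close> sym_grad_sym, folded Z_def])
    show "complexify \<Omega> $ j $ j \<noteq> 0" for j
      using \<Omega>(2)[of j] by (simp add: complexify_def)
    show "trace (sym_grad p Z ** cov_velocity (complexify \<Lambda>) (complexify \<Omega>) (single i j) 0) = 0"
      if "(i, j) \<in> E" for i j
      using velocity[OF edge_supported_single[OF that] diagonal_0]
      by (simp add: complexify_single complexify_0)
    show "trace (sym_grad p Z ** cov_velocity (complexify \<Lambda>) (complexify \<Omega>) 0 (single j j)) = 0" for j
      using velocity[OF edge_supported_0 diagonal_single]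
      by (simp add: complexify_single complexify_0)
  qed simp
qed

text \<open>The relation \<open>R W = 0\<close> below links a point \<open>W\<close> to the data \<open>T W\<close> for which it is critical with score
\<open>sym_grad p W\<close>. It is polynomial in \<open>W\<close> and holds on the model, hence on the Zariski closure, also at
points outside the image of the parametrisation. At \<open>Z\<close> the data are \<open>S\<close>, and as the parent
blocks of \<open>S\<close> are invertible the relation can be solved for \<open>Z\<close>.\<close>

theorem critical_point_eq_mle:
  fixes Z S :: "(complex, 'm) square_matrix"
  assumes Z: "Z \<in> zariski_closure (dag_model E)" "det Z \<noteq> 0" and S: "S \<in> sym_mats"
    and "n > 0"
    and critical: "score n S Z \<in> sym_orthogonal (zariski_tangent_space (zariski_closure (dag_model E)) Z)"
    and nz: "\<And>j. parent_det E j S \<noteq> 0"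
  shows "Z = mle E S"
proof -
  let ?X = "zariski_closure (dag_model E)"
  obtain p where p: "p \<in> vanishing_ideal ?X" "sym_grad p Z = score n S Z"
    using normal_covector_is_differential[OF critical] .
  define T where "T W = W + (2 / real n) *\<^sub>R (W ** sym_grad p W ** W)" for W
  have "matrix_poly p" using p(1) by (simp add: vanishing_ideal_def)
  then have T_poly: "poly_map T"
    unfolding T_def [abs_def] by (intro poly_map_intros sym_grad(1))
  have TZ: "T Z = S"
    using score_solve[OF Z(2) \<open>n > 0\<close>, of S] by (simp add: T_def p(2))
  \<comment> \<open>By regression_num_congruence, R W vanishes when W and T W satisfy the normal equations.\<close>
  define R where "R W = transpose (regression_num E (T W)) ** W ** regression_num E (T W)
    - resid_num E (T W)" for W
  have R_poly: "poly_map R"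
    unfolding R_def [abs_def]
    by (intro poly_map_intros T_poly poly_map_compose[OF poly_map_regression_num]
        poly_map_compose[OF poly_map_resid_num])
  have R_model: "R (complexify \<Sigma>) = 0" if model: "\<Sigma> \<in> dag_model E" for \<Sigma>
  proof -
    obtain \<Lambda> \<Omega> where \<Sigma>: "\<Sigma> = sem_cov \<Lambda> \<Omega>" and \<Lambda>: "edge_supported E \<Lambda>"
      and \<Omega>: "diagonal \<Omega>" "\<And>j. \<Omega> $ j $ j > 0"
      using model unfolding dag_model_eq[OF ordered_dag_axioms] by blast
    have c\<Lambda>: "edge_supported E (complexify \<Lambda>)" and c\<Omega>: "diagonal (complexify \<Omega>)"
      using \<Lambda> \<Omega> by (simp_all add: edge_supported_def diagonal_def complexify_def)
    let ?W = "sem_cov (complexify \<Lambda>) (complexify \<Omega>)"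
    have W: "complexify \<Sigma> = ?W"
      by (simp add: \<Sigma> complexify_sem_cov[OF \<Lambda>])
    have W_sym: "?W \<in> sym_mats"
      by (rule sem_cov_sym[OF c\<Omega>])
    have "?W ** sym_grad p ?W ** ?W \<in> sym_mats"
      using sym_mats_congruence(1)[OF sym_grad_sym, of ?W] W_sym by (simp add: transpose_sym_mats)
    then have T_sym: "T ?W \<in> sym_mats"
      using W_sym by (simp add: T_def sym_mats_iff)
    have normal: "normal_equations E (complexify \<Lambda>) (complexify \<Omega>) (T ?W)"
      unfolding T_def using \<open>n > 0\<close>
      by (intro normal_equations_on_model[OF p(1) _ \<Lambda> \<Omega>]) simp
    have "transpose (mat 1 - complexify \<Lambda>) ** ?W ** (mat 1 - complexify \<Lambda>) = complexify \<Omega>"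
      using sem_cov_unique[OF c\<Lambda>] by blast
    then show ?thesis
      unfolding W R_def regression_num_congruence[OF T_sym c\<Lambda> c\<Omega> normal] by simp
  qed
  have "(\<lambda>W. R W $ i $ j) \<in> vanishing_ideal (complexify ` dag_model E)" for i j
    using R_poly R_model by (auto simp: vanishing_ideal_def poly_map_def)
  moreover have "\<forall>q \<in> vanishing_ideal (complexify ` dag_model E). q Z = 0"
    using Z(1) by (simp add: zariski_closure_def)
  ultimately have "R Z $ i $ j = 0" for i j
    by fast
  then have "R Z = 0" by (simp add: vec_eq_iff)
  let ?\<Lambda> = "regression E S"
  define D :: "(complex, 'm) square_matrix" where "D = (\<chi> i j. if i = j then parent_det E j S else 0)"
  have normal: "normal_equations E ?\<Lambda> (resid_var E S) S"
    by (rule normal_equations_regression[OF S nz])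
  note num = regression_num_congruence[OF S edge_supported_regression diagonal_resid_var normal, folded D_def]
  have "det D = (\<Prod>j\<in>UNIV. parent_det E j S)"
    by (subst det_diagonal) (simp_all add: D_def)
  then have "det D \<noteq> 0" using nz by simp
  have "D ** (transpose (mat 1 - ?\<Lambda>) ** Z ** (mat 1 - ?\<Lambda>)) ** D = D ** resid_var E S ** D"
    using \<open>R Z = 0\<close> num by (simp add: R_def TZ)
  then have "transpose (mat 1 - ?\<Lambda>) ** Z ** (mat 1 - ?\<Lambda>) = resid_var E S"
    using \<open>det D \<noteq> 0\<close> by (simp add: matrix_mult_right_cancel matrix_mult_left_cancel)
  then show ?thesis
    unfolding mle_def using sem_cov_unique[OF edge_supported_regression] by blast
qed

end

section \<open>Smoothness of the model at points with invertible parent blocks\<close>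

text \<open>The partial covariance of \<open>i\<close> and \<open>j\<close> given the parents of \<open>j\<close>, multiplied by the determinant of the
parent block.\<close>

definition ci_poly :: "('m \<times> 'm) set \<Rightarrow> 'm \<Rightarrow> 'm \<Rightarrow> 'a::field^'m^'m \<Rightarrow> 'a" where
  "ci_poly E i j Z = parent_det E j Z * Z $ i $ j - (\<Sum>k\<in>UNIV. Z $ i $ k * coef_num E Z k j)"

lemma matrix_poly_ci_poly: "matrix_poly (ci_poly E i j)"
  unfolding ci_poly_def [abs_def]
  by (intro matrix_poly_diff matrix_poly.mult matrix_poly_sum matrix_poly_parent_det
      matrix_poly_coef_num matrix_poly.entry)

lemma ci_poly_eq:
  fixes Z :: "'a::field^'m^'m"
  assumes "\<And>k. coef_num E Z k j = \<Lambda> $ k $ j * parent_det E j Z"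
  shows "ci_poly E i j Z = parent_det E j Z * (Z ** (mat 1 - \<Lambda>)) $ i $ j"
  unfolding mult_one_minus_entry ci_poly_def assms
  by (simp add: right_diff_distrib sum_distrib_left mult_ac)

lemma ci_poly_regression:
  fixes Z :: "'a::field^'m^'m"
  assumes "parent_det E j Z \<noteq> 0"
  shows "ci_poly E i j Z = parent_det E j Z * (Z ** (mat 1 - regression E Z)) $ i $ j"
  using assms by (intro ci_poly_eq) (simp add: regression_def)

lemma mult_one_minus_transpose:
  fixes Z :: "'a::field^'m^'m"
  assumes "Z \<in> sym_mats"
  shows "(Z ** (mat 1 - \<Lambda>)) $ i $ j = (transpose (mat 1 - \<Lambda>) ** Z) $ j $ i"
  using assms unfolding mult_one_minus_entry one_minus_transpose_mult_entry sym_mats_iff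
  by (simp add: mult.commute)

lemma frechet_derivative_line:
  fixes p :: "complex^'m^'m \<Rightarrow> complex"
  assumes "matrix_poly p" "\<And>t. p (Z + t *\<^sub>R H) = p Z + t *\<^sub>R d"
  shows "frechet_derivative p (at Z) H = d"
proof -
  have "((\<lambda>t. Z + t *\<^sub>R H) has_derivative (\<lambda>t. t *\<^sub>R H)) (at 0)"
    by (auto intro!: derivative_eq_intros)
  moreover have "(p has_derivative frechet_derivative p (at Z)) (at (Z + 0 *\<^sub>R H))"
    using matrix_poly_frechet_derivative[OF assms(1), of Z] by simp
  ultimately have "((\<lambda>t. p (Z + t *\<^sub>R H)) has_derivative (\<lambda>t. frechet_derivative p (at Z) (t *\<^sub>R H))) (at 0)"
    by (rule has_derivative_compose)
  moreover have "((\<lambda>t. p Z + t *\<^sub>R d) has_derivative (\<lambda>t. t *\<^sub>R d)) (at 0)"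
    by (auto intro!: derivative_eq_intros)
  ultimately have "(\<lambda>t. frechet_derivative p (at Z) (t *\<^sub>R H)) = (\<lambda>t. t *\<^sub>R d)"
    unfolding assms(2) by (rule has_derivative_unique)
  from fun_cong[OF this, of 1] show ?thesis by simp
qed

context ordered_dag
begin

text \<open>The inverse of \<open>1 - \<Lambda>\<close> is polynomial in \<open>\<Lambda>\<close> because the determinant is one. A polynomial
which vanishes on the model thus pulls back to a polynomial in the parameters that vanishes
at all positive real ones, hence everywhere. Both parameters are packed into one matrix, \<open>\<Omega>\<close> on
the diagonal and \<open>\<Lambda>\<close> off it.\<close>

lemma sem_cov_in_zariski_closure:
  fixes \<Lambda> \<Omega> :: "(complex, 'm) square_matrix"
  assumes \<Lambda>: "edge_supported E \<Lambda>" and \<Omega>: "diagonal \<Omega>"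
  shows "sem_cov \<Lambda> \<Omega> \<in> zariski_closure (dag_model E)"
proof -
  have "p (sem_cov \<Lambda> \<Omega>) = 0" if p: "p \<in> vanishing_ideal (complexify ` dag_model E)" for p
  proof -
    define L where "L M = (\<chi> i j. if (i, j) \<in> E then M $ i $ j else 0)"
      for M :: "(complex, 'm) square_matrix"
    define W where "W M = (\<chi> i j. if i = j then M $ i $ j else 0)"
      for M :: "(complex, 'm) square_matrix"
    have L: "edge_supported E (L M)" and W: "diagonal (W M)" for M
      by (simp_all add: L_def W_def edge_supported_def diagonal_def)
    have poly: "poly_map L" "poly_map W"
      unfolding poly_map_def L_def W_def vec_lambda_beta
      by (intro allI matrix_poly_if matrix_poly.const matrix_poly.entry)+
    have inv: "matrix_inv (mat 1 - L M) $ k $ l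
        = det (\<chi> i j. if j = k then mat 1 $ i $ l else (mat 1 - L M) $ i $ j)" for M k l
      using matrix_inv_entry[of "mat 1 - L M"] det_one_minus[OF L] by simp
    have "poly_map (\<lambda>M. \<chi> i j. if j = k then mat 1 $ i $ l else (mat 1 - L M) $ i $ j)" for k l
      unfolding poly_map_def vec_lambda_beta
      by (intro allI matrix_poly_if matrix_poly.const poly_mapD poly_map_intros poly)
    then have "poly_map (\<lambda>M. matrix_inv (mat 1 - L M))"
      using matrix_poly_det unfolding poly_map_def[of "\<lambda>M. matrix_inv (mat 1 - L M)"] inv by blast
    then have "poly_map (\<lambda>M. sem_cov (L M) (W M))"
      unfolding sem_cov_def by (intro poly_map_intros poly)
    moreover have "matrix_poly p"
      using p by (simp add: vanishing_ideal_def)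
    ultimately have q: "matrix_poly (\<lambda>M. p (sem_cov (L M) (W M)))"
      by (rule matrix_poly_compose[rotated])
    have "p (sem_cov (L (complexify M)) (W (complexify M))) = 0" if pos: "\<And>i j. M $ i $ j > 0" for M
    proof -
      define \<Lambda>\<^sub>r :: "(real, 'm) square_matrix" where "\<Lambda>\<^sub>r = (\<chi> i j. if (i, j) \<in> E then M $ i $ j else 0)"
      define \<Omega>\<^sub>r :: "(real, 'm) square_matrix" where "\<Omega>\<^sub>r = (\<chi> i j. if i = j then M $ i $ j else 0)"
      have \<Lambda>\<^sub>r: "edge_supported E \<Lambda>\<^sub>r" by (simp add: edge_supported_def \<Lambda>\<^sub>r_def)
      have \<Omega>\<^sub>r: "diagonal \<Omega>\<^sub>r" "\<forall>i. \<Omega>\<^sub>r $ i $ i > 0"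
        using pos by (simp_all add: diagonal_def \<Omega>\<^sub>r_def)
      have "sem_cov \<Lambda>\<^sub>r \<Omega>\<^sub>r \<in> dag_model E"
        unfolding dag_model_eq[OF ordered_dag_axioms]
        using \<Lambda>\<^sub>r \<Omega>\<^sub>r by blast
      then have "p (complexify (sem_cov \<Lambda>\<^sub>r \<Omega>\<^sub>r)) = 0"
        using p by (auto simp: vanishing_ideal_def)
      moreover have "complexify \<Lambda>\<^sub>r = L (complexify M)" "complexify \<Omega>\<^sub>r = W (complexify M)"
        by (simp_all add: vec_eq_iff complexify_def \<Lambda>\<^sub>r_def \<Omega>\<^sub>r_def L_def W_def)
      ultimately show ?thesis
        by (simp add: complexify_sem_cov[OF \<Lambda>\<^sub>r])
    qed
    then have zero: "p (sem_cov (L M) (W M)) = 0" for M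
      by (rule matrix_poly_zero_if_zero_on_positive[OF q])
    have "i \<noteq> j" if "(i, j) \<in> E" for i j
      using edge_less[OF that] by simp
    then have "L (\<Lambda> + \<Omega>) = \<Lambda>"
      using \<Lambda> \<Omega> by (simp add: vec_eq_iff L_def edge_supported_def diagonal_def)
    moreover have "W (\<Lambda> + \<Omega>) = \<Omega>"
      using \<Omega> edge_supported_zero[OF \<Lambda> order_refl] by (simp add: vec_eq_iff W_def diagonal_def)
    ultimately have "L (\<Lambda> + \<Omega>) = \<Lambda>" "W (\<Lambda> + \<Omega>) = \<Omega>" .
    then show ?thesis using zero[of "\<Lambda> + \<Omega>"] by simp
  qed
  then show ?thesis
    by (simp add: zariski_closure_def sem_cov_sym[OF \<Omega>])
qed

lemma coef_num_sem_cov: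
  fixes \<Lambda> :: "('a::field, 'm) square_matrix"
  assumes "edge_supported E \<Lambda>" "diagonal \<Omega>"
  shows "coef_num E (sem_cov \<Lambda> \<Omega>) k j = \<Lambda> $ k $ j * parent_det E j (sem_cov \<Lambda> \<Omega>)"
  by (rule coef_num_eq[OF sem_cov_sym[OF assms(2)] assms(1)])
     (simp add: transpose_mult_sem_cov_entry[OF assms] edge_less)

lemma regression_sem_cov:
  fixes \<Lambda> :: "('a::field, 'm) square_matrix"
  assumes "edge_supported E \<Lambda>" "diagonal \<Omega>" "\<And>j. parent_det E j (sem_cov \<Lambda> \<Omega>) \<noteq> 0"
  shows "regression E (sem_cov \<Lambda> \<Omega>) = \<Lambda>"
  using assms(3) by (simp add: vec_eq_iff regression_def coef_num_sem_cov[OF assms(1,2)])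

lemma ci_poly_vanishing:
  assumes "i < j"
  shows "ci_poly E i j \<in> vanishing_ideal (zariski_closure (dag_model E))"
proof -
  have "ci_poly E i j (complexify \<Sigma>) = 0" if model: "\<Sigma> \<in> dag_model E" for \<Sigma>
  proof -
    obtain \<Lambda> \<Omega> where \<Sigma>: "\<Sigma> = sem_cov \<Lambda> \<Omega>" and \<Lambda>: "edge_supported E \<Lambda>" and \<Omega>: "diagonal \<Omega>"
      using model unfolding dag_model_eq[OF ordered_dag_axioms] by blast
    have c\<Lambda>: "edge_supported E (complexify \<Lambda>)" and c\<Omega>: "diagonal (complexify \<Omega>)"
      using \<Lambda> \<Omega> by (simp_all add: edge_supported_def diagonal_def complexify_def)
    show ?thesis
      unfolding \<Sigma> complexify_sem_cov[OF \<Lambda>] ci_poly_eq[OF coef_num_sem_cov[OF c\<Lambda> c\<Omega>]]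
        mult_one_minus_transpose[OF sem_cov_sym[OF c\<Omega>]]
      using transpose_mult_sem_cov_entry(1)[OF c\<Lambda> c\<Omega> assms] by simp
  qed
  then show ?thesis
    unfolding vanishing_ideal_zariski_closure[OF dag_model_sym]
    by (auto simp: vanishing_ideal_def matrix_poly_ci_poly)
qed

text \<open>The polynomial for \<open>(k, l)\<close> involves only entries with indices up to \<open>l\<close>, and of row or column
\<open>l\<close> only the entry \<open>(k, l)\<close> and those at edges into \<open>l\<close>. So along the non-edge \<open>(i, j)\<close> with \<open>l \<le> j\<close> it
is constant, unless it is the polynomial for \<open>(i, j)\<close> itself.\<close>

lemma frechet_derivative_ci_poly:
  fixes Z :: "(complex, 'm) square_matrix"
  assumes "i < j" "(i, j) \<notin> E" "k < l" "l \<le> j"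
  shows "frechet_derivative (ci_poly E k l) (at Z) (sym_unit i j)
    = (if k = i \<and> l = j then parent_det E j Z else 0)"
proof (rule frechet_derivative_line[OF matrix_poly_ci_poly])
  fix t :: real
  let ?W = "Z + t *\<^sub>R sym_unit i j"
  have low: "?W $ a $ b = Z $ a $ b" if "a < j" "b < j" for a b
    using that by (auto simp: sym_unit_def)
  have parent: "a < l" if "(a, l) \<in> E" for a
    using edge_less that .
  have "?W $ a $ b = Z $ a $ b" if "(a, l) \<in> E" "(b, l) \<in> E" for a b
    by (intro low less_le_trans[OF parent assms(4)] that)
  then have gram: "parent_gram E l ?W = parent_gram E l Z"
    unfolding vec_eq_iff parent_gram_def vec_lambda_beta by auto
  have "?W $ a $ l = Z $ a $ l" if "(a, l) \<in> E" for a
    using parent[OF that] assms that by (auto simp: sym_unit_def)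
  then have rhs: "parent_rhs E l ?W = parent_rhs E l Z"
    unfolding vec_eq_iff parent_rhs_def vec_lambda_beta by (simp del: vector_add_component)
  have num: "coef_num E ?W a l = coef_num E Z a l" for a
    unfolding coef_num_def gram rhs ..
  have det: "parent_det E l ?W = parent_det E l Z"
    by (simp add: parent_det_def gram)
  have "?W $ k $ a * coef_num E Z a l = Z $ k $ a * coef_num E Z a l" for a
  proof (cases "(a, l) \<in> E")
    case True
    then have "?W $ k $ a = Z $ k $ a"
      using parent[OF True] assms by (intro low) auto
    then show ?thesis by simp
  qed (simp add: coef_num_def)
  then have sum: "(\<Sum>a\<in>UNIV. ?W $ k $ a * coef_num E Z a l) = (\<Sum>a\<in>UNIV. Z $ k $ a * coef_num E Z a l)"
    by (rule sum.cong[OF refl])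
  have entry: "?W $ k $ l = Z $ k $ l + t *\<^sub>R (if k = i \<and> l = j then 1 else 0)"
    using assms by (auto simp: sym_unit_def)
  show "ci_poly E k l ?W
      = ci_poly E k l Z + t *\<^sub>R (if k = i \<and> l = j then parent_det E j Z else 0)"
    unfolding ci_poly_def num det sum entry
    by (cases "k = i \<and> l = j") (auto simp: distrib_left)
qed

lemma matrix_poly_antisym: "matrix_poly (\<lambda>W. W $ i $ j - W $ j $ i)"
  by (intro matrix_poly_diff matrix_poly.entry)

text \<open>Near \<open>Z\<close> the parent blocks stay invertible. There the equations of symmetry and of vanishing
partial covariances for the non-edges make \<open>B\<^sup>T W\<close> triangular, with \<open>\<Lambda>\<close> the regression of \<open>W\<close>, so that
\<open>W\<close> is parametrised. Their differentials are independent by \<open>frechet_derivative_ci_poly\<close>, taking the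
non-edges in the order of decreasing second vertex.\<close>

lemma nonsingular_point_sem_cov:
  fixes \<Lambda> :: "(complex, 'm) square_matrix"
  assumes \<Lambda>: "edge_supported E \<Lambda>" and \<Omega>: "diagonal \<Omega>"
  defines "Z \<equiv> sem_cov \<Lambda> \<Omega>"
  assumes det: "\<And>j. parent_det E j Z \<noteq> 0"
  shows "nonsingular_point (zariski_closure (dag_model E)) Z"
proof -
  let ?X = "zariski_closure (dag_model E)"
  define antisym where "antisym = (\<lambda>(i, j) (W :: (complex, 'm) square_matrix). W $ i $ j - W $ j $ i)"
  define I where "I = {(i :: 'm, j). i < j}"
  define F where "F = antisym ` I \<union> (\<lambda>(i, j). ci_poly E i j) ` (I - E)"
  define U where "U = {W :: (complex, 'm) square_matrix. \<forall>j. parent_det E j W \<noteq> 0}"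
  have anti_poly: "matrix_poly (antisym x)" for x
    by (cases x) (simp add: antisym_def matrix_poly_antisym)
  have F_cases: "f \<in> antisym ` I \<or> (\<exists>i j. f = ci_poly E i j \<and> i < j \<and> (i, j) \<notin> E)" if "f \<in> F" for f
    using that by (auto simp: F_def I_def)
  have "finite F"
    by (simp add: F_def)
  moreover have "F \<subseteq> vanishing_ideal ?X"
  proof -
    have "antisym x \<in> vanishing_ideal ?X" for x
      using anti_poly[of x]
      by (cases x) (auto simp: vanishing_ideal_def zariski_closure_def antisym_def sym_mats_iff)
    then show ?thesis
      using ci_poly_vanishing by (auto simp: F_def I_def)
  qed
  moreover have "open U"
  proof -
    have "continuous_on UNIV (parent_det E j :: (complex, 'm) square_matrix \<Rightarrow> complex)" for j
      using matrix_poly_frechet_derivative[OF matrix_poly_parent_det] has_derivative_continuous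
      by (blast intro: continuous_at_imp_continuous_on)
    then have "open {W :: (complex, 'm) square_matrix. parent_det E j W \<noteq> 0}" for j
      by (intro open_Collect_neq continuous_on_const)
    then have "open (\<Inter>j. {W :: (complex, 'm) square_matrix. parent_det E j W \<noteq> 0})"
      by (intro open_INT) auto
    also have "(\<Inter>j. {W :: (complex, 'm) square_matrix. parent_det E j W \<noteq> 0}) = U"
      by (auto simp: U_def)
    finally show ?thesis .
  qed
  moreover have "Z \<in> U"
    using det by (simp add: U_def)
  moreover have "{W \<in> U. \<forall>f\<in>F. f W = 0} \<subseteq> ?X"
  proof
    fix W assume "W \<in> {W \<in> U. \<forall>f\<in>F. f W = 0}"
    then have nz: "\<And>j. parent_det E j W \<noteq> 0" and zero: "\<And>f. f \<in> F \<Longrightarrow> f W = 0"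
      by (auto simp: U_def)
    have upper: "W $ i $ j = W $ j $ i" if "i < j" for i j
    proof -
      have "antisym (i, j) \<in> F"
        using that by (simp add: F_def I_def)
      from zero[OF this] show ?thesis by (simp add: antisym_def)
    qed
    have "W $ i $ j = W $ j $ i" for i j
      using upper[of i j] upper[of j i] by (cases i j rule: linorder_cases) auto
    then have W: "W \<in> sym_mats"
      by (simp add: sym_mats_iff)
    have "(transpose (mat 1 - regression E W) ** W) $ j $ i = 0" if "i < j" for i j
    proof (cases "(i, j) \<in> E")
      case True
      then show ?thesis by (rule regression_uncorrelated[OF W nz])
    next
      case False
      then have "ci_poly E i j W = 0"
        using zero that by (force simp: F_def I_def)
      then show ?thesis
        using nz[of j] by (simp add: ci_poly_regression mult_one_minus_transpose[OF W])
    qed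
    then have "W = sem_cov (regression E W)
        (\<chi> i j. if i = j then (transpose (mat 1 - regression E W) ** W) $ i $ i else 0)"
      by (rule sem_cov_of_triangular[OF edge_supported_regression W])
    then show "W \<in> ?X"
      by (rule ssubst[where P = "\<lambda>Y. Y \<in> ?X"])
         (rule sem_cov_in_zariski_closure[OF edge_supported_regression], simp add: diagonal_def)
  qed
  moreover have "\<forall>f\<in>F. c f = 0"
    if indep: "\<forall>T. (\<Sum>f\<in>F. c f * frechet_derivative f (at Z) T) = 0" for c
  proof -
    \<comment> \<open>Each coefficient is isolated by a direction along which the terms of all other equations vanish.\<close>
    have only: "c f = 0" if "f \<in> F" "frechet_derivative f (at Z) T \<noteq> 0"
      and others: "\<And>f'. f' \<in> F \<Longrightarrow> f' \<noteq> f \<Longrightarrow> c f' * frechet_derivative f' (at Z) T = 0" for f T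
    proof -
      have "(\<Sum>f'\<in>F. c f' * frechet_derivative f' (at Z) T)
          = (\<Sum>f'\<in>F. if f' = f then c f * frechet_derivative f (at Z) T else 0)"
        using others by (intro sum.cong) auto
      then have "c f * frechet_derivative f (at Z) T = 0"
        using indep \<open>finite F\<close> \<open>f \<in> F\<close> by simp
      then show ?thesis using that(2) by simp
    qed
    have anti_deriv: "frechet_derivative (antisym (k, l)) (at Z) T = T $ k $ l - T $ l $ k" for k l T
      by (rule frechet_derivative_line[OF anti_poly])
         (simp add: antisym_def scaleR_conv_of_real[where 'a = complex] algebra_simps)
    have ci: "c (ci_poly E i j) = 0" if "i < j" "(i, j) \<notin> E" for i j
      using that
    proof (induction "card {l. j < l}" arbitrary: i j rule: less_induct)
      case less
      have later: "c (ci_poly E k l) = 0" if "j < l" "k < l" "(k, l) \<notin> E" for k l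
      proof (rule less.hyps)
        show "card {i. l < i} < card {i. j < i}"
          using that by (intro psubset_card_mono) auto
      qed (use that in auto)
      show ?case
      proof (rule only[of _ "sym_unit i j"])
        show "ci_poly E i j \<in> F"
          using less.prems by (force simp: F_def I_def)
        show "frechet_derivative (ci_poly E i j) (at Z) (sym_unit i j) \<noteq> 0"
          using det less.prems by (simp add: frechet_derivative_ci_poly)
        fix f assume f: "f \<in> F" "f \<noteq> ci_poly E i j"
        show "c f * frechet_derivative f (at Z) (sym_unit i j) = 0"
        proof (cases "f \<in> antisym ` I")
          case True
          then obtain k l where "f = antisym (k, l)" by auto
          then show ?thesis
            using sym_unit_sym[of i j, where 'a = complex] by (simp add: anti_deriv sym_mats_iff)
        next
          case False
          then obtain k l where kl: "f = ci_poly E k l" "k < l" "(k, l) \<notin> E"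
            using f(1) by (auto simp: F_def I_def)
          show ?thesis
          proof (cases "l \<le> j")
            case True
            have "\<not> (k = i \<and> l = j)" using f(2) kl(1) by blast
            then have "frechet_derivative f (at Z) (sym_unit i j) = 0"
              unfolding kl(1) frechet_derivative_ci_poly[OF less.prems kl(2) True] by (rule if_not_P)
            then show ?thesis by simp
          next
            case False
            then show ?thesis using later kl by simp
          qed
        qed
      qed
    qed
    have anti: "c (antisym (i, j)) = 0" if "i < j" for i j
    proof (rule only[of _ "single i j"])
      show "antisym (i, j) \<in> F"
        using that by (simp add: F_def I_def)
      show "frechet_derivative (antisym (i, j)) (at Z) (single i j) \<noteq> 0"
        using that by (simp add: anti_deriv single_def)
      fix f assume f: "f \<in> F" "f \<noteq> antisym (i, j)"
      show "c f * frechet_derivative f (at Z) (single i j) = 0"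
      proof (cases "f \<in> antisym ` I")
        case True
        then obtain x where x: "f = antisym x" "x \<in> I" by (rule imageE)
        obtain k l where "x = (k, l)" by (cases x)
        then have kl: "f = antisym (k, l)" "k < l" using x by (simp_all add: I_def)
        then have "\<not> (k = i \<and> l = j)" using f(2) by blast
        moreover have "\<not> (l = i \<and> k = j)" using kl(2) that by auto
        ultimately have "(single i j :: (complex, 'm) square_matrix) $ k $ l = 0"
          "(single i j :: (complex, 'm) square_matrix) $ l $ k = 0"
          unfolding single_def vec_lambda_beta by (simp_all only: if_False)
        then show ?thesis
          unfolding kl(1) anti_deriv by simp
      next
        case False
        with F_cases[OF f(1)] obtain k l where kl: "f = ci_poly E k l" "k < l" "(k, l) \<notin> E"
          by blast
        show ?thesis unfolding kl(1) ci[OF kl(2,3)] by simp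
      qed
    qed
    show ?thesis
    proof
      fix f assume "f \<in> F"
      from F_cases[OF this] show "c f = 0"
      proof
        assume "f \<in> antisym ` I"
        then obtain x where x: "f = antisym x" "x \<in> I" by (rule imageE)
        obtain k l where "x = (k, l)" by (cases x)
        then show ?thesis using x anti by (simp add: I_def)
      next
        assume "\<exists>i j. f = ci_poly E i j \<and> i < j \<and> (i, j) \<notin> E"
        then obtain k l where kl: "f = ci_poly E k l" "k < l" "(k, l) \<notin> E" by blast
        show ?thesis unfolding kl(1) by (rule ci[OF kl(2,3)])
      qed
    qed
  qed
  ultimately show ?thesis
    unfolding nonsingular_point_def
    using sem_cov_in_zariski_closure[OF \<Lambda> \<Omega>, folded Z_def] by blast
qed

text \<open>Along a tangent vector \<open>T\<close> the regression coefficients have a derivative \<open>\<Lambda>'\<close>, and the partial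
covariances of any vertex with its predecessors are stationary, because the polynomials
\<open>ci_poly E i j\<close> with \<open>i < j\<close> belong to the ideal. Hence \<open>B\<^sup>T T B\<close> differs from
\<open>B\<^sup>T Z \<Lambda>' + \<Lambda>'\<^sup>T Z B\<close> by a diagonal matrix.\<close>

lemma zariski_tangent_is_velocity:
  fixes \<Lambda> :: "(complex, 'm) square_matrix"
  assumes \<Lambda>: "edge_supported E \<Lambda>" and \<Omega>: "diagonal \<Omega>"
  defines "Z \<equiv> sem_cov \<Lambda> \<Omega>"
  assumes det: "\<And>j. parent_det E j Z \<noteq> 0"
    and T: "T \<in> zariski_tangent_space (zariski_closure (dag_model E)) Z"
  obtains \<Lambda>' \<Omega>' where "edge_supported E \<Lambda>'" "diagonal \<Omega>'" "T = cov_velocity \<Lambda> \<Omega> \<Lambda>' \<Omega>'"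
proof -
  let ?A = "matrix_inv (mat 1 - \<Lambda>)" and ?B = "mat 1 - \<Lambda>"
  define r where "r k j = frechet_derivative (\<lambda>W. regression E W $ k $ j) (at Z)" for k j
  define \<Lambda>' where "\<Lambda>' = (\<chi> k j. r k j T)"
  have T_sym: "T \<in> sym_mats"
    using T by (simp add: zariski_tangent_space_def)
  have Z_sym: "Z \<in> sym_mats"
    unfolding Z_def by (rule sem_cov_sym[OF \<Omega>])
  have reg: "regression E Z = \<Lambda>"
    unfolding Z_def by (rule regression_sem_cov[OF \<Lambda> \<Omega>]) (use det in \<open>simp add: Z_def\<close>)
  have r: "((\<lambda>W. regression E W $ k $ j) has_derivative r k j) (at Z)" for k j
  proof -
    have "(\<lambda>W. regression E W $ k $ j) differentiable (at Z)"
      unfolding regression_def vec_lambda_beta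
      by (intro differentiable_divide matrix_poly_differentiable matrix_poly_coef_num
          matrix_poly_parent_det det)
    then show ?thesis
      by (simp add: r_def frechet_derivative_works)
  qed
  have \<Lambda>': "edge_supported E \<Lambda>'"
  proof -
    have "r k j T = 0" if "(k, j) \<notin> E" for k j
    proof -
      have "(\<lambda>W. regression E W $ k $ j) = (\<lambda>W. 0 :: complex)"
        using that by (simp add: regression_def coef_num_def)
      then show ?thesis by (simp add: r_def)
    qed
    then show ?thesis by (simp add: edge_supported_def \<Lambda>'_def)
  qed
  have upper: "(T ** ?B - Z ** \<Lambda>') $ i $ j = 0" if "i < j" for i j
  proof -
    let ?\<phi> = "\<lambda>W. (W ** (mat 1 - regression E W)) $ i $ j"
    have der: "(?\<phi> has_derivative (\<lambda>H. H $ i $ j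
        - (\<Sum>k\<in>UNIV. Z $ i $ k * r k j H + H $ i $ k * regression E Z $ k $ j))) (at Z)"
      unfolding mult_one_minus_entry
      by (intro has_derivative_diff has_derivative_sum has_derivative_mult has_derivative_entry r)
    have zero: "(Z ** ?B) $ i $ j = 0"
      unfolding mult_one_minus_transpose[OF Z_sym] unfolding Z_def
      by (rule transpose_mult_sem_cov_entry(1)[OF \<Lambda> \<Omega> that])
    obtain d where d: "(parent_det E j has_derivative d) (at Z)"
      using matrix_poly_frechet_derivative[OF matrix_poly_parent_det] by blast
    have "((\<lambda>W. parent_det E j W * ?\<phi> W) has_derivative frechet_derivative (ci_poly E i j) (at Z)) (at Z)"
    proof (rule has_derivative_transform_eventually)
      show "(ci_poly E i j has_derivative frechet_derivative (ci_poly E i j) (at Z)) (at Z)"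
        by (rule matrix_poly_frechet_derivative[OF matrix_poly_ci_poly])
      have "(parent_det E j \<longlongrightarrow> parent_det E j Z) (at Z)"
        using has_derivative_continuous[OF d] by (simp add: continuous_within)
      then have "eventually (\<lambda>W. parent_det E j W \<noteq> 0) (at Z)"
        using det by (rule tendsto_imp_eventually_ne)
      then show "eventually (\<lambda>W. ci_poly E i j W = parent_det E j W * ?\<phi> W) (at Z)"
        by (rule eventually_mono) (rule ci_poly_regression)
      show "ci_poly E i j Z = parent_det E j Z * ?\<phi> Z"
        by (rule ci_poly_regression[OF det])
    qed simp
    from fun_cong[OF has_derivative_unique[OF this has_derivative_mult[OF d der]], of T]
    have "frechet_derivative (ci_poly E i j) (at Z) T = parent_det E j Z * (T $ i $ j
        - (\<Sum>k\<in>UNIV. Z $ i $ k * r k j T + T $ i $ k * \<Lambda> $ k $ j))"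
      by (simp only: zero reg mult_zero_right add_0_right)
    moreover have "frechet_derivative (ci_poly E i j) (at Z) T = 0"
      using T ci_poly_vanishing[OF that] by (simp add: zariski_tangent_space_def)
    ultimately have "T $ i $ j - (\<Sum>k\<in>UNIV. Z $ i $ k * r k j T + T $ i $ k * \<Lambda> $ k $ j) = 0"
      using det[of j] by simp
    then show ?thesis
      unfolding vector_minus_component mult_one_minus_entry matrix_mult_entry[of Z]
      by (simp add: \<Lambda>'_def sum.distrib algebra_simps)
  qed
  define \<Omega>' where "\<Omega>' = transpose ?B ** T ** ?B - transpose ?B ** Z ** \<Lambda>' - transpose \<Lambda>' ** Z ** ?B"
  have \<Omega>'_sym: "\<Omega>' \<in> sym_mats"
    using T_sym Z_sym
    by (simp add: \<Omega>'_def sym_mats_def transpose_diff transpose_add matrix_transpose_mul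
        matrix_mul_assoc algebra_simps)
  have "\<Omega>' $ a $ j = 0" if "a < j" for a j
  proof -
    have "(transpose ?B ** (T ** ?B - Z ** \<Lambda>')) $ a $ j = 0"
      unfolding matrix_mult_entry[of "transpose ?B"]
    proof (intro sum.neutral ballI)
      fix i
      show "transpose ?B $ a $ i * (T ** ?B - Z ** \<Lambda>') $ i $ j = 0"
      proof (cases "i \<le> a")
        case True
        then have "(T ** ?B - Z ** \<Lambda>') $ i $ j = 0"
          using that by (intro upper) simp
        then show ?thesis by simp
      next
        case False
        then show ?thesis
          using edge_supported_zero[OF \<Lambda>, of a i] by (auto simp: mat_1_entry)
      qed
    qed
    moreover have "(transpose \<Lambda>' ** (Z ** ?B)) $ a $ j = 0"
      unfolding matrix_mult_entry[of "transpose \<Lambda>'"]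
    proof (intro sum.neutral ballI)
      fix k
      have "(Z ** ?B) $ k $ j = ?A $ j $ k * \<Omega> $ j $ j"
        unfolding Z_def sem_cov_mult[OF \<Lambda>] by (simp add: diagonal_mult_entry[OF \<Omega>])
      then show "transpose \<Lambda>' $ a $ k * (Z ** ?B) $ k $ j = 0"
        using edge_supported_zero[OF \<Lambda>', of a k] inverse_unitriangular(1)[OF \<Lambda>, of k j] that
        by (cases "a \<le> k") auto
    qed
    moreover have "\<Omega>' = transpose ?B ** (T ** ?B - Z ** \<Lambda>') - transpose \<Lambda>' ** (Z ** ?B)"
      by (simp add: \<Omega>'_def matrix_mult_diff matrix_mul_assoc)
    ultimately show ?thesis by simp
  qed
  then have "\<Omega>' $ a $ j = 0" if "a \<noteq> j" for a j
    using \<Omega>'_sym that unfolding sym_mats_iff by (metis linorder_neqE)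
  then have \<Omega>': "diagonal \<Omega>'"
    by (simp add: diagonal_def)
  note inv = inverse_one_minus[OF \<Lambda>]
  have "transpose ?A ** \<Omega>' ** ?A = (transpose ?A ** transpose ?B) ** T ** (?B ** ?A)
      - (transpose ?A ** transpose ?B) ** Z ** \<Lambda>' ** ?A
      - transpose ?A ** transpose \<Lambda>' ** Z ** (?B ** ?A)"
    by (simp only: \<Omega>'_def matrix_mult_diff matrix_mul_assoc)
  then have "T = cov_velocity \<Lambda> \<Omega> \<Lambda>' \<Omega>'"
    by (simp add: cov_velocity_def inv flip: Z_def)
  then show ?thesis
    using that \<Lambda>' \<Omega>' by blast
qed

end

section \<open>Generic data\<close>

text \<open>Off the zero set of \<open>d\<close> the function is a polynomial divided by a power of \<open>d\<close>.\<close>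

definition regular_off :: "(complex^'m^'m \<Rightarrow> complex) \<Rightarrow> (complex^'m^'m \<Rightarrow> complex) \<Rightarrow> bool" where
  "regular_off d f \<longleftrightarrow> (\<exists>N q. matrix_poly q \<and> (\<forall>S. d S \<noteq> 0 \<longrightarrow> d S ^ N * f S = q S))"

lemma matrix_poly_power: "matrix_poly p \<Longrightarrow> matrix_poly (\<lambda>A. p A ^ n)"
  by (induction n) (auto intro: matrix_poly.intros)

lemma regular_off_matrix_poly: "matrix_poly p \<Longrightarrow> regular_off d p"
  unfolding regular_off_def by (intro exI[of _ 0] exI[of _ p]) simp

lemma regular_off_mult:
  assumes "regular_off d f" "regular_off d g"
  shows "regular_off d (\<lambda>S. f S * g S)"
proof -
  obtain N q M r where *: "matrix_poly q" "matrix_poly r"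
    "\<And>S. d S \<noteq> 0 \<Longrightarrow> d S ^ N * f S = q S" "\<And>S. d S \<noteq> 0 \<Longrightarrow> d S ^ M * g S = r S"
    using assms unfolding regular_off_def by blast
  have "d S ^ (N + M) * (f S * g S) = q S * r S" if "d S \<noteq> 0" for S
  proof -
    have "d S ^ (N + M) * (f S * g S) = (d S ^ N * f S) * (d S ^ M * g S)"
      by (simp add: power_add mult_ac)
    then show ?thesis by (simp only: *(3,4)[OF that])
  qed
  moreover have "matrix_poly (\<lambda>S. q S * r S)"
    by (intro matrix_poly.mult *)
  ultimately show ?thesis
    unfolding regular_off_def by blast
qed

lemma regular_off_add:
  assumes d: "matrix_poly d" and "regular_off d f" "regular_off d g"
  shows "regular_off d (\<lambda>S. f S + g S)"
proof -
  obtain N q M r where *: "matrix_poly q" "matrix_poly r"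
    "\<And>S. d S \<noteq> 0 \<Longrightarrow> d S ^ N * f S = q S" "\<And>S. d S \<noteq> 0 \<Longrightarrow> d S ^ M * g S = r S"
    using assms unfolding regular_off_def by blast
  have "d S ^ (N + M) * (f S + g S) = d S ^ M * q S + d S ^ N * r S" if "d S \<noteq> 0" for S
  proof -
    have "d S ^ (N + M) * (f S + g S) = d S ^ M * (d S ^ N * f S) + d S ^ N * (d S ^ M * g S)"
      by (simp add: power_add algebra_simps)
    then show ?thesis by (simp only: *(3,4)[OF that])
  qed
  moreover have "matrix_poly (\<lambda>S. d S ^ M * q S + d S ^ N * r S)"
    by (intro matrix_poly.add matrix_poly.mult matrix_poly_power d *)
  ultimately show ?thesis
    unfolding regular_off_def by blast
qed

lemma regular_off_sum:
  assumes "matrix_poly d" "\<And>x. x \<in> I \<Longrightarrow> regular_off d (f x)"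
  shows "regular_off d (\<lambda>S. \<Sum>x\<in>I. f x S)"
  using assms(2)
  by (induction I rule: infinite_finite_induct)
     (simp_all add: regular_off_matrix_poly matrix_poly.const regular_off_add[OF assms(1)])

lemma regular_off_prod:
  assumes "\<And>x. x \<in> I \<Longrightarrow> regular_off d (f x)"
  shows "regular_off d (\<lambda>S. \<Prod>x\<in>I. f x S)"
  using assms
  by (induction I rule: infinite_finite_induct)
     (simp_all add: regular_off_matrix_poly matrix_poly.const regular_off_mult)

lemma regular_off_diff:
  assumes "matrix_poly d" "regular_off d f" "regular_off d g"
  shows "regular_off d (\<lambda>S. f S - g S)"
proof -
  have "regular_off d (\<lambda>S. - 1 * g S)"
    by (intro regular_off_mult regular_off_matrix_poly[OF matrix_poly.const] assms)
  from regular_off_add[OF assms(1,2) this] show ?thesis by simp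
qed

lemma regular_off_compose:
  assumes "matrix_poly p" and d: "matrix_poly d" and T: "\<And>i j. regular_off d (\<lambda>S. T S $ i $ j)"
  shows "regular_off d (\<lambda>S. p (T S))"
  using assms(1)
proof induction
  case (const c)
  show ?case by (intro regular_off_matrix_poly matrix_poly.const)
qed (simp_all add: T regular_off_add[OF d] regular_off_mult)

lemma regular_off_matrix_mult:
  assumes "matrix_poly d"
    and "\<And>i j. regular_off d (\<lambda>S. T S $ i $ j)" "\<And>i j. regular_off d (\<lambda>S. R S $ i $ j)"
  shows "regular_off d (\<lambda>S. (T S ** R S) $ i $ j)"
  unfolding matrix_mult_entry by (intro regular_off_sum regular_off_mult assms)

definition parent_dets :: "('m \<times> 'm) set \<Rightarrow> complex^'m^'m \<Rightarrow> complex" where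
  "parent_dets E S = (\<Prod>j\<in>UNIV. parent_det E j S)"

lemma matrix_poly_parent_dets: "matrix_poly (parent_dets E)"
  unfolding parent_dets_def [abs_def] by (intro matrix_poly_prod matrix_poly_parent_det)

lemma regular_off_regression:
  "regular_off (parent_dets E) (\<lambda>S. regression E S $ k $ j)"
proof -
  let ?q = "\<lambda>S. coef_num E S k j * (\<Prod>l\<in>UNIV - {j}. parent_det E l S)"
  have "matrix_poly ?q"
    by (intro matrix_poly.mult matrix_poly_coef_num matrix_poly_prod matrix_poly_parent_det)
  moreover have "parent_dets E S ^ 1 * regression E S $ k $ j = ?q S" if "parent_dets E S \<noteq> 0" for S
  proof -
    have "parent_dets E S = parent_det E j S * (\<Prod>l\<in>UNIV - {j}. parent_det E l S)"
      unfolding parent_dets_def by (rule prod.remove) auto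
    then show ?thesis
      using that by (simp add: regression_def)
  qed
  ultimately show ?thesis
    unfolding regular_off_def by blast
qed

context ordered_dag
begin

lemma regular_off_resid_var: "regular_off (parent_dets E) (\<lambda>S. resid_var E S $ i $ j)"
proof (cases "i = j")
  case True
  then show ?thesis
    unfolding resid_var_def vec_lambda_beta one_minus_transpose_mult_entry
    by (simp add: regular_off_diff regular_off_sum regular_off_mult regular_off_regression
        regular_off_matrix_poly matrix_poly.entry matrix_poly_parent_dets)
qed (simp add: resid_var_def regular_off_matrix_poly matrix_poly.const)

lemma regular_off_mle: "regular_off (parent_dets E) (\<lambda>S. mle E S $ i $ j)"
proof -
  have reg: "regular_off (parent_dets E) (\<lambda>S. (mat 1 - regression E S) $ k $ l)" for k l
    unfolding vector_minus_component
    by (intro regular_off_diff regular_off_regression regular_off_matrix_poly matrix_poly.const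
        matrix_poly_parent_dets)
  have inv: "matrix_inv (mat 1 - regression E S) $ k $ l
      = det (\<chi> i j. if j = k then mat 1 $ i $ l else (mat 1 - regression E S) $ i $ j)"
    for S :: "(complex, 'm) square_matrix" and k l
  proof -
    have "det (mat 1 - regression E S) = 1"
      by (rule det_one_minus[OF edge_supported_regression])
    then show ?thesis by (simp add: matrix_inv_entry)
  qed
  have "regular_off (parent_dets E) (\<lambda>S. matrix_inv (mat 1 - regression E S) $ k $ l)" for k l
    unfolding inv
  proof (rule regular_off_compose[OF matrix_poly_det[OF poly_map_id] matrix_poly_parent_dets])
    show "regular_off (parent_dets E)
      (\<lambda>S. (\<chi> i j. if j = k then mat 1 $ i $ l else (mat 1 - regression E S) $ i $ j) $ a $ b)" for a b
      by (cases "b = k") (simp_all add: reg regular_off_matrix_poly matrix_poly.const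
          del: vector_minus_component)
  qed
  then show ?thesis
    unfolding mle_def sem_cov_def
    by (intro regular_off_matrix_mult matrix_poly_parent_dets regular_off_resid_var) simp_all
qed

text \<open>The identity matrix as data is fixed by the estimator; it witnesses that the polynomial which
excludes special data is not identically zero.\<close>

lemma mle_identity:
  "parent_det E j (mat 1 :: (complex, 'm) square_matrix) = 1"
  "resid_var E (mat 1 :: (complex, 'm) square_matrix) = mat 1"
  "mle E (mat 1 :: (complex, 'm) square_matrix) = mat 1"
proof -
  let ?I = "mat 1 :: (complex, 'm) square_matrix"
  have "parent_gram E j ?I = mat 1" for j
    by (auto simp: vec_eq_iff parent_gram_def mat_1_entry)
  then show det: "parent_det E j ?I = 1" for j
    by (simp add: parent_det_def)
  have "coef_num E ?I k j = 0 $ k $ j * parent_det E j ?I" for k j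
  proof (rule coef_num_eq)
    show "?I \<in> sym_mats" by (simp add: sym_mats_def)
    show "(transpose (mat 1 - 0) ** ?I) $ j $ i = 0" if "(i, j) \<in> E" for i
      using edge_less[OF that] by (simp add: mat_1_entry)
  qed (rule edge_supported_0)
  then have reg: "regression E ?I = 0"
    by (simp add: regression_def vec_eq_iff)
  then show resid: "resid_var E ?I = mat 1"
    by (simp add: resid_var_def vec_eq_iff mat_1_entry)
  have "matrix_inv ?I = mat 1"
    by (rule matrix_inv_eqI) simp
  then show "mle E ?I = mat 1"
    by (simp add: mle_def reg resid sem_cov_def)
qed

text \<open>The conditions on \<open>S\<close> are nonvanishing of functions that are rational with denominators built
from the parent determinants of \<open>S\<close>, so they amount to nonvanishing of one polynomial.\<close>

lemma generic_polynomial: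
  "\<exists>h. matrix_poly h \<and> h (mat 1 :: (complex, 'm) square_matrix) \<noteq> 0 \<and>
    (\<forall>S j. h S \<noteq> 0 \<longrightarrow>
      parent_det E j S \<noteq> 0 \<and> resid_var E S $ j $ j \<noteq> 0 \<and> parent_det E j (mle E S) \<noteq> 0)"
proof -
  define f where "f S = (\<Prod>j\<in>UNIV. resid_var E S $ j $ j) * parent_dets E (mle E S)"
    for S :: "(complex, 'm) square_matrix"
  have "regular_off (parent_dets E) f"
    unfolding f_def [abs_def]
    by (intro regular_off_mult regular_off_prod regular_off_resid_var
        regular_off_compose[OF matrix_poly_parent_dets matrix_poly_parent_dets] regular_off_mle)
  then obtain N q where q: "matrix_poly q" "\<And>S. parent_dets E S \<noteq> 0 \<Longrightarrow> parent_dets E S ^ N * f S = q S"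
    unfolding regular_off_def by blast
  define h where "h S = parent_dets E S * q S" for S
  have h: "parent_dets E S \<noteq> 0" "f S \<noteq> 0" if "h S \<noteq> 0" for S
    using that q(2)[of S] by (auto simp: h_def)
  show ?thesis
  proof (intro exI[of _ h] conjI allI impI)
    show "matrix_poly h"
      unfolding h_def [abs_def] by (intro matrix_poly.mult matrix_poly_parent_dets q)
    have "parent_dets E (mat 1 :: (complex, 'm) square_matrix) = 1"
      by (simp add: parent_dets_def mle_identity)
    moreover from this have "f (mat 1) = 1"
      by (simp add: f_def mle_identity mat_1_entry)
    ultimately show "h (mat 1) \<noteq> 0"
      using q(2)[of "mat 1"] by (simp add: h_def)
    show "parent_det E j S \<noteq> 0" if "h S \<noteq> 0" for S j
      using h(1)[OF that] by (simp add: parent_dets_def)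
    show "resid_var E S $ j $ j \<noteq> 0" "parent_det E j (mle E S) \<noteq> 0" if "h S \<noteq> 0" for S j
      using h(2)[OF that] by (simp_all add: f_def parent_dets_def)
  qed
qed

section \<open>The maximum likelihood degree\<close>

text \<open>The normal equations hold by construction, and the velocities exhaust the Zariski tangent space.\<close>

lemma mle_critical:
  fixes S :: "(complex, 'm) square_matrix"
  assumes S: "S \<in> sym_mats" and "n > 0"
    and det: "\<And>j. parent_det E j S \<noteq> 0" and var: "\<And>j. resid_var E S $ j $ j \<noteq> 0"
    and det_mle: "\<And>j. parent_det E j (mle E S) \<noteq> 0"
  shows "mle E S \<in> nonsingular_complex_critical_points n (zariski_closure (dag_model E)) S"
proof -
  let ?\<Lambda> = "regression E S" and ?\<Omega> = "resid_var E S"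
  note \<Lambda> = edge_supported_regression[of E S] and \<Omega> = diagonal_resid_var[of E S]
  have nz: "det (mle E S) \<noteq> 0"
    using var by (simp add: mle_def det_sem_cov[OF \<Lambda> \<Omega>])
  have sym: "mle E S \<in> sym_mats"
    unfolding mle_def by (rule sem_cov_sym[OF \<Omega>])
  have "trace (score n S (mle E S) ** T) = 0"
    if T: "T \<in> zariski_tangent_space (zariski_closure (dag_model E)) (mle E S)" for T
  proof -
    obtain \<Lambda>' \<Omega>' where "edge_supported E \<Lambda>'" "diagonal \<Omega>'" "T = cov_velocity ?\<Lambda> ?\<Omega> \<Lambda>' \<Omega>'"
      using zariski_tangent_is_velocity[OF \<Lambda> \<Omega> det_mle[unfolded mle_def] T[unfolded mle_def]] .
    moreover have "2 / real n \<noteq> 0" using \<open>n > 0\<close> by simp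
    moreover have "S = sem_cov ?\<Lambda> ?\<Omega>
        + (2 / real n) *\<^sub>R (sem_cov ?\<Lambda> ?\<Omega> ** score n S (mle E S) ** sem_cov ?\<Lambda> ?\<Omega>)"
      using score_solve[OF nz \<open>n > 0\<close>, of S] by (simp add: mle_def)
    ultimately show ?thesis
      using normal_equationsD[OF \<Lambda> \<Omega> var _ score_sym[OF sym S nz] _
          normal_equations_regression[OF S det]] by blast
  qed
  then have "score n S (mle E S)
      \<in> sym_orthogonal (zariski_tangent_space (zariski_closure (dag_model E)) (mle E S))"
    by (simp add: sym_orthogonal_def score_sym[OF sym S nz])
  moreover have "nonsingular_point (zariski_closure (dag_model E)) (mle E S)"
    unfolding mle_def using det_mle
    by (intro nonsingular_point_sem_cov[OF \<Lambda> \<Omega>]) (simp add: mle_def)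
  ultimately show ?thesis
    unfolding nonsingular_complex_critical_points_def
    using nz is_complex_score_iff[OF sym S] by blast
qed

theorem maximum_likelihood_degree_one:
  assumes "n > 0"
  shows "has_ML_degree n (dag_model E) 1"
proof -
  let ?crit = "nonsingular_complex_critical_points n (zariski_closure (dag_model E))"
  obtain h where h: "matrix_poly h" "h (mat 1 :: (complex, 'm) square_matrix) \<noteq> 0"
    "\<And>S j. h S \<noteq> 0 \<Longrightarrow> parent_det E j S \<noteq> 0"
    "\<And>S j. h S \<noteq> 0 \<Longrightarrow> resid_var E S $ j $ j \<noteq> 0"
    "\<And>S j. h S \<noteq> 0 \<Longrightarrow> parent_det E j (mle E S) \<noteq> 0"
    using generic_polynomial by blast
  have "?crit S = {mle E S}" if S: "S \<in> sym_mats" "h S \<noteq> 0" for S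
  proof
    show "{mle E S} \<subseteq> ?crit S"
      using mle_critical[OF S(1) assms h(3-5)[OF S(2)]] by simp
    show "?crit S \<subseteq> {mle E S}"
    proof
      fix Z assume "Z \<in> ?crit S"
      then obtain g where Z: "Z \<in> zariski_closure (dag_model E)" and g: "is_complex_score n S Z g"
        "g \<in> sym_orthogonal (zariski_tangent_space (zariski_closure (dag_model E)) Z)"
        by (auto simp: nonsingular_complex_critical_points_def nonsingular_point_def)
      have "Z \<in> sym_mats" using Z by (simp add: zariski_closure_def)
      then have "det Z \<noteq> 0" "g = score n S Z"
        using g(1) is_complex_score_iff S(1) by blast+
      then show "Z \<in> {mle E S}"
        using critical_point_eq_mle[OF Z _ S(1) assms _ h(3)[OF S(2)]] g(2) by simp
    qed
  qed
  moreover have "(mat 1 :: (complex, 'm) square_matrix) \<in> sym_mats"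
    by (simp add: sym_mats_def)
  ultimately show ?thesis
    unfolding has_ML_degree_def using h(1,2) by (intro exI[of _ h]) auto
qed

end

theorem theorem4p1:
  fixes E :: "('m::{finite,linorder} \<times> 'm) set" and n :: nat
  assumes "topologically_ordered_dag E"
    and "n > 0"
  shows "has_ML_degree n (dag_model E) 1 \<and>
    (\<forall>\<Sigma> \<in> dag_model E.
       log_Voronoi n (dag_model E) \<Sigma> = log_normal_spectrahedron n (dag_model E) \<Sigma>)"
proof -
  interpret ordered_dag E
    using assms(1) by unfold_locales (simp add: topologically_ordered_dag_def)
  show ?thesis
    using maximum_likelihood_degree_one log_Voronoi_eq_spectrahedron assms(2) by blast
qed

end
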